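(* Let $k\in\mathbb N\sqcup\{\mathrm{lip},\infty\}$. If $G$ is $C^k$-semiregular, then $G$ is Mackey $k$-continuous.
   Context: $\mathbb N=\{0,1,2,\dots\}$. $G$ is a Lie group in Milnor's infinite-dimensional sense: a smooth Hausdorff manifold modelled on a real Hausdorff locally convex vector space $E$ (no completeness assumed) with smooth group operations, where $C^k$ is understood in Bastiani's sense (iterated directional derivatives of order $p\le k$ exist and define continuous maps $(x,v_1,\dots,v_p)\mapsto d^p_xf(v_1,\dots,v_p)$). $e$ is the unit, $\mathfrak g=T_eG$, $R_g(h)=hg$. $\mathfrak P$ is the set of continuous seminorms on $E$, $\Xi$ a fixed chart of $G$ around $e$ with $\Xi(e)=0$ (and convex image), and $p_{\mathfrak g}:=p\circ d_e\Xi$ for $p\in\mathfrak P$ (a continuous seminorm on $\mathfrak g$). Curves: a curve on a compact interval is of class $C^k$ ($k\in\mathbb N\sqcup\{\infty\}$) if it is the restriction of a $C^k$-curve on an open interval. $C^{\mathrm{lip}}([0,1],\mathfrak g)$ is the set of curves $\gamma$ with $\mathrm{Lip}(p_{\mathfrak g},\gamma):=\sup_{t\ne t'}p_{\mathfrak g}(\gamma(t)-\gamma(t'))/|t-t'|<\infty$ for all $p\in\mathfrak P$. Write $s\preceq k$ for: $s=\mathrm{lip}$ if $k=\mathrm{lip}$; $s\in\mathbb N$, $s\le k$ if $k\in\mathbb N$; $s\in\mathbb N$ if $k=\infty$. Put $p^{s}_{\mathfrak g,\infty}(\gamma):=\sup\{p_{\mathfrak g}(\gamma^{(m)}(t)):0\le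 m\le s,\ t\in[0,1]\}$ for $s\in\mathbb N$ and $p^{\mathrm{lip}}_{\mathfrak g,\infty}(\gamma):=\max(\sup_tp_{\mathfrak g}(\gamma(t)),\mathrm{Lip}(p_{\mathfrak g},\gamma))$. Evolution: for $\mu\in C^1([0,1],G)$ let $\delta^r(\mu)(t)=d_{\mu(t)}R_{\mu(t)^{-1}}(\dot\mu(t))$, and $\mathrm D=\{\delta^r(\mu):\mu\in C^1([0,1],G)\}$. On $\mathrm D$, $\mathrm{Evol}(\delta^r(\mu)):=\mu\cdot\mu(0)^{-1}$ is well defined. $\mathrm D_k:=\mathrm D\cap C^k([0,1],\mathfrak g)$. $G$ is $C^k$-semiregular if $\mathrm D_k=C^k([0,1],\mathfrak g)$. Mackey convergence: $\{\phi_n\}\rightharpoonup_{\mathfrak m.k}\phi$ for $\phi_n,\phi\in C^k([0,1],\mathfrak g)$ means that there are constants $c^s_p\ge0$, $l^s_p\in\mathbb N$ ($p\in\mathfrak P$, $s\preceq k$) and a sequence $\lambda_n\ge0$, $\lambda_n\to0$ (independent of $p,s$), with $p^s_{\mathfrak g,\infty}(\phi-\phi_n)\le c^s_p\cdot\lambda_n$ for all $n\ge l^s_p$, $p\in\mathfrak P$, $s\preceq k$. $G$ is Mackey $k$-continuous if for all $\phi_n,\phi\in\mathrm D_k$ with $\{\phi_n\}\rightharpoonup_{\mathfrak m.k}\phi$ we have $\mathrm{Evol}(\phi_n)\to\mathrm{Evol}(\phi)$ uniformly, i.e. for each neighbourhood $U$ of $e$ there is $n_U$ with $\mathrm{Evol}(\phi)(t)^{-1}\mathrm{Evol}(\phi_n)(t)\in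 U$ for all $t\in[0,1]$, $n\ge n_U$. *)

theory Defs
  imports "HOL-Analysis.Analysis" "HOL-Algebra.Group"
begin

section \<open>Hausdorff locally convex spaces\<close>

text \<open>The condition on \<open>V\<close> in the class axiom is the definition of \<^const>\<open>convex\<close>, which cannot be used
  inside of the class specification.\<close>

class locally_convex_space = t2_space + real_vector + topological_ab_group_add +
  assumes tendsto_scaleR_Pair_lcs:
    "LIM z (nhds (a::real) \<times>\<^sub>F nhds x). fst z *\<^sub>R snd z :> nhds (a *\<^sub>R x)"
  and locally_convex_axiom:
    "open U \<Longrightarrow> 0 \<in> U \<Longrightarrow> \<exists>V. open V \<and> 0 \<in> V \<and>
       (\<forall>x\<in>V. \<forall>y\<in>V. \<forall>u\<ge>0. \<forall>v\<ge>0. u + v = 1 \<longrightarrow> u *\<^sub>R x + v *\<^sub>R y \<in> V) \<and> V \<subseteq> U"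

lemma locally_convex:
  fixes U :: "'e::locally_convex_space set"
  assumes "open U" "0 \<in> U"
  obtains V where "open V" "0 \<in> V" "convex V" "V \<subseteq> U"
  using locally_convex_axiom[OF assms] unfolding convex_def[symmetric] by blast

instance real_normed_vector \<subseteq> locally_convex_space
proof
  fix a :: real and x :: 'a
  show "LIM z (nhds a \<times>\<^sub>F nhds x). fst z *\<^sub>R snd z :> nhds (a *\<^sub>R x)"
    by (intro tendsto_scaleR filterlim_fst filterlim_snd)
next
  fix U :: "'a set"
  assume "open U" "0 \<in> U"
  then obtain e where "e > 0" "ball 0 e \<subseteq> U"
    by (meson open_contains_ball)
  then show "\<exists>V. open V \<and> 0 \<in> V \<and>
      (\<forall>x\<in>V. \<forall>y\<in>V. \<forall>u\<ge>0. \<forall>v\<ge>0. u + v = 1 \<longrightarrow> u *\<^sub>R x + v *\<^sub>R y \<in> V) \<and> V \<subseteq> U"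
    unfolding convex_def[symmetric] using convex_ball[of 0 e]
    by (intro exI[of _ "ball 0 e"]) simp
qed

instance prod :: (topological_monoid_add, topological_monoid_add) topological_monoid_add
proof
  fix a b :: "'a \<times> 'b"
  have "((\<lambda>z. (fst (fst z) + fst (snd z), snd (fst z) + snd (snd z)))
           \<longlongrightarrow> (fst a + fst b, snd a + snd b)) (nhds a \<times>\<^sub>F nhds b)"
    by (intro tendsto_Pair tendsto_add tendsto_fst tendsto_snd filterlim_fst filterlim_snd)
  then show "LIM x (nhds a \<times>\<^sub>F nhds b). fst x + snd x :> nhds (a + b)"
    by (simp add: plus_prod_def)
qed

instance prod :: (topological_comm_monoid_add, topological_comm_monoid_add) topological_comm_monoid_add ..

instance prod :: (topological_group_add, topological_group_add) topological_group_add
proof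
  fix a :: "'a \<times> 'b"
  have "((\<lambda>z. (- fst z, - snd z)) \<longlongrightarrow> (- fst a, - snd a)) (nhds a)"
    by (intro tendsto_Pair tendsto_minus tendsto_fst tendsto_snd filterlim_ident)
  then show "(uminus \<longlongrightarrow> - a) (nhds a)"
    by (simp add: uminus_prod_def[abs_def])
qed

instance prod :: (topological_ab_group_add, topological_ab_group_add) topological_ab_group_add ..

instance prod :: (locally_convex_space, locally_convex_space) locally_convex_space
proof
  fix a :: real and x :: "'a \<times> 'b"
  have f: "LIM z (nhds a \<times>\<^sub>F nhds x). (fst z, fst (snd z)) :> nhds a \<times>\<^sub>F nhds (fst x)"
    and s: "LIM z (nhds a \<times>\<^sub>F nhds x). (fst z, snd (snd z)) :> nhds a \<times>\<^sub>F nhds (snd x)"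
    by (intro filterlim_Pair tendsto_fst tendsto_snd filterlim_fst filterlim_snd)+
  have "((\<lambda>z. (fst z *\<^sub>R fst (snd z), fst z *\<^sub>R snd (snd z)))
           \<longlongrightarrow> (a *\<^sub>R fst x, a *\<^sub>R snd x)) (nhds a \<times>\<^sub>F nhds x)"
    using filterlim_compose[OF tendsto_scaleR_Pair_lcs f]
      filterlim_compose[OF tendsto_scaleR_Pair_lcs s]
    by (intro tendsto_Pair) simp_all
  then show "LIM z (nhds a \<times>\<^sub>F nhds x). fst z *\<^sub>R snd z :> nhds (a *\<^sub>R x)"
    by (simp add: scaleR_prod_def)
next
  fix U :: "('a \<times> 'b) set"
  assume "open U" "0 \<in> U"
  then obtain P Q where PQ: "open P" "open Q" "(0, 0) \<in> P \<times> Q" "P \<times> Q \<subseteq> U"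
    by (metis open_prod_def zero_prod_def)
  obtain V where V: "open V" "0 \<in> V" "convex V" "V \<subseteq> P"
    using locally_convex[of P] PQ by auto
  obtain W where W: "open W" "0 \<in> W" "convex W" "W \<subseteq> Q"
    using locally_convex[of Q] PQ by auto
  have "open (V \<times> W) \<and> 0 \<in> V \<times> W \<and> convex (V \<times> W) \<and> V \<times> W \<subseteq> U"
    using V(1-3) W(1-3) order_trans[OF Sigma_mono[OF V(4) W(4)] PQ(4)]
    by (simp add: open_Times convex_Times zero_prod_def)
  then show "\<exists>V. open V \<and> 0 \<in> V \<and>
      (\<forall>x\<in>V. \<forall>y\<in>V. \<forall>u\<ge>0. \<forall>v\<ge>0. u + v = 1 \<longrightarrow> u *\<^sub>R x + v *\<^sub>R y \<in> V) \<and> V \<subseteq> U"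
    unfolding convex_def[symmetric] by (rule exI)
qed

definition continuous_seminorm :: "('e::locally_convex_space \<Rightarrow> real) \<Rightarrow> bool" where
  "continuous_seminorm p \<longleftrightarrow>
     (\<forall>x y. p (x + y) \<le> p x + p y) \<and> (\<forall>a x. p (a *\<^sub>R x) = \<bar>a\<bar> * p x) \<and> continuous_on UNIV p"


section \<open>Bastiani differentiability\<close>

definition has_dir_deriv ::
  "('e::locally_convex_space \<Rightarrow> 'f::locally_convex_space) \<Rightarrow> 'e \<Rightarrow> 'e \<Rightarrow> 'f \<Rightarrow> bool" where
  "has_dir_deriv f x v d \<longleftrightarrow> ((\<lambda>h::real. (f (x + h *\<^sub>R v) - f x) /\<^sub>R h) \<longlongrightarrow> d) (at 0)"

definition dir_deriv ::
  "('e::locally_convex_space \<Rightarrow> 'f::locally_convex_space) \<Rightarrow> 'e \<Rightarrow> 'e \<Rightarrow> 'f" where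
  "dir_deriv f x v = Lim (at 0) (\<lambda>h::real. (f (x + h *\<^sub>R v) - f x) /\<^sub>R h)"

text \<open>\<open>iter_deriv p f x v\<close> is $d^p_x f(v_1, \ldots, v_p)$. The directions are the entries
  \<open>v 0, \<dots>, v (p - 1)\<close> of a sequence, whose other entries are ignored, so that all orders have
  the same type; continuity in \<open>(x, v)\<close> for the product topology on sequences is then
  continuity on $U \times E^p$.\<close>

primrec iter_deriv ::
  "nat \<Rightarrow> ('e::locally_convex_space \<Rightarrow> 'f::locally_convex_space) \<Rightarrow> 'e \<Rightarrow> (nat \<Rightarrow> 'e) \<Rightarrow> 'f" where
  "iter_deriv 0 f x v = f x"
| "iter_deriv (Suc p) f x v = dir_deriv (\<lambda>y. iter_deriv p f y v) x (v p)"

definition bastiani ::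
  "enat \<Rightarrow> 'e::locally_convex_space set \<Rightarrow> ('e \<Rightarrow> 'f::locally_convex_space) \<Rightarrow> bool" where
  "bastiani k U f \<longleftrightarrow> open U \<and>
     (\<forall>p. enat (Suc p) \<le> k \<longrightarrow>
        (\<forall>x\<in>U. \<forall>v. \<exists>d. has_dir_deriv (\<lambda>y. iter_deriv p f y v) x (v p) d)) \<and>
     (\<forall>p. enat p \<le> k \<longrightarrow> continuous_on (U \<times> UNIV) (\<lambda>(x, v). iter_deriv p f x v))"


section \<open>Manifolds modelled on a locally convex space\<close>

text \<open>A chart is a domain together with a map that is only relevant on this domain.\<close>

type_synonym ('m, 'e) chart = "'m set \<times> ('m \<Rightarrow> 'e)"

abbreviation cdom :: "('m, 'e) chart \<Rightarrow> 'm set" where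
  "cdom c \<equiv> fst c"

abbreviation cmap :: "('m, 'e) chart \<Rightarrow> 'm \<Rightarrow> 'e" where
  "cmap c \<equiv> snd c"

abbreviation cinv :: "('m, 'e) chart \<Rightarrow> 'e \<Rightarrow> 'm" where
  "cinv c \<equiv> inv_into (cdom c) (cmap c)"

definition topological_chart :: "('m::topological_space, 'e::locally_convex_space) chart \<Rightarrow> bool" where
  "topological_chart c \<longleftrightarrow> open (cdom c) \<and> open (cmap c ` cdom c) \<and>
     homeomorphism (cdom c) (cmap c ` cdom c) (cmap c) (cinv c)"

definition smoothly_compatible ::
  "('m::topological_space, 'e::locally_convex_space) chart \<Rightarrow> ('m, 'e) chart \<Rightarrow> bool" where
  "smoothly_compatible c d \<longleftrightarrow>
     bastiani \<infinity> (cmap c ` (cdom c \<inter> cdom d)) (cmap d \<circ> cinv c) \<and>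
     bastiani \<infinity> (cmap d ` (cdom c \<inter> cdom d)) (cmap c \<circ> cinv d)"

definition smooth_atlas :: "('m::topological_space, 'e::locally_convex_space) chart set \<Rightarrow> bool" where
  "smooth_atlas A \<longleftrightarrow> (\<forall>c\<in>A. topological_chart c) \<and> (\<Union>c\<in>A. cdom c) = UNIV \<and>
     (\<forall>c\<in>A. \<forall>d\<in>A. smoothly_compatible c d)"

definition smooth_structure :: "('m::topological_space, 'e::locally_convex_space) chart set \<Rightarrow> bool" where
  "smooth_structure A \<longleftrightarrow> smooth_atlas A \<and>
     (\<forall>c. topological_chart c \<and> (\<forall>d\<in>A. smoothly_compatible c d) \<longrightarrow> c \<in> A)"

definition model_atlas :: "('e, 'e) chart set" where
  "model_atlas = {(UNIV, id)}"

definition prod_atlas ::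
  "('m, 'e) chart set \<Rightarrow> ('n, 'f) chart set \<Rightarrow> ('m \<times> 'n, 'e \<times> 'f) chart set" where
  "prod_atlas A B = {(cdom c \<times> cdom d, map_prod (cmap c) (cmap d)) | c d. c \<in> A \<and> d \<in> B}"

definition Ck_map ::
  "enat \<Rightarrow> ('m::topological_space, 'e::locally_convex_space) chart set \<Rightarrow>
   ('n::topological_space, 'f::locally_convex_space) chart set \<Rightarrow> 'm set \<Rightarrow> ('m \<Rightarrow> 'n) \<Rightarrow> bool" where
  "Ck_map k A B S f \<longleftrightarrow> open S \<and> continuous_on S f \<and>
     (\<forall>c\<in>A. \<forall>d\<in>B. bastiani k (cmap c ` {x \<in> S \<inter> cdom c. f x \<in> cdom d}) (cmap d \<circ> f \<circ> cinv c))"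


subsection \<open>Tangent vectors\<close>

text \<open>A tangent vector at \<open>x\<close> is the compatible family of its coordinates in all charts around
  \<open>x\<close>, i.e. the set of all pairs \<open>(c, d\<^sub>xc(X))\<close>; it is thus an equivalence class of pairs of a
  chart and a vector.\<close>

type_synonym ('m, 'e) tvec = "(('m, 'e) chart \<times> 'e) set"

definition charts_at :: "('m, 'e) chart set \<Rightarrow> 'm \<Rightarrow> ('m, 'e) chart set" where
  "charts_at A x = {c \<in> A. x \<in> cdom c}"

definition tangent_space ::
  "('m, 'e::locally_convex_space) chart set \<Rightarrow> 'm \<Rightarrow> ('m, 'e) tvec set" where
  "tangent_space A x =
     {{(d, dir_deriv (cmap d \<circ> cinv c) (cmap c x) v) | d. d \<in> charts_at A x} | c v. c \<in> charts_at A x}"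

text \<open>\<open>chart_deriv c X\<close> is \<open>d\<^sub>xc(X)\<close> for a tangent vector \<open>X\<close> at \<open>x\<close>. These linear
  isomorphisms, for \<open>c\<close> a chart around \<open>x\<close>, define the topological vector space structure of the
  tangent space at \<open>x\<close>.\<close>

definition chart_deriv :: "('m, 'e) chart \<Rightarrow> ('m, 'e) tvec \<Rightarrow> 'e" where
  "chart_deriv c X = (THE v. (c, v) \<in> X)"

definition tvec_diff :: "('m, 'e::locally_convex_space) tvec \<Rightarrow> ('m, 'e) tvec \<Rightarrow> ('m, 'e) tvec" where
  "tvec_diff X Y = {(c, v - w) | c v w. (c, v) \<in> X \<and> (c, w) \<in> Y}"

definition tangent_map ::
  "('n, 'f::locally_convex_space) chart set \<Rightarrow> ('m \<Rightarrow> 'n) \<Rightarrow> 'm \<Rightarrow>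
   ('m, 'e::locally_convex_space) tvec \<Rightarrow> ('n, 'f) tvec" where
  "tangent_map B f x X =
     {(d, dir_deriv (cmap d \<circ> f \<circ> cinv c) (cmap c x) v) | c v d. (c, v) \<in> X \<and> d \<in> charts_at B (f x)}"


subsection \<open>Curves on the unit interval\<close>

text \<open>Curves on $[0,1]$ are total functions whose values outside of $[0,1]$ are ignored; at the
  end points, derivatives are one-sided.\<close>

definition curve_deriv :: "(real \<Rightarrow> 'e::locally_convex_space) \<Rightarrow> real \<Rightarrow> 'e" where
  "curve_deriv \<gamma> t = Lim (at t within {0..1}) (\<lambda>s. (\<gamma> s - \<gamma> t) /\<^sub>R (s - t))"

definition Ck_curve :: "enat \<Rightarrow> (real \<Rightarrow> 'e::locally_convex_space) \<Rightarrow> bool" where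
  "Ck_curve k \<gamma> \<longleftrightarrow>
     (\<exists>a b \<eta>. a < 0 \<and> 1 < b \<and> bastiani k {a<..<b} \<eta> \<and> (\<forall>t\<in>{0..1}. \<eta> t = \<gamma> t))"

definition C1_curves ::
  "('m::topological_space, 'e::locally_convex_space) chart set \<Rightarrow> (real \<Rightarrow> 'm) set" where
  "C1_curves A = {\<mu>. \<exists>a b \<nu>. a < 0 \<and> 1 < b \<and> Ck_map 1 model_atlas A {a<..<b} \<nu> \<and>
     (\<forall>t\<in>{0..1}. \<nu> t = \<mu> t)}"

definition velocity ::
  "('m, 'e::locally_convex_space) chart set \<Rightarrow> (real \<Rightarrow> 'm) \<Rightarrow> real \<Rightarrow> ('m, 'e) tvec" where
  "velocity A \<mu> t = {(c, curve_deriv (cmap c \<circ> \<mu>) t) | c. c \<in> charts_at A (\<mu> t)}"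

text \<open>The \<open>m\<close>-th derivative of a curve in the fixed tangent space at \<open>x\<close>.\<close>

definition tvec_curve_deriv ::
  "('m, 'e::locally_convex_space) chart set \<Rightarrow> 'm \<Rightarrow> nat \<Rightarrow> (real \<Rightarrow> ('m, 'e) tvec) \<Rightarrow>
   real \<Rightarrow> ('m, 'e) tvec" where
  "tvec_curve_deriv A x m \<gamma> t =
     {(c, (curve_deriv ^^ m) (chart_deriv c \<circ> \<gamma>) t) | c. c \<in> charts_at A x}"


section \<open>Lie groups\<close>

datatype regularity = Fin nat | Lip | Infty

fun reg_prec :: "regularity \<Rightarrow> regularity \<Rightarrow> bool" (infix "\<preceq>" 50) where
  "Lip \<preceq> Lip \<longleftrightarrow> True"
| "Fin s \<preceq> Fin k \<longleftrightarrow> s \<le> k"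
| "Fin s \<preceq> Infty \<longleftrightarrow> True"
| "_ \<preceq> _ \<longleftrightarrow> False"

locale lie_group = group G
  for G :: "('g::t2_space, 'b) monoid_scheme" (structure) +
  fixes A :: "('g, 'e::locally_convex_space) chart set"
  assumes carrier_UNIV: "carrier G = UNIV"
    and smooth_structure: "smooth_structure A"
    and smooth_mult: "Ck_map \<infinity> (prod_atlas A A) A UNIV (\<lambda>(x, y). x \<otimes> y)"
    and smooth_inv: "Ck_map \<infinity> A A UNIV (\<lambda>x. inv x)"
begin

definition lie_algebra :: "('g, 'e) tvec set" where
  "lie_algebra = tangent_space A \<one>"

definition right_log_deriv :: "(real \<Rightarrow> 'g) \<Rightarrow> real \<Rightarrow> ('g, 'e) tvec" where
  "right_log_deriv \<mu> t = tangent_map A (\<lambda>h. h \<otimes> inv (\<mu> t)) (\<mu> t) (velocity A \<mu> t)"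

definition log_derivs :: "(real \<Rightarrow> ('g, 'e) tvec) set" where
  "log_derivs = {\<phi>. \<exists>\<mu>\<in>C1_curves A. \<forall>t\<in>{0..1}. \<phi> t = right_log_deriv \<mu> t}"

text \<open>Two $C^1$-curves with the same right logarithmic derivative differ by a right translation,
  so on $[0,1]$ the result does not depend on the choice.\<close>

definition Evol :: "(real \<Rightarrow> ('g, 'e) tvec) \<Rightarrow> real \<Rightarrow> 'g" where
  "Evol \<phi> = (SOME \<nu>. \<exists>\<mu>\<in>C1_curves A. (\<forall>t\<in>{0..1}. \<phi> t = right_log_deriv \<mu> t) \<and>
     \<nu> = (\<lambda>t. \<mu> t \<otimes> inv (\<mu> 0)))"

end

locale charted_lie_group = lie_group G A
  for G :: "('g::t2_space, 'b) monoid_scheme" (structure)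
    and A :: "('g, 'e::locally_convex_space) chart set" +
  fixes \<Xi> :: "('g, 'e) chart"
  assumes chart_Xi: "\<Xi> \<in> charts_at A \<one>"
    and Xi_one: "cmap \<Xi> \<one> = 0"
    and convex_Xi: "convex (cmap \<Xi> ` cdom \<Xi>)"
begin

definition p_lie :: "('e \<Rightarrow> real) \<Rightarrow> ('g, 'e) tvec \<Rightarrow> real" where
  "p_lie p X = p (chart_deriv \<Xi> X)"

definition difference_quotients :: "('e \<Rightarrow> real) \<Rightarrow> (real \<Rightarrow> ('g, 'e) tvec) \<Rightarrow> real set" where
  "difference_quotients p \<gamma> =
     {p_lie p (tvec_diff (\<gamma> t) (\<gamma> t')) / \<bar>t - t'\<bar> | t t'. t \<in> {0..1} \<and> t' \<in> {0..1} \<and> t \<noteq> t'}"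

definition Lip_const :: "('e \<Rightarrow> real) \<Rightarrow> (real \<Rightarrow> ('g, 'e) tvec) \<Rightarrow> real" where
  "Lip_const p \<gamma> = Sup (difference_quotients p \<gamma>)"

definition lie_curves :: "regularity \<Rightarrow> (real \<Rightarrow> ('g, 'e) tvec) set" where
  "lie_curves k = {\<gamma>. (\<forall>t\<in>{0..1}. \<gamma> t \<in> lie_algebra) \<and>
     (case k of
        Fin n \<Rightarrow> \<forall>c\<in>charts_at A \<one>. Ck_curve (enat n) (chart_deriv c \<circ> \<gamma>)
      | Infty \<Rightarrow> \<forall>c\<in>charts_at A \<one>. Ck_curve \<infinity> (chart_deriv c \<circ> \<gamma>)
      | Lip \<Rightarrow> \<forall>p. continuous_seminorm p \<longrightarrow> bdd_above (difference_quotients p \<gamma>))}"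

text \<open>The value for \<open>Infty\<close> is immaterial, since \<open>s \<preceq> k\<close> never holds for \<open>s = Infty\<close>.\<close>

definition curve_seminorm ::
  "('e \<Rightarrow> real) \<Rightarrow> regularity \<Rightarrow> (real \<Rightarrow> ('g, 'e) tvec) \<Rightarrow> real" where
  "curve_seminorm p s \<gamma> = (case s of
     Fin n \<Rightarrow> Sup {p_lie p (tvec_curve_deriv A \<one> m \<gamma> t) | m t. m \<le> n \<and> t \<in> {0..1}}
   | Lip \<Rightarrow> max (SUP t\<in>{0..1}. p_lie p (\<gamma> t)) (Lip_const p \<gamma>)
   | Infty \<Rightarrow> undefined)"

definition log_derivs_of_class :: "regularity \<Rightarrow> (real \<Rightarrow> ('g, 'e) tvec) set" where
  "log_derivs_of_class k = log_derivs \<inter> lie_curves k"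

definition semiregular :: "regularity \<Rightarrow> bool" where
  "semiregular k \<longleftrightarrow> log_derivs_of_class k = lie_curves k"

definition mackey_converges ::
  "regularity \<Rightarrow> (nat \<Rightarrow> real \<Rightarrow> ('g, 'e) tvec) \<Rightarrow> (real \<Rightarrow> ('g, 'e) tvec) \<Rightarrow> bool" where
  "mackey_converges k \<phi>s \<phi> \<longleftrightarrow>
     (\<exists>(C :: ('e \<Rightarrow> real) \<Rightarrow> regularity \<Rightarrow> real) (L :: ('e \<Rightarrow> real) \<Rightarrow> regularity \<Rightarrow> nat)
       (r :: nat \<Rightarrow> real).
        (\<forall>n. 0 \<le> r n) \<and> r \<longlonglongrightarrow> 0 \<and>
        (\<forall>p s. continuous_seminorm p \<and> s \<preceq> k \<longrightarrow> 0 \<le> C p s \<and>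
           (\<forall>n\<ge>L p s. curve_seminorm p s (\<lambda>t. tvec_diff (\<phi> t) (\<phi>s n t)) \<le> C p s * r n)))"

definition mackey_continuous :: "regularity \<Rightarrow> bool" where
  "mackey_continuous k \<longleftrightarrow>
     (\<forall>\<phi>s \<phi>. (\<forall>n. \<phi>s n \<in> log_derivs_of_class k) \<and> \<phi> \<in> log_derivs_of_class k \<and>
        mackey_converges k \<phi>s \<phi> \<longrightarrow>
        (\<forall>U. open U \<and> \<one> \<in> U \<longrightarrow>
           (\<exists>N. \<forall>n\<ge>N. \<forall>t\<in>{0..1}. inv (Evol \<phi> t) \<otimes> Evol (\<phi>s n) t \<in> U)))"

end

end

theory Submission
  imports Defs
begin

text \<open>
  Write \<open>E = Evol \<phi>\<close> and \<open>E n = Evol (\<phi> n)\<close>. The right logarithmic derivative of \<open>inv E \<otimes> E n\<close> is the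
  adjoint action of \<open>inv E\<close> on \<open>\<phi> n - \<phi>\<close>. Since the derivative of \<open>Ad (inv E) v\<close> is \<open>Ad (inv E) (b \<phi> v)\<close>
  for a continuous bilinear \<open>b\<close> (the bracket up to sign), the derivatives of these curves
  are bounded by the Mackey rate. Suppose that \<open>inv E \<otimes> E n\<close> leaves a neighbourhood of the unit for
  infinitely many \<open>n\<close>. Along a subsequence whose rate decreases rapidly, reparametrise the curves
  by a smooth step that is flat at both ends and concatenate them on the dyadic intervals from
  \<open>2 powr (- (i + 1))\<close> to \<open>2 powr (- i)\<close>. The result is a single curve of class \<open>k\<close>, which by
  semiregularity is the right logarithmic derivative of some \<open>\<mu>\<close>. On the \<open>i\<close>-th interval, \<open>inv E \<otimes> E n\<close>
  is the reparametrised \<open>\<mu> t \<otimes> inv (\<mu> (2 powr (- (i + 1))))\<close>, which tends to the unit by continuity of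
  \<open>\<mu>\<close> at 0, a contradiction.
\<close>

section \<open>Continuous seminorms\<close>

text \<open>Concatenation is possible because Mackey convergence has one rate for all seminorms and
  all orders. Squeezing a curve into an interval of length \<open>2 powr (- (i + 1))\<close>
  multiplies its \<open>m\<close>-th derivative by \<open>(2 ^ Suc i) ^ m\<close>, and the
  logarithmic derivative of the squeezed curve carries one more such factor. A single subsequence
  whose rate is at most \<open>inverse ((2 ^ Suc i) ^ i)\<close> beats all these factors for all
  seminorms at once; if the rate depended on the seminorm, so would the subsequence. The other
  obstacle is that the model space need not be complete, so curves cannot be integrated. A mean
  value estimate proved by bisection replaces the integral, both in the chain rule and in showing
  that a curve with vanishing logarithmic derivative is constant. Higher derivatives of
  \<open>Ad (inv E)\<close> are never computed separately: its first derivative is again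
  \<open>Ad (inv E)\<close> applied to something bilinear, so an induction on the order only
  differentiates the coordinates of \<open>\<phi>\<close> and of the differences. Of the smoothness
  of the group operations, two derivatives are used, since \<open>b\<close> is a mixed second
  derivative of conjugation in the chart.\<close>

lemma tendsto_scaleR_lcs:
  fixes g :: "'a \<Rightarrow> 'e::locally_convex_space"
  assumes "(f \<longlongrightarrow> a) F" "(g \<longlongrightarrow> x) F"
  shows "((\<lambda>z. f z *\<^sub>R g z) \<longlongrightarrow> a *\<^sub>R x) F"
  using filterlim_compose[OF tendsto_scaleR_Pair_lcs filterlim_Pair[OF assms]] by simp

lemma continuous_on_scaleR_lcs:
  fixes g :: "'a::topological_space \<Rightarrow> 'e::locally_convex_space"
  assumes "continuous_on S f" "continuous_on S g"
  shows "continuous_on S (\<lambda>x. f x *\<^sub>R g x)"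
  using assms unfolding continuous_on_def by (auto intro: tendsto_scaleR_lcs)

context
  fixes p :: "'e::locally_convex_space \<Rightarrow> real"
  assumes p: "continuous_seminorm p"
begin

lemma seminorm_triangle: "p (x + y) \<le> p x + p y"
  and seminorm_scaleR: "p (a *\<^sub>R x) = \<bar>a\<bar> * p x"
  and seminorm_continuous: "continuous_on UNIV p"
  using p by (auto simp: continuous_seminorm_def)

lemma seminorm_zero: "p 0 = 0"
  using seminorm_scaleR[of 0 0] by simp

lemma seminorm_minus: "p (- x) = p x"
  using seminorm_scaleR[of "-1" x] by simp

lemma seminorm_nonneg: "0 \<le> p x"
  using seminorm_triangle[of x "- x"] by (simp add: seminorm_minus seminorm_zero)

lemma seminorm_minus_commute: "p (x - y) = p (y - x)"
  using seminorm_minus[of "x - y"] by simp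

lemma seminorm_diff: "p (x - y) \<le> p x + p y"
  using seminorm_triangle[of x "- y"] by (simp add: seminorm_minus)

lemma seminorm_tendsto: "(f \<longlongrightarrow> l) F \<Longrightarrow> ((\<lambda>x. p (f x)) \<longlongrightarrow> p l) F"
  using seminorm_continuous continuous_on_tendsto_compose[of UNIV p f l F] by simp

lemma seminorm_tendsto_zero: "(f \<longlongrightarrow> 0) F \<Longrightarrow> ((\<lambda>x. p (f x)) \<longlongrightarrow> 0) F"
  using seminorm_tendsto[of f 0 F] by (simp add: seminorm_zero)

end

lemma continuous_seminorm_abs: "continuous_seminorm (abs :: real \<Rightarrow> real)"
  by (auto simp: continuous_seminorm_def abs_mult intro!: continuous_intros)

text \<open>The seminorm is the Minkowski functional of a symmetric convex neighbourhood.\<close>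

lemma ex_continuous_seminorm:
  fixes U :: "'e::locally_convex_space set"
  assumes "open U" "0 \<in> U"
  obtains p where "continuous_seminorm p" "{x. p x < 1} \<subseteq> U"
proof -
  obtain V where V: "open V" "0 \<in> V" "convex V" "V \<subseteq> U"
    using locally_convex[OF assms] .
  define B where "B = V \<inter> uminus -` V"
  have B_open: "open B"
    unfolding B_def using V(1)
    by (intro open_Int open_vimage) (auto intro!: continuous_intros)
  have B0: "0 \<in> B" and BU: "B \<subseteq> U" using V by (auto simp: B_def)
  have Bc: "u *\<^sub>R x + v *\<^sub>R y \<in> B" if "x \<in> B" "y \<in> B" "0 \<le> u" "0 \<le> v" "u + v = 1" for x y u v
  proof -
    have "u *\<^sub>R x + v *\<^sub>R y \<in> V" "u *\<^sub>R (- x) + v *\<^sub>R (- y) \<in> V"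
      using that V(3) unfolding B_def by (auto intro!: convexD simp del: scaleR_minus_right)
    then show ?thesis by (simp add: B_def)
  qed
  have Bs: "a *\<^sub>R x \<in> B" if "x \<in> B" "\<bar>a\<bar> \<le> 1" for a x
  proof -
    have "- x \<in> B" using that(1) by (simp add: B_def)
    \<comment> \<open>\<open>a *\<^sub>R x\<close> lies on the segment between \<open>x\<close> and
      \<open>- x\<close>, so symmetry and convexity suffice.\<close>
    then have "((1 + a) / 2) *\<^sub>R x + ((1 - a) / 2) *\<^sub>R (- x) \<in> B"
      using that by (intro Bc) (auto simp: field_simps)
    moreover have "((1 + a) / 2) *\<^sub>R x + ((1 - a) / 2) *\<^sub>R (- x) = a *\<^sub>R x"
    proof -
      have "((1 + a) / 2) *\<^sub>R x + ((1 - a) / 2) *\<^sub>R (- x) = ((1 + a) / 2 - (1 - a) / 2) *\<^sub>R x"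
        unfolding scaleR_left_diff_distrib by simp
      also have "(1 + a) / 2 - (1 - a) / 2 = a" by (simp add: field_simps)
      finally show ?thesis .
    qed
    ultimately show ?thesis by simp
  qed
  define R where "R x = {r::real. r > 0 \<and> inverse r *\<^sub>R x \<in> B}" for x
  define p where "p x = Inf (R x)" for x
  have R_pos: "\<And>x r. r \<in> R x \<Longrightarrow> 0 < r" by (simp add: R_def)
  then have bdd: "bdd_below (R x)" for x by (meson bdd_belowI less_imp_le)
  have R_ne: "R x \<noteq> {}" for x
  proof -
    have "((\<lambda>r. inverse r *\<^sub>R x) \<longlongrightarrow> 0 *\<^sub>R x) (at_top :: real filter)"
      by (intro tendsto_scaleR_lcs tendsto_const tendsto_inverse_0_at_top filterlim_ident)
    then have "eventually (\<lambda>r. inverse r *\<^sub>R x \<in> B) (at_top :: real filter)"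
      using B_open B0 by (auto dest: topological_tendstoD)
    then have "eventually (\<lambda>r. r \<in> R x) (at_top :: real filter)"
      using eventually_gt_at_top[of 0] by eventually_elim (simp add: R_def)
    then show ?thesis by (metis empty_iff eventually_at_top_linorder order_refl)
  qed
  have p_le: "p x \<le> r" if "r \<in> R x" for x r
    unfolding p_def using that bdd by (rule cInf_lower)
  have p_less: "\<exists>r\<in>R x. r < c" if "p x < c" for x c
    using that unfolding p_def using cInf_lessD[OF R_ne] by blast
  have p_ge: "0 \<le> p x" for x
    unfolding p_def using R_ne R_pos by (intro cInf_greatest) (auto intro: less_imp_le)
  have sub: "p (x + y) \<le> p x + p y" for x y
  proof (rule field_le_epsilon)
    fix e :: real assume "e > 0"
    then obtain r s where r: "r \<in> R x" "r < p x + e / 2" and s: "s \<in> R y" "s < p y + e / 2"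
      using p_less[of x "p x + e / 2"] p_less[of y "p y + e / 2"] by auto
    have rs: "0 < r" "0 < s" using R_pos r s by auto
    have "(r / (r + s)) *\<^sub>R (inverse r *\<^sub>R x) + (s / (r + s)) *\<^sub>R (inverse s *\<^sub>R y) \<in> B"
      using r s rs by (intro Bc) (auto simp: R_def add_divide_distrib[symmetric])
    moreover have "(r / (r + s)) *\<^sub>R (inverse r *\<^sub>R x) + (s / (r + s)) *\<^sub>R (inverse s *\<^sub>R y)
        = inverse (r + s) *\<^sub>R (x + y)"
    proof -
      have "(r / (r + s)) * inverse r = inverse (r + s)" "(s / (r + s)) * inverse s = inverse (r + s)"
        using rs by (simp_all add: field_simps)
      then show ?thesis by (simp only: scaleR_scaleR scaleR_add_right)
    qed
    ultimately have "r + s \<in> R (x + y)" using rs by (simp add: R_def)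
    then show "p (x + y) \<le> p x + p y + e" using p_le r s by fastforce
  qed
  have sc: "p (a *\<^sub>R x) \<le> \<bar>a\<bar> * p x" if "a \<noteq> 0" for a x
  proof (rule field_le_epsilon)
    fix e :: real assume "e > 0"
    then have "p x < p x + e / \<bar>a\<bar>" using that by simp
    then obtain r where r: "r \<in> R x" "r < p x + e / \<bar>a\<bar>" using p_less by blast
    have "(a / \<bar>a\<bar>) *\<^sub>R (inverse r *\<^sub>R x) \<in> B"
      using r(1) by (intro Bs[of "inverse r *\<^sub>R x"]) (auto simp: R_def)
    also have "(a / \<bar>a\<bar>) *\<^sub>R (inverse r *\<^sub>R x) = inverse (\<bar>a\<bar> * r) *\<^sub>R (a *\<^sub>R x)"
      by (simp add: divide_inverse ac_simps)
    finally have "\<bar>a\<bar> * r \<in> R (a *\<^sub>R x)"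
      using r that by (simp add: R_def)
    then have "p (a *\<^sub>R x) \<le> \<bar>a\<bar> * r" by (rule p_le)
    also have "\<dots> \<le> \<bar>a\<bar> * (p x + e / \<bar>a\<bar>)" using r by (intro mult_left_mono) auto
    also have "\<dots> = \<bar>a\<bar> * p x + e" using that by (simp add: distrib_left)
    finally show "p (a *\<^sub>R x) \<le> \<bar>a\<bar> * p x + e" .
  qed
  have p0: "p 0 = 0"
  proof -
    have "p 0 \<le> e" if "e > 0" for e
      using that B0 by (intro p_le) (simp add: R_def)
    then show ?thesis using p_ge[of 0] field_le_epsilon[of "p 0" 0] by fastforce
  qed
  have hom: "p (a *\<^sub>R x) = \<bar>a\<bar> * p x" for a x
  proof (cases "a = 0")
    case False
    \<comment> \<open>Applying \<open>sc\<close> to the factor \<open>inverse a\<close> and the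
      vector \<open>a *\<^sub>R x\<close> gives the reverse inequality.\<close>
    have "\<bar>a\<bar> * p (inverse a *\<^sub>R (a *\<^sub>R x)) \<le> \<bar>a\<bar> * (\<bar>inverse a\<bar> * p (a *\<^sub>R x))"
      using False by (intro mult_left_mono sc) auto
    then show ?thesis using sc[OF False, of x] False by (simp add: field_simps)
  qed (simp add: p0)
  have "isCont p x" for x
    unfolding isCont_def
  proof (rule tendstoI)
    fix e :: real assume e: "e > 0"
    have "((\<lambda>y. inverse (e / 2) *\<^sub>R (y - x)) \<longlongrightarrow> inverse (e / 2) *\<^sub>R (x - x)) (at x)"
      by (intro tendsto_scaleR_lcs tendsto_intros)
    then have "eventually (\<lambda>y. inverse (e / 2) *\<^sub>R (y - x) \<in> B) (at x)"
      using B_open B0 by (auto dest: topological_tendstoD)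
    then show "eventually (\<lambda>y. dist (p y) (p x) < e) (at x)"
    proof eventually_elim
      case (elim y)
      then have 1: "p (y - x) \<le> e / 2" using e by (intro p_le) (simp add: R_def)
      have "p y \<le> p (y - x) + p x" "p x \<le> p (-1 *\<^sub>R (y - x)) + p y"
        using sub[of "y - x" x] sub[of "-1 *\<^sub>R (y - x)" y] by simp_all
      then show ?case using 1 e hom[of "-1" "y - x"] by (simp add: dist_real_def)
    qed
  qed
  then have "continuous_seminorm p"
    using sub hom by (auto simp: continuous_seminorm_def intro!: continuous_at_imp_continuous_on)
  moreover have "{x. p x < 1} \<subseteq> U"
  proof
    fix x assume "x \<in> {x. p x < 1}"
    then obtain r where r: "r \<in> R x" "r < 1" using p_less by blast
    then have "r *\<^sub>R (inverse r *\<^sub>R x) \<in> B" using Bs[of "inverse r *\<^sub>R x" r] by (simp add: R_def)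
    moreover have "r *\<^sub>R (inverse r *\<^sub>R x) = x" using r R_pos[OF r(1)] by simp
    ultimately show "x \<in> U" using BU by auto
  qed
  ultimately show ?thesis using that by blast
qed

text \<open>After a translation to the origin, every neighbourhood contains the unit ball of a
  continuous seminorm. Limits in the model space can thus be proved by real estimates, one seminorm
  at a time.\<close>

lemma tendsto_seminormI:
  fixes f :: "'a \<Rightarrow> 'e::locally_convex_space"
  assumes "\<And>p e. continuous_seminorm p \<Longrightarrow> e > 0 \<Longrightarrow> eventually (\<lambda>x. p (f x - l) < e) F"
  shows "(f \<longlongrightarrow> l) F"
proof (rule topological_tendstoI)
  fix S assume S: "open S" "l \<in> S"
  have "open ((\<lambda>z. z + l) -` S)"
    using S(1) by (intro open_vimage continuous_intros)
  then obtain p where p: "continuous_seminorm p" "{x. p x < 1} \<subseteq> (\<lambda>z. z + l) -` S"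
    using ex_continuous_seminorm[of "(\<lambda>z. z + l) -` S"] S(2) by auto
  show "eventually (\<lambda>x. f x \<in> S) F"
    using assms[OF p(1) zero_less_one] by eventually_elim (use p(2) in auto)
qed

lemma seminorm_tendsto_diff:
  fixes f :: "'a \<Rightarrow> 'e::locally_convex_space"
  assumes "continuous_seminorm p" "(f \<longlongrightarrow> l) F"
  shows "((\<lambda>x. p (f x - l)) \<longlongrightarrow> 0) F"
  using tendsto_diff[OF assms(2) tendsto_const[of l]]
  by (intro seminorm_tendsto_zero[OF assms(1)]) simp

lemma seminorm_eventually_less:
  fixes f :: "'a \<Rightarrow> 'e::locally_convex_space"
  assumes "continuous_seminorm p" "(f \<longlongrightarrow> l) F" "e > 0"
  shows "eventually (\<lambda>x. p (f x - l) < e) F"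
  using order_tendstoD(2)[OF seminorm_tendsto_diff[OF assms(1,2)] assms(3)] .

text \<open>Separation turns estimates into equations: a nonzero vector is missed by some
  neighbourhood of 0, hence by the unit ball of a continuous seminorm.\<close>

lemma eq_zero_seminormI:
  fixes x :: "'e::locally_convex_space"
  assumes "\<And>p. continuous_seminorm p \<Longrightarrow> p x \<le> 0"
  shows "x = 0"
proof (rule ccontr)
  assume "x \<noteq> 0"
  then obtain U where U: "open U" "0 \<in> U" "x \<notin> U" by (metis t1_space)
  obtain p where "continuous_seminorm p" "{x. p x < 1} \<subseteq> U"
    using ex_continuous_seminorm[OF U(1,2)] .
  then show False using assms[of p] U(3) by force
qed

lemma seminorm_ball_subset:
  fixes U :: "'e::locally_convex_space set"
  assumes "open U" "x \<in> U"
  obtains p where "continuous_seminorm p" "{y. p (y - x) < 1} \<subseteq> U"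
proof -
  have "open ((\<lambda>z. z + x) -` U)"
    using assms(1) by (intro open_vimage continuous_intros)
  then obtain p where p: "continuous_seminorm p" "{z. p z < 1} \<subseteq> (\<lambda>z. z + x) -` U"
    using ex_continuous_seminorm[of "(\<lambda>z. z + x) -` U"] assms(2) by auto
  then have "{y. p (y - x) < 1} \<subseteq> U" by force
  then show ?thesis using that p by blast
qed

section \<open>Bounds that are uniform on compact sets\<close>

lemma compact_seminorm_bounded:
  assumes "continuous_seminorm p" "compact S" "continuous_on S f"
  obtains C where "0 \<le> C" "\<And>x. x \<in> S \<Longrightarrow> p (f x) \<le> C"
proof -
  have "compact ((\<lambda>x. p (f x)) ` S)"
    by (intro compact_continuous_image assms(2)
        continuous_on_compose2[OF seminorm_continuous[OF assms(1)] assms(3)]) simp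
  then have "bdd_above ((\<lambda>x. p (f x)) ` S)" by (intro bounded_imp_bdd_above compact_imp_bounded)
  then obtain C where "\<And>x. x \<in> S \<Longrightarrow> p (f x) \<le> C" by (auto simp: bdd_above_def)
  then show ?thesis by (intro that[of "max C 0"]) (auto simp: le_max_iff_disj)
qed

text \<open>The maps \<open>f t\<close> vanish at 0, so by the tube lemma one neighbourhood of 0 is
  sent into the unit ball of \<open>p\<close> by all \<open>t\<close> in the compact set.
  Homogeneity turns this neighbourhood into a seminorm \<open>q\<close> that dominates the whole
  family.\<close>

lemma compact_family_bounded:
  fixes f :: "'t::topological_space \<Rightarrow> 'e::locally_convex_space \<Rightarrow> 'f::locally_convex_space"
  assumes p: "continuous_seminorm p" and S: "compact S"
    and cont: "continuous_on (S \<times> UNIV) (\<lambda>(t, x). f t x)"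
    and hom: "\<And>t a x. t \<in> S \<Longrightarrow> f t (a *\<^sub>R x) = a *\<^sub>R f t x"
  obtains q where "continuous_seminorm q" "\<And>t x. t \<in> S \<Longrightarrow> p (f t x) \<le> q x"
proof -
  have "continuous_on (UNIV \<times> S) (\<lambda>(x, t). p (f t x))"
  proof -
    have "continuous_on (UNIV \<times> S) (\<lambda>z. f (snd z) (fst z))"
      using continuous_on_compose2[OF cont, of "UNIV \<times> S" "\<lambda>z. (snd z, fst z)"]
        continuous_on_Pair[OF continuous_on_snd[OF continuous_on_id] continuous_on_fst[OF continuous_on_id]]
      by (auto simp: split_beta image_subset_iff)
    then have "continuous_on (UNIV \<times> S) (\<lambda>z. p (f (snd z) (fst z)))"
      by (rule continuous_on_compose2[OF seminorm_continuous[OF p]]) simp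
    then show ?thesis by (simp add: split_beta)
  qed
  then obtain W where W: "open W" "W \<inter> (UNIV \<times> S) = (\<lambda>(x, t). p (f t x)) -` {..<1} \<inter> (UNIV \<times> S)"
    unfolding continuous_on_open_invariant by (meson open_lessThan)
  have "{0} \<times> S \<subseteq> W"
  proof clarify
    fix t assume t: "t \<in> S"
    have "p (f t 0) = 0" using hom[OF t, of 0 0] by (simp add: seminorm_zero[OF p])
    then have "(0, t) \<in> (\<lambda>(x, t). p (f t x)) -` {..<1} \<inter> (UNIV \<times> S)" using t by simp
    then show "(0, t) \<in> W" using W(2) by blast
  qed
  then obtain X where X: "0 \<in> X" "open X" "X \<times> S \<subseteq> W"
    using Elementary_Topology.tube_lemma[OF S W(1)] by blast
  obtain q where q: "continuous_seminorm q" "{x. q x < 1} \<subseteq> X"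
    using ex_continuous_seminorm[OF X(2,1)] .
  have "p (f t x) \<le> q x" if t: "t \<in> S" for t x
  proof (rule field_le_epsilon)
    fix e :: real assume e: "e > 0"
    \<comment> \<open>The summand \<open>e\<close> keeps the scaling factor positive when
      \<open>q x = 0\<close>.\<close>
    define c where "c = q x + e"
    have c: "c > 0" "q x < c" using seminorm_nonneg[OF q(1), of x] e by (auto simp: c_def)
    then have "q (inverse c *\<^sub>R x) < 1" by (simp add: seminorm_scaleR[OF q(1)] field_simps)
    then have "(inverse c *\<^sub>R x, t) \<in> W \<inter> (UNIV \<times> S)" using q(2) X(3) t by blast
    then have "p (f t (inverse c *\<^sub>R x)) < 1" unfolding W(2) by simp
    then have "p (f t x) < c" using c by (simp add: hom[OF t] seminorm_scaleR[OF p] field_simps)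
    then show "p (f t x) \<le> q x + e" by (simp add: c_def)
  qed
  then show ?thesis using that q(1) by blast
qed

section \<open>Continuous bilinear maps\<close>

definition continuous_bilinear ::
  "('a::locally_convex_space \<Rightarrow> 'b::locally_convex_space \<Rightarrow> 'c::locally_convex_space) \<Rightarrow> bool" where
  "continuous_bilinear b \<longleftrightarrow>
     (\<forall>x x' y. b (x + x') y = b x y + b x' y) \<and> (\<forall>x y y'. b x (y + y') = b x y + b x y') \<and>
     (\<forall>a x y. b (a *\<^sub>R x) y = a *\<^sub>R b x y) \<and> (\<forall>a x y. b x (a *\<^sub>R y) = a *\<^sub>R b x y) \<and>
     continuous_on UNIV (\<lambda>(x, y). b x y)"

text \<open>With this instance, the product rules for bilinear maps also serve for scalar functions
  times vector-valued curves.\<close>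

lemma continuous_bilinear_scaleR:
  "continuous_bilinear (scaleR :: real \<Rightarrow> 'e::locally_convex_space \<Rightarrow> 'e)"
  unfolding continuous_bilinear_def
  by (auto simp: scaleR_add_left scaleR_add_right split_beta
      intro!: continuous_on_scaleR_lcs continuous_intros)

context
  fixes b :: "'a::locally_convex_space \<Rightarrow> 'b::locally_convex_space \<Rightarrow> 'c::locally_convex_space"
  assumes b: "continuous_bilinear b"
begin

lemma bilinear_add_left: "b (x + x') y = b x y + b x' y"
  and bilinear_add_right: "b x (y + y') = b x y + b x y'"
  and bilinear_scaleR_left: "b (a *\<^sub>R x) y = a *\<^sub>R b x y"
  and bilinear_scaleR_right: "b x (a *\<^sub>R y) = a *\<^sub>R b x y"
  using b by (auto simp: continuous_bilinear_def)

lemma bilinear_diff_left: "b (x - x') y = b x y - b x' y"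
  using bilinear_add_left[of "x - x'" x' y] by simp

lemma bilinear_diff_right: "b x (y - y') = b x y - b x y'"
  using bilinear_add_right[of x "y - y'" y'] by simp

lemma bilinear_tendsto:
  assumes "(f \<longlongrightarrow> x) F" "(g \<longlongrightarrow> y) F"
  shows "((\<lambda>z. b (f z) (g z)) \<longlongrightarrow> b x y) F"
proof -
  have "continuous_on UNIV (\<lambda>(x, y). b x y)" using b by (simp add: continuous_bilinear_def)
  from continuous_on_tendsto_compose[OF this tendsto_Pair[OF assms]] show ?thesis by simp
qed

lemma bilinear_continuous_on:
  "continuous_on S f \<Longrightarrow> continuous_on S g \<Longrightarrow> continuous_on S (\<lambda>z. b (f z) (g z))"
  unfolding continuous_on_def by (auto intro: bilinear_tendsto)

text \<open>Continuity at the origin bounds \<open>b\<close> by 1 on a product of two seminorm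
  balls, and homogeneity in each argument spreads this bound to all pairs.\<close>

lemma bilinear_bounded:
  assumes p: "continuous_seminorm p"
  obtains q q' where "continuous_seminorm q" "continuous_seminorm q'" "\<And>x y. p (b x y) \<le> q x * q' y"
proof -
  have b0: "b 0 0 = 0" using bilinear_scaleR_left[of 0 0 0] by simp
  have "((\<lambda>z. p (b (fst z) (snd z))) \<longlongrightarrow> p (b 0 0)) (nhds (0, 0))"
    using tendsto_fst[OF filterlim_ident, of "(0, 0)"] tendsto_snd[OF filterlim_ident, of "(0, 0)"]
    by (intro seminorm_tendsto[OF p] bilinear_tendsto) simp_all
  then have "eventually (\<lambda>z. p (b (fst z) (snd z)) < 1) (nhds (0, 0))"
    by (rule order_tendstoD) (simp add: seminorm_zero[OF p] b0)
  then obtain W where "open W" "(0, 0) \<in> W" and W: "\<And>z. z \<in> W \<Longrightarrow> p (b (fst z) (snd z)) < 1"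
    by (auto simp: eventually_nhds)
  then obtain X Y where XY: "open X" "open Y" "0 \<in> X" "0 \<in> Y" "X \<times> Y \<subseteq> W"
    by (metis mem_Times_iff fst_conv snd_conv open_prod_elim)
  obtain q where q: "continuous_seminorm q" "{x. q x < 1} \<subseteq> X"
    using ex_continuous_seminorm[OF XY(1,3)] .
  obtain q' where q': "continuous_seminorm q'" "{x. q' x < 1} \<subseteq> Y"
    using ex_continuous_seminorm[OF XY(2,4)] .
  have eps: "p (b x y) \<le> (q x + e) * (q' y + e)" if e: "e > 0" for x y e
  proof -
    define c d where "c = q x + e" and "d = q' y + e"
    have c: "c > 0" "q x < c" "d > 0" "q' y < d"
      using seminorm_nonneg[OF q(1), of x] seminorm_nonneg[OF q'(1), of y] e
      by (auto simp: c_def d_def)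
    then have "q (inverse c *\<^sub>R x) < 1" "q' (inverse d *\<^sub>R y) < 1"
      by (simp_all add: seminorm_scaleR[OF q(1)] seminorm_scaleR[OF q'(1)] field_simps)
    then have "(inverse c *\<^sub>R x, inverse d *\<^sub>R y) \<in> W" using q(2) q'(2) XY(5) by blast
    from W[OF this] have "p (b x y) < c * d"
      using c by (simp add: bilinear_scaleR_left bilinear_scaleR_right seminorm_scaleR[OF p] field_simps)
    then show ?thesis by (simp add: c_def d_def)
  qed
  have "p (b x y) \<le> q x * q' y" for x y
  proof (rule tendsto_lowerbound)
    show "((\<lambda>e. (q x + e) * (q' y + e)) \<longlongrightarrow> q x * q' y) (at_right 0)"
      by (auto intro!: tendsto_eq_intros)
    show "eventually (\<lambda>e. p (b x y) \<le> (q x + e) * (q' y + e)) (at_right 0)"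
      using eventually_at_right_less[of 0] by eventually_elim (rule eps)
  qed simp
  then show ?thesis using that q(1) q'(1) by blast
qed

end

section \<open>Derivatives of curves\<close>

text \<open>A relation rather than a limit operator, so that existence of the limit is part of the
  claim. The set \<open>S\<close> makes derivatives one-sided at end points; for
  \<open>{0..1}\<close> the quotient is the one whose limit defines
  \<open>curve_deriv\<close>.\<close>

definition has_curve_deriv ::
  "(real \<Rightarrow> 'e::locally_convex_space) \<Rightarrow> 'e \<Rightarrow> real \<Rightarrow> real set \<Rightarrow> bool" where
  "has_curve_deriv \<gamma> D t S \<longleftrightarrow> ((\<lambda>s. (\<gamma> s - \<gamma> t) /\<^sub>R (s - t)) \<longlongrightarrow> D) (at t within S)"

lemma has_curve_deriv_real:
  "has_curve_deriv f D t S \<longleftrightarrow> (f has_real_derivative D) (at t within S)"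
  by (simp add: has_curve_deriv_def has_field_derivative_iff divide_inverse mult.commute)

lemma has_curve_deriv_continuous:
  assumes "has_curve_deriv \<gamma> D t S"
  shows "(\<gamma> \<longlongrightarrow> \<gamma> t) (at t within S)"
proof -
  have "((\<lambda>s. \<gamma> t + (s - t) *\<^sub>R ((\<gamma> s - \<gamma> t) /\<^sub>R (s - t))) \<longlongrightarrow> \<gamma> t + (t - t) *\<^sub>R D) (at t within S)"
    using assms unfolding has_curve_deriv_def
    by (intro tendsto_add tendsto_const tendsto_scaleR_lcs tendsto_diff tendsto_ident_at)
  then have "((\<lambda>s. \<gamma> t + (s - t) *\<^sub>R ((\<gamma> s - \<gamma> t) /\<^sub>R (s - t))) \<longlongrightarrow> \<gamma> t) (at t within S)"
    by simp
  then show ?thesis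
    by (rule Lim_transform_eventually) (auto simp: eventually_at_filter)
qed

lemma has_curve_deriv_continuous_on:
  assumes "\<And>t. t \<in> S \<Longrightarrow> has_curve_deriv \<gamma> (D t) t S"
  shows "continuous_on S \<gamma>"
  using assms has_curve_deriv_continuous unfolding continuous_on_def by blast

lemma has_curve_deriv_mono:
  "has_curve_deriv \<gamma> D t S \<Longrightarrow> T \<subseteq> S \<Longrightarrow> has_curve_deriv \<gamma> D t T"
  unfolding has_curve_deriv_def by (rule tendsto_within_subset)

lemma has_curve_deriv_transform_eventually:
  assumes "has_curve_deriv \<gamma> D t S" "eventually (\<lambda>s. \<gamma> s = \<gamma>' s) (at t within S)" "\<gamma> t = \<gamma>' t"
  shows "has_curve_deriv \<gamma>' D t S"
  using assms(1) unfolding has_curve_deriv_def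
  by (rule Lim_transform_eventually) (use assms(2,3) in \<open>auto elim: eventually_mono\<close>)

lemma has_curve_deriv_cong:
  assumes "has_curve_deriv \<gamma> D t S" "\<And>s. s \<in> S \<Longrightarrow> \<gamma> s = \<gamma>' s" "t \<in> S"
  shows "has_curve_deriv \<gamma>' D t S"
  using assms by (intro has_curve_deriv_transform_eventually[OF assms(1)]) (auto simp: eventually_at_filter)

lemma has_curve_deriv_const: "has_curve_deriv (\<lambda>_. c) 0 t S"
  by (simp add: has_curve_deriv_def)

lemma has_curve_deriv_add:
  assumes "has_curve_deriv \<gamma> D t S" "has_curve_deriv \<gamma>' D' t S"
  shows "has_curve_deriv (\<lambda>s. \<gamma> s + \<gamma>' s) (D + D') t S"
  using tendsto_add[OF assms[unfolded has_curve_deriv_def]]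
  by (simp add: has_curve_deriv_def scaleR_add_right[symmetric] algebra_simps del: scaleR_add_right)

lemma has_curve_deriv_diff:
  assumes "has_curve_deriv \<gamma> D t S" "has_curve_deriv \<gamma>' D' t S"
  shows "has_curve_deriv (\<lambda>s. \<gamma> s - \<gamma>' s) (D - D') t S"
  using tendsto_diff[OF assms[unfolded has_curve_deriv_def]]
  by (simp add: has_curve_deriv_def scaleR_diff_right[symmetric] algebra_simps del: scaleR_diff_right)

lemma has_curve_deriv_unique:
  assumes "has_curve_deriv \<gamma> D t S" "has_curve_deriv \<gamma> D' t S" "at t within S \<noteq> bot"
  shows "D = D'"
  using assms tendsto_unique unfolding has_curve_deriv_def by blast

lemma has_curve_deriv_bilinear:
  assumes b: "continuous_bilinear b"
    and "has_curve_deriv \<gamma> D t S" "has_curve_deriv \<gamma>' D' t S"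
  shows "has_curve_deriv (\<lambda>s. b (\<gamma> s) (\<gamma>' s)) (b D (\<gamma>' t) + b (\<gamma> t) D') t S"
proof -
  have "((\<lambda>s. b ((\<gamma> s - \<gamma> t) /\<^sub>R (s - t)) (\<gamma>' s) + b (\<gamma> t) ((\<gamma>' s - \<gamma>' t) /\<^sub>R (s - t)))
      \<longlongrightarrow> b D (\<gamma>' t) + b (\<gamma> t) D') (at t within S)"
    using assms(2,3) has_curve_deriv_continuous[OF assms(3)] unfolding has_curve_deriv_def
    by (intro tendsto_add bilinear_tendsto[OF b] tendsto_const)
  moreover have "b ((\<gamma> s - \<gamma> t) /\<^sub>R (s - t)) (\<gamma>' s) + b (\<gamma> t) ((\<gamma>' s - \<gamma>' t) /\<^sub>R (s - t))
      = (b (\<gamma> s) (\<gamma>' s) - b (\<gamma> t) (\<gamma>' t)) /\<^sub>R (s - t)" for s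
    by (simp add: bilinear_scaleR_left[OF b] bilinear_scaleR_right[OF b] bilinear_diff_left[OF b]
        bilinear_diff_right[OF b] scaleR_add_right[symmetric] del: scaleR_add_right)
  ultimately show ?thesis by (simp add: has_curve_deriv_def)
qed

lemma has_curve_deriv_comp_real:
  assumes \<gamma>: "has_curve_deriv \<gamma> D (\<sigma> t) T" and \<sigma>: "has_curve_deriv \<sigma> c t S"
    and T: "\<And>s. s \<in> S \<Longrightarrow> \<sigma> s \<in> T"
  shows "has_curve_deriv (\<lambda>s. \<gamma> (\<sigma> s)) (c *\<^sub>R D) t S"
proof -
  \<comment> \<open>Extending the quotient by \<open>D\<close> at \<open>\<sigma> t\<close> covers
    those \<open>s \<noteq> t\<close> with \<open>\<sigma> s = \<sigma> t\<close>, where the plain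
    quotient would be a division by zero.\<close>
  define q where "q u = (if u = \<sigma> t then D else (\<gamma> u - \<gamma> (\<sigma> t)) /\<^sub>R (u - \<sigma> t))" for u
  have "(q \<longlongrightarrow> D) (at (\<sigma> t) within T)"
    using \<gamma> unfolding has_curve_deriv_def
    by (rule Lim_transform_eventually) (auto simp: q_def eventually_at_filter)
  then have "(q \<longlongrightarrow> q (\<sigma> t)) (at (\<sigma> t) within T)" by (simp add: q_def)
  \<comment> \<open>The filter must contain the point \<open>\<sigma> t\<close> itself, since
    \<open>\<sigma>\<close> may return to this value arbitrarily close to \<open>t\<close>.\<close>
  have qT: "(q \<longlongrightarrow> q (\<sigma> t)) (inf (nhds (\<sigma> t)) (principal T))"
  proof (rule topological_tendstoI, goal_cases)
    case (1 U)
    then have "eventually (\<lambda>u. q u \<in> U) (at (\<sigma> t) within T)"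
      using \<open>(q \<longlongrightarrow> q (\<sigma> t)) (at (\<sigma> t) within T)\<close> by (blast dest: topological_tendstoD)
    then show ?case
      using 1 unfolding eventually_at_filter eventually_inf_principal
      by (auto elim: eventually_mono)
  qed
  have \<sigma>T: "filterlim \<sigma> (inf (nhds (\<sigma> t)) (principal T)) (at t within S)"
    using has_curve_deriv_continuous[OF \<sigma>] T
    by (auto simp: filterlim_inf filterlim_principal eventually_at_filter)
  have "((\<lambda>s. ((\<sigma> s - \<sigma> t) /\<^sub>R (s - t)) *\<^sub>R q (\<sigma> s)) \<longlongrightarrow> c *\<^sub>R q (\<sigma> t)) (at t within S)"
    using \<sigma> filterlim_compose[OF qT \<sigma>T] unfolding has_curve_deriv_def
    by (rule tendsto_scaleR_lcs)
  moreover have "((\<sigma> s - \<sigma> t) /\<^sub>R (s - t)) *\<^sub>R q (\<sigma> s) = (\<gamma> (\<sigma> s) - \<gamma> (\<sigma> t)) /\<^sub>R (s - t)" for s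
    by (simp add: q_def)
  ultimately show ?thesis by (simp add: has_curve_deriv_def q_def)
qed

text \<open>The estimate with slack \<open>e\<close> holds on small intervals around each point by
  differentiability, and it is additive over adjacent intervals, so bisection extends it to all of
  \<open>{a..b}\<close>.\<close>

lemma curve_mean_value:
  fixes \<gamma> :: "real \<Rightarrow> 'e::locally_convex_space"
  assumes p: "continuous_seminorm p" and "a \<le> b"
    and D: "\<And>t. t \<in> {a..b} \<Longrightarrow> has_curve_deriv \<gamma> (D t) t {a..b}"
    and C: "\<And>t. t \<in> {a..b} \<Longrightarrow> p (D t) \<le> C"
  shows "p (\<gamma> b - \<gamma> a) \<le> C * (b - a)"
proof -
  have eps: "p (\<gamma> b - \<gamma> a) \<le> (C + e) * (b - a)" if e: "e > 0" for e
  proof -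
    define P where "P u v \<longleftrightarrow> (a \<le> u \<and> v \<le> b \<longrightarrow> p (\<gamma> v - \<gamma> u) \<le> (C + e) * (v - u))" for u v
    have "P a b"
      using \<open>a \<le> b\<close>
    proof (induction rule: Bolzano)
      case (trans x y z)
      then show ?case
        using seminorm_triangle[OF p, of "\<gamma> z - \<gamma> y" "\<gamma> y - \<gamma> x"] by (auto simp: P_def algebra_simps)
    next
      case (local x)
      then have x: "x \<in> {a..b}" by simp
      have "eventually (\<lambda>s. p ((\<gamma> s - \<gamma> x) /\<^sub>R (s - x) - D x) < e) (at x within {a..b})"
        using seminorm_eventually_less[OF p _ e] D[OF x] unfolding has_curve_deriv_def by blast
      then obtain d where d: "d > 0" and dd:
        "\<And>s. s \<in> {a..b} \<Longrightarrow> s \<noteq> x \<Longrightarrow> dist s x < d \<Longrightarrow> p ((\<gamma> s - \<gamma> x) /\<^sub>R (s - x) - D x) < e"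
        unfolding eventually_at by blast
      \<comment> \<open>The estimate has the fixed base point \<open>x\<close>; an interval around
        \<open>x\<close> is then treated by splitting it at \<open>x\<close>.\<close>
      have est: "p (\<gamma> s - \<gamma> x) \<le> (C + e) * \<bar>s - x\<bar>" if s: "s \<in> {a..b}" "\<bar>s - x\<bar> < d" for s
      proof (cases "s = x")
        case False
        have "p ((\<gamma> s - \<gamma> x) /\<^sub>R (s - x)) \<le> p ((\<gamma> s - \<gamma> x) /\<^sub>R (s - x) - D x) + p (D x)"
          using seminorm_triangle[OF p, of "(\<gamma> s - \<gamma> x) /\<^sub>R (s - x) - D x" "D x"] by simp
        also have "\<dots> \<le> C + e" using dd[of s] s False C[OF x] by (force simp: dist_real_def)
        finally have "inverse \<bar>s - x\<bar> * p (\<gamma> s - \<gamma> x) \<le> C + e"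
          by (simp add: seminorm_scaleR[OF p] abs_inverse del: scaleR_diff_right)
        then have "\<bar>s - x\<bar> * (inverse \<bar>s - x\<bar> * p (\<gamma> s - \<gamma> x)) \<le> \<bar>s - x\<bar> * (C + e)"
          by (rule mult_left_mono) simp
        moreover have "\<bar>s - x\<bar> * (inverse \<bar>s - x\<bar> * p (\<gamma> s - \<gamma> x)) = p (\<gamma> s - \<gamma> x)"
          using False by simp
        ultimately show ?thesis by (simp only: mult.commute[of "\<bar>s - x\<bar>" "C + e"])
      qed (simp add: seminorm_zero[OF p])
      have "p (\<gamma> v - \<gamma> u) \<le> (C + e) * (v - u)"
        if uv: "u \<le> x \<and> x \<le> v \<and> v - u < d" "a \<le> u \<and> v \<le> b" for u v
      proof -
        have "p (\<gamma> v - \<gamma> u) \<le> p (\<gamma> v - \<gamma> x) + p (\<gamma> u - \<gamma> x)"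
          using seminorm_diff[OF p, of "\<gamma> v - \<gamma> x" "\<gamma> u - \<gamma> x"] by simp
        also have "\<dots> \<le> (C + e) * \<bar>v - x\<bar> + (C + e) * \<bar>u - x\<bar>"
          using uv x by (intro add_mono est) auto
        also have "\<dots> = (C + e) * (v - u)" using uv by (simp add: algebra_simps)
        finally show ?thesis .
      qed
      then show ?case using d by (intro exI[of _ d]) (auto simp: P_def)
    qed
    then show ?thesis by (simp add: P_def)
  qed
  show ?thesis
  proof (rule tendsto_lowerbound)
    show "((\<lambda>e. (C + e) * (b - a)) \<longlongrightarrow> C * (b - a)) (at_right 0)"
      by (auto intro!: tendsto_eq_intros)
    show "eventually (\<lambda>e. p (\<gamma> b - \<gamma> a) \<le> (C + e) * (b - a)) (at_right 0)"
      using eventually_at_right_less[of 0] by eventually_elim (rule eps)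
  qed simp
qed

lemma curve_constant:
  assumes "a \<le> b" "\<And>t. t \<in> {a..b} \<Longrightarrow> has_curve_deriv \<gamma> 0 t {a..b}"
  shows "\<gamma> b = \<gamma> a"
proof -
  have "p (\<gamma> b - \<gamma> a) \<le> 0 * (b - a)" if "continuous_seminorm p" for p
    using that assms by (intro curve_mean_value[where D = "\<lambda>_. 0"]) (auto simp: seminorm_zero)
  then have "\<gamma> b - \<gamma> a = 0" by (intro eq_zero_seminormI) simp
  then show ?thesis by simp
qed

section \<open>Calculus of Bastiani maps of class C1 and C2\<close>

definition C1_map_on ::
  "'e::locally_convex_space set \<Rightarrow> ('e \<Rightarrow> 'f::locally_convex_space) \<Rightarrow> ('e \<Rightarrow> 'e \<Rightarrow> 'f) \<Rightarrow> bool" where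
  "C1_map_on U f df \<longleftrightarrow> open U \<and> continuous_on U f \<and>
     (\<forall>x\<in>U. \<forall>v. has_dir_deriv f x v (df x v)) \<and>
     continuous_on (U \<times> UNIV) (\<lambda>z. df (fst z) (snd z))"

text \<open>The derivative is required to be \<open>C1\<close> jointly in base point and direction.
  In this tangent map form, chain and pairing rules for class 2 are instances of those for class
  1.\<close>

definition C2_map_on ::
  "'e::locally_convex_space set \<Rightarrow> ('e \<Rightarrow> 'f::locally_convex_space) \<Rightarrow> ('e \<Rightarrow> 'e \<Rightarrow> 'f) \<Rightarrow> bool" where
  "C2_map_on U f df \<longleftrightarrow> C1_map_on U f df \<and>
     (\<exists>ddf. C1_map_on (U \<times> UNIV) (\<lambda>z. df (fst z) (snd z)) ddf)"

lemma has_dir_deriv_iff_curve: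
  "has_dir_deriv f (x + u *\<^sub>R v) v d \<longleftrightarrow> has_curve_deriv (\<lambda>s. f (x + s *\<^sub>R v)) d u UNIV"
proof -
  have "has_curve_deriv (\<lambda>s. f (x + s *\<^sub>R v)) d u UNIV \<longleftrightarrow>
      ((\<lambda>h. (f (x + (u + h) *\<^sub>R v) - f (x + u *\<^sub>R v)) /\<^sub>R (u + h - u)) \<longlongrightarrow> d) (at 0)"
    unfolding has_curve_deriv_def by (rule LIM_offset_zero_iff) simp
  then show ?thesis by (simp add: has_dir_deriv_def scaleR_add_left add.assoc)
qed

lemma has_dir_deriv_iff_curve_zero:
  "has_dir_deriv f x v d \<longleftrightarrow> has_curve_deriv (\<lambda>s. f (x + s *\<^sub>R v)) d 0 UNIV"
  using has_dir_deriv_iff_curve[of f x 0 v d] by simp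

lemma has_dir_deriv_unique: "has_dir_deriv f x v d \<Longrightarrow> has_dir_deriv f x v d' \<Longrightarrow> d = d'"
  unfolding has_dir_deriv_def by (rule tendsto_unique[rotated]) auto

lemma dir_deriv_eqI: "has_dir_deriv f x v d \<Longrightarrow> dir_deriv f x v = d"
  unfolding has_dir_deriv_def dir_deriv_def by (rule tendsto_Lim) auto

lemma has_dir_deriv_transform:
  fixes f :: "'e::locally_convex_space \<Rightarrow> 'f::locally_convex_space"
  assumes "has_dir_deriv f x v d" "open U" "x \<in> U" "\<And>y. y \<in> U \<Longrightarrow> f y = g y"
  shows "has_dir_deriv g x v d"
proof -
  have "((\<lambda>h. x + h *\<^sub>R v) \<longlongrightarrow> x + 0 *\<^sub>R v) (at (0::real))"
    by (intro tendsto_add tendsto_const tendsto_scaleR_lcs tendsto_ident_at)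
  then have "eventually (\<lambda>h. x + h *\<^sub>R v \<in> U) (at (0::real))"
    using assms(2,3) by (auto dest: topological_tendstoD)
  then have "eventually (\<lambda>h. (f (x + h *\<^sub>R v) - f x) /\<^sub>R h = (g (x + h *\<^sub>R v) - g x) /\<^sub>R h) (at 0)"
    by eventually_elim (use assms(3,4) in auto)
  then show ?thesis
    using assms(1) unfolding has_dir_deriv_def by (rule Lim_transform_eventually[rotated])
qed

lemma C1_map_onD:
  assumes "C1_map_on U f df"
  shows "open U" "continuous_on U f" "\<And>x v. x \<in> U \<Longrightarrow> has_dir_deriv f x v (df x v)"
    "continuous_on (U \<times> UNIV) (\<lambda>z. df (fst z) (snd z))"
  using assms by (auto simp: C1_map_on_def)

lemma C1_map_on_subset: "C1_map_on U f df \<Longrightarrow> open V \<Longrightarrow> V \<subseteq> U \<Longrightarrow> C1_map_on V f df"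
  unfolding C1_map_on_def
  by (auto intro: continuous_on_subset)

lemma C1_map_on_cong:
  assumes "C1_map_on U f df" "\<And>x. x \<in> U \<Longrightarrow> f x = g x"
    and "\<And>x v. x \<in> U \<Longrightarrow> df x v = dg x v"
  shows "C1_map_on U g dg"
  unfolding C1_map_on_def
proof (intro conjI ballI allI)
  show "continuous_on U g" "open U"
    using C1_map_onD(1,2)[OF assms(1)] assms(2) by (auto cong: continuous_on_cong)
  show "continuous_on (U \<times> UNIV) (\<lambda>z. dg (fst z) (snd z))"
    using C1_map_onD(4)[OF assms(1)] assms(3)
    by (subst continuous_on_cong[OF refl, of _ _ "\<lambda>z. df (fst z) (snd z)"]) auto
  show "has_dir_deriv g x v (dg x v)" if "x \<in> U" for x v
    using has_dir_deriv_transform[OF C1_map_onD(3)[OF assms(1) that] C1_map_onD(1)[OF assms(1)] that assms(2)]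
      assms(3)[OF that] by simp
qed

lemma C2_map_on_cong:
  assumes "C2_map_on U f df" "\<And>x. x \<in> U \<Longrightarrow> f x = g x"
  shows "C2_map_on U g df"
  using assms C1_map_on_cong[of U f df g df] by (auto simp: C2_map_on_def)

lemma C2_map_on_subset: "C2_map_on U f df \<Longrightarrow> open V \<Longrightarrow> V \<subseteq> U \<Longrightarrow> C2_map_on V f df"
  unfolding C2_map_on_def
  by (auto intro: C1_map_on_subset intro!: open_Times dest: C1_map_on_subset[of _ _ _ "V \<times> UNIV"])

lemma C2_map_on_imp_C1: "C2_map_on U f df \<Longrightarrow> C1_map_on U f df"
  by (simp add: C2_map_on_def)

lemma C1_map_on_tendsto:
  assumes "C1_map_on U f df" "x \<in> U" "(y \<longlongrightarrow> x) F" "(w \<longlongrightarrow> v) F"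
  shows "((\<lambda>i. df (y i) (w i)) \<longlongrightarrow> df x v) F"
proof -
  have "isCont (\<lambda>z. df (fst z) (snd z)) (x, v)"
    using C1_map_onD(4)[OF assms(1)] C1_map_onD(1)[OF assms(1)] assms(2)
    by (subst (asm) continuous_on_eq_continuous_at) (auto simp: open_Times)
  from isCont_tendsto_compose[OF this tendsto_Pair[OF assms(3,4)]] show ?thesis by simp
qed

text \<open>The mean value estimate on the segment from \<open>y i\<close> to \<open>y i + h i *\<^sub>R w i\<close> replaces the
  fundamental theorem of calculus, which is not available without completeness.\<close>

lemma C1_map_on_strict:
  assumes C1: "C1_map_on U f df" and x: "x \<in> U"
    and y: "(y \<longlongrightarrow> x) F" and w: "(w \<longlongrightarrow> v) F" and h: "(h \<longlongrightarrow> (0::real)) F" "eventually (\<lambda>i. h i \<noteq> 0) F"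
  shows "((\<lambda>i. (f (y i + h i *\<^sub>R w i) - f (y i)) /\<^sub>R h i) \<longlongrightarrow> df x v) F"
proof (rule tendsto_seminormI)
  fix p :: "'b \<Rightarrow> real" and e :: real
  assume p: "continuous_seminorm p" and e: "e > 0"
  have "eventually (\<lambda>z. p (df (fst z) (snd z) - df x v) < e / 2) (nhds (x, v))"
    using e tendsto_fst[OF filterlim_ident, of "(x, v)"] tendsto_snd[OF filterlim_ident, of "(x, v)"]
    by (intro seminorm_eventually_less[OF p] C1_map_on_tendsto[OF C1 x]) simp_all
  then obtain W where "open W" "(x, v) \<in> W"
    and W: "\<And>z. z \<in> W \<Longrightarrow> p (df (fst z) (snd z) - df x v) < e / 2"
    by (auto simp: eventually_nhds)
  then obtain N M where NM: "open N" "open M" "x \<in> N" "v \<in> M" "N \<times> M \<subseteq> W"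
    by (metis mem_Times_iff fst_conv snd_conv open_prod_elim)
  have dfNM: "p (df a c - df x v) \<le> e / 2" if "a \<in> N" "c \<in> M" for a c
    using W[of "(a, c)"] NM(5) that by force
  have "open (N \<inter> U)" "x \<in> N \<inter> U" using NM x C1_map_onD(1)[OF C1] by auto
  \<comment> \<open>A seminorm ball is used because the whole segment from \<open>y i\<close> to
    \<open>y i + h i *\<^sub>R w i\<close> has to stay in \<open>N \<inter> U\<close>; smallness of
    its two ingredients ensures this.\<close>
  then obtain q where q: "continuous_seminorm q" "{z. q (z - x) < 1} \<subseteq> N \<inter> U"
    using seminorm_ball_subset by blast
  have "((\<lambda>i. h i *\<^sub>R w i) \<longlongrightarrow> 0 *\<^sub>R v) F" by (intro tendsto_scaleR_lcs h w)
  then have "eventually (\<lambda>i. q (h i *\<^sub>R w i - 0) < 1 / 2) F"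
    by (intro seminorm_eventually_less[OF q(1)]) auto
  moreover have "eventually (\<lambda>i. q (y i - x) < 1 / 2) F"
    by (rule seminorm_eventually_less[OF q(1) y]) simp
  moreover have "eventually (\<lambda>i. w i \<in> M) F"
    using w NM by (auto dest: topological_tendstoD)
  ultimately show "eventually (\<lambda>i. p ((f (y i + h i *\<^sub>R w i) - f (y i)) /\<^sub>R h i - df x v) < e) F"
    using h(2)
  proof eventually_elim
    case (elim i)
    \<comment> \<open>Subtracting the expected linear term leaves a curve whose derivative is the
      error of \<open>df\<close>, scaled by \<open>h i\<close>; the mean value estimate then bounds
      the error of the quotient.\<close>
    define g where "g s = f (y i + (s * h i) *\<^sub>R w i) - s *\<^sub>R (h i *\<^sub>R df x v)" for s
    define g' where "g' s = h i *\<^sub>R df (y i + (s * h i) *\<^sub>R w i) (w i) - h i *\<^sub>R df x v" for s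
    have inNU: "y i + (s * h i) *\<^sub>R w i \<in> N \<inter> U" if "s \<in> {0..1}" for s
    proof -
      have "q (y i + (s * h i) *\<^sub>R w i - x) \<le> q (y i - x) + q (s *\<^sub>R (h i *\<^sub>R w i))"
        using seminorm_triangle[OF q(1), of "y i - x" "s *\<^sub>R (h i *\<^sub>R w i)"] by (simp add: algebra_simps)
      also have "q (s *\<^sub>R (h i *\<^sub>R w i)) = \<bar>s\<bar> * q (h i *\<^sub>R w i)" by (rule seminorm_scaleR[OF q(1)])
      also have "\<dots> \<le> 1 * q (h i *\<^sub>R w i)"
        using that by (intro mult_right_mono seminorm_nonneg[OF q(1)]) auto
      finally show ?thesis using elim(1,2) q(2) by auto
    qed
    have "p (g 1 - g 0) \<le> (\<bar>h i\<bar> * (e / 2)) * (1 - 0)"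
    proof (rule curve_mean_value[OF p, where D = g'])
      fix s :: real assume s: "s \<in> {0..1}"
      have "has_curve_deriv (\<lambda>s. f (y i + s *\<^sub>R w i)) (df (y i + (s * h i) *\<^sub>R w i) (w i)) (s * h i) UNIV"
        using C1_map_onD(3)[OF C1] inNU[OF s] by (simp add: has_dir_deriv_iff_curve[symmetric])
      moreover have sh: "has_curve_deriv (\<lambda>s. s * c) c s {0..1}" for c
        unfolding has_curve_deriv_real by (auto intro!: derivative_eq_intros)
      ultimately have "has_curve_deriv (\<lambda>s. f (y i + (s * h i) *\<^sub>R w i))
          (h i *\<^sub>R df (y i + (s * h i) *\<^sub>R w i) (w i)) s {0..1}"
        by (intro has_curve_deriv_comp_real[where \<sigma> = "\<lambda>s. s * h i"]) auto
      moreover have "has_curve_deriv (\<lambda>s. s *\<^sub>R (h i *\<^sub>R df x v)) (h i *\<^sub>R df x v) s {0..1}"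
        using has_curve_deriv_bilinear[OF continuous_bilinear_scaleR sh[of 1]
            has_curve_deriv_const[of "h i *\<^sub>R df x v"]] by simp
      ultimately show "has_curve_deriv g (g' s) s {0..1}"
        unfolding g_def g'_def by (rule has_curve_deriv_diff)
      have "p (g' s) = \<bar>h i\<bar> * p (df (y i + (s * h i) *\<^sub>R w i) (w i) - df x v)"
        unfolding g'_def scaleR_diff_right[symmetric] by (rule seminorm_scaleR[OF p])
      also have "\<dots> \<le> \<bar>h i\<bar> * (e / 2)"
        using inNU[OF s] elim(3) by (intro mult_left_mono dfNM) auto
      finally show "p (g' s) \<le> \<bar>h i\<bar> * (e / 2)" .
    qed simp
    moreover have "g 1 - g 0 = h i *\<^sub>R ((f (y i + h i *\<^sub>R w i) - f (y i)) /\<^sub>R h i - df x v)"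
      using elim(4) by (simp add: g_def scaleR_diff_right)
    ultimately have "\<bar>h i\<bar> * p ((f (y i + h i *\<^sub>R w i) - f (y i)) /\<^sub>R h i - df x v) \<le> \<bar>h i\<bar> * (e / 2)"
      by (simp add: seminorm_scaleR[OF p] del: scaleR_diff_right)
    then have "p ((f (y i + h i *\<^sub>R w i) - f (y i)) /\<^sub>R h i - df x v) \<le> e / 2"
      using elim(4) by (simp add: mult_le_cancel_left_pos)
    then show ?case using e by simp
  qed
qed

text \<open>Strict differentiability is applied at the fixed base point \<open>\<gamma> t\<close>
  with the difference quotient of \<open>\<gamma>\<close> as moving direction and
  \<open>s - t\<close> as step: base point plus step times direction is exactly
  \<open>\<gamma> s\<close>.\<close>

lemma C1_map_on_chain_curve:
  assumes "C1_map_on U f df" "has_curve_deriv \<gamma> D t S" "\<gamma> t \<in> U"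
  shows "has_curve_deriv (\<lambda>s. f (\<gamma> s)) (df (\<gamma> t) D) t S"
proof -
  have "((\<lambda>s. s - t) \<longlongrightarrow> t - t) (at t within S)" by (intro tendsto_intros)
  then have "((\<lambda>s. (f (\<gamma> t + (s - t) *\<^sub>R ((\<gamma> s - \<gamma> t) /\<^sub>R (s - t))) - f (\<gamma> t)) /\<^sub>R (s - t))
      \<longlongrightarrow> df (\<gamma> t) D) (at t within S)"
    using assms(2) unfolding has_curve_deriv_def
    by (intro C1_map_on_strict[OF assms(1,3)]) (auto simp: eventually_at_filter)
  then show ?thesis unfolding has_curve_deriv_def
    by (rule Lim_transform_eventually) (auto simp: eventually_at_filter)
qed

text \<open>The increment along \<open>v + w\<close> is taken in two steps. The second one starts at
  the moving point \<open>x + h *\<^sub>R v\<close>, which is why the strict form of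
  differentiability enters.\<close>

lemma C1_map_on_deriv_add:
  assumes C1: "C1_map_on U f df" and x: "x \<in> U"
  shows "df x (v + w) = df x v + df x w"
proof -
  have "((\<lambda>h. x + h *\<^sub>R v) \<longlongrightarrow> x + 0 *\<^sub>R v) (at (0::real))"
    by (intro tendsto_add tendsto_const tendsto_scaleR_lcs tendsto_ident_at)
  then have "((\<lambda>h. (f ((x + h *\<^sub>R v) + h *\<^sub>R w) - f (x + h *\<^sub>R v)) /\<^sub>R h) \<longlongrightarrow> df x w) (at 0)"
    by (intro C1_map_on_strict[OF C1 x]) (auto simp: eventually_at_filter)
  moreover have "((\<lambda>h. (f (x + h *\<^sub>R v) - f x) /\<^sub>R h) \<longlongrightarrow> df x v) (at 0)"
    using C1_map_onD(3)[OF C1 x] by (simp add: has_dir_deriv_def)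
  ultimately have "((\<lambda>h. (f ((x + h *\<^sub>R v) + h *\<^sub>R w) - f (x + h *\<^sub>R v)) /\<^sub>R h + (f (x + h *\<^sub>R v) - f x) /\<^sub>R h)
      \<longlongrightarrow> df x w + df x v) (at 0)"
    by (rule tendsto_add)
  then have "has_dir_deriv f x (v + w) (df x w + df x v)"
    by (simp add: has_dir_deriv_def scaleR_add_right[symmetric] add.assoc del: scaleR_add_right)
  then show ?thesis
    using has_dir_deriv_unique C1_map_onD(3)[OF C1 x] by (metis add.commute)
qed

text \<open>The line in direction \<open>c *\<^sub>R v\<close> is the line in direction
  \<open>v\<close> with its parameter multiplied by \<open>c\<close>; the composition rule includes
  the case \<open>c = 0\<close>.\<close>

lemma C1_map_on_deriv_scaleR:
  assumes C1: "C1_map_on U f df" and x: "x \<in> U"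
  shows "df x (c *\<^sub>R v) = c *\<^sub>R df x v"
proof -
  have "has_curve_deriv (\<lambda>s. s * c) c 0 UNIV"
    unfolding has_curve_deriv_real by (auto intro!: derivative_eq_intros)
  then have "has_curve_deriv (\<lambda>s. f (x + (s * c) *\<^sub>R v)) (c *\<^sub>R df x v) 0 UNIV"
    using C1_map_onD(3)[OF C1 x, of v] unfolding has_dir_deriv_iff_curve_zero
    by (intro has_curve_deriv_comp_real[where T = UNIV and \<sigma> = "\<lambda>s. s * c"]) auto
  then have "has_dir_deriv f x (c *\<^sub>R v) (c *\<^sub>R df x v)"
    by (simp add: has_dir_deriv_iff_curve_zero)
  then show ?thesis using has_dir_deriv_unique C1_map_onD(3)[OF C1 x] by blast
qed

lemma C1_map_on_deriv_zero: "C1_map_on U f df \<Longrightarrow> x \<in> U \<Longrightarrow> df x 0 = 0"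
  using C1_map_on_deriv_scaleR[of U f df x 0 0] by simp

section \<open>Compositions, pairs and linear maps\<close>

lemma C1_map_on_compose:
  assumes f: "C1_map_on U f df" and g: "C1_map_on V g dg" and UV: "f ` U \<subseteq> V"
  shows "C1_map_on U (\<lambda>x. g (f x)) (\<lambda>x v. dg (f x) (df x v))"
  unfolding C1_map_on_def
proof (intro conjI ballI allI)
  show "open U" by (rule C1_map_onD(1)[OF f])
  show "continuous_on U (\<lambda>x. g (f x))"
    by (rule continuous_on_compose2[OF C1_map_onD(2)[OF g] C1_map_onD(2)[OF f] UV])
  have "continuous_on (U \<times> UNIV) (\<lambda>z. (f (fst z), df (fst z) (snd z)))"
    by (intro continuous_on_Pair C1_map_onD(4)[OF f]
        continuous_on_compose2[OF C1_map_onD(2)[OF f] continuous_on_fst[OF continuous_on_id]]) auto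
  moreover have "(\<lambda>z. (f (fst z), df (fst z) (snd z))) ` (U \<times> UNIV) \<subseteq> V \<times> UNIV"
    using UV by force
  ultimately show "continuous_on (U \<times> UNIV) (\<lambda>z. dg (f (fst z)) (df (fst z) (snd z)))"
    using continuous_on_compose2[OF C1_map_onD(4)[OF g]] by fastforce
  show "has_dir_deriv (\<lambda>x. g (f x)) x v (dg (f x) (df x v))" if "x \<in> U" for x v
    using C1_map_on_chain_curve[OF g C1_map_onD(3)[OF f that, of v, unfolded has_dir_deriv_iff_curve_zero]]
      UV that by (auto simp: has_dir_deriv_iff_curve_zero)
qed

lemma C1_map_on_Pair:
  assumes f: "C1_map_on U f df" and g: "C1_map_on U g dg"
  shows "C1_map_on U (\<lambda>x. (f x, g x)) (\<lambda>x v. (df x v, dg x v))"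
  unfolding C1_map_on_def
proof (intro conjI ballI allI)
  show "open U" by (rule C1_map_onD(1)[OF f])
  show "continuous_on U (\<lambda>x. (f x, g x))"
    "continuous_on (U \<times> UNIV) (\<lambda>z. (df (fst z) (snd z), dg (fst z) (snd z)))"
    using C1_map_onD[OF f] C1_map_onD[OF g] by (auto intro!: continuous_on_Pair)
  show "has_dir_deriv (\<lambda>x. (f x, g x)) x v (df x v, dg x v)" if "x \<in> U" for x v
    using tendsto_Pair[OF C1_map_onD(3)[OF f that, of v, unfolded has_dir_deriv_def]
        C1_map_onD(3)[OF g that, of v, unfolded has_dir_deriv_def]]
    by (simp add: has_dir_deriv_def scaleR_prod_def)
qed

lemma C1_map_on_linear:
  assumes "open U" "\<And>x y. L (x + y) = L x + L y" "\<And>a x. L (a *\<^sub>R x) = a *\<^sub>R L x" "continuous_on UNIV L"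
  shows "C1_map_on U L (\<lambda>_ v. L v)"
  unfolding C1_map_on_def
proof (intro conjI ballI allI)
  show "continuous_on U L" using assms(4) continuous_on_subset by blast
  show "continuous_on (U \<times> UNIV) (\<lambda>z. L (snd z))"
    by (rule continuous_on_compose2[OF assms(4) continuous_on_snd[OF continuous_on_id]]) simp
  show "has_dir_deriv L x v (L v)" for x v
    unfolding has_dir_deriv_def assms(2,3)
    by (rule Lim_transform_eventually[OF tendsto_const]) (auto simp: eventually_at_filter)
qed (rule assms(1))

lemma C1_map_on_const: "open U \<Longrightarrow> C1_map_on U (\<lambda>_. c) (\<lambda>_ _. 0)"
  by (auto simp: C1_map_on_def has_dir_deriv_def)

text \<open>The derivative of the composition is the joint map of \<open>dg\<close> after the pair
  of \<open>f\<close> and \<open>df\<close>, both regarded as maps on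
  \<open>U \<times> UNIV\<close>, so the \<open>C1\<close> rules apply to it.\<close>

lemma C2_map_on_compose:
  assumes f: "C2_map_on U f df" and g: "C2_map_on V g dg" and UV: "f ` U \<subseteq> V"
  shows "C2_map_on U (\<lambda>x. g (f x)) (\<lambda>x v. dg (f x) (df x v))"
proof -
  obtain ddf ddg where ddf: "C1_map_on (U \<times> UNIV) (\<lambda>z. df (fst z) (snd z)) ddf"
    and ddg: "C1_map_on (V \<times> UNIV) (\<lambda>z. dg (fst z) (snd z)) ddg"
    using f g by (auto simp: C2_map_on_def)
  have f1: "C1_map_on U f df" and g1: "C1_map_on V g dg" using f g by (auto simp: C2_map_on_def)
  have "C1_map_on (U \<times> UNIV :: ('a \<times> 'a) set) fst (\<lambda>_. fst)"
    using C1_map_onD(1)[OF f1] by (intro C1_map_on_linear) (auto simp: open_Times intro!: continuous_intros)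
  then have "C1_map_on (U \<times> UNIV :: ('a \<times> 'a) set) (\<lambda>z. f (fst z)) (\<lambda>x v. df (fst x) (fst v))"
    by (rule C1_map_on_compose[OF _ f1]) auto
  moreover have "(\<lambda>z. (f (fst z), df (fst z) (snd z))) ` (U \<times> UNIV) \<subseteq> V \<times> UNIV"
    using UV by force
  ultimately have "C1_map_on (U \<times> UNIV) (\<lambda>z. dg (f (fst z)) (df (fst z) (snd z)))
     (\<lambda>z v. ddg (f (fst z), df (fst z) (snd z)) (df (fst z) (fst v), ddf z v))"
    using C1_map_on_compose[OF C1_map_on_Pair[OF _ ddf] ddg] by fastforce
  then show ?thesis
    using C1_map_on_compose[OF f1 g1 UV] unfolding C2_map_on_def by blast
qed

lemma C2_map_on_Pair:
  assumes f: "C2_map_on U f df" and g: "C2_map_on U g dg"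
  shows "C2_map_on U (\<lambda>x. (f x, g x)) (\<lambda>x v. (df x v, dg x v))"
proof -
  obtain ddf ddg where ddf: "C1_map_on (U \<times> UNIV) (\<lambda>z. df (fst z) (snd z)) ddf"
    and ddg: "C1_map_on (U \<times> UNIV) (\<lambda>z. dg (fst z) (snd z)) ddg"
    using f g by (auto simp: C2_map_on_def)
  show ?thesis
    using C1_map_on_Pair[OF C2_map_on_imp_C1[OF f] C2_map_on_imp_C1[OF g]] C1_map_on_Pair[OF ddf ddg]
    by (auto simp: C2_map_on_def)
qed

lemma C2_map_on_linear:
  assumes "open U" "\<And>x y. L (x + y) = L x + L y" "\<And>a x. L (a *\<^sub>R x) = a *\<^sub>R L x" "continuous_on UNIV L"
  shows "C2_map_on U L (\<lambda>_ v. L v)"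
proof -
  have "C1_map_on (U \<times> UNIV) (\<lambda>z. L (snd z)) (\<lambda>_ v. L (snd v))"
    using assms by (intro C1_map_on_linear)
      (auto simp: open_Times intro!: continuous_on_compose2[OF assms(4) continuous_on_snd[OF continuous_on_id]])
  then show ?thesis using C1_map_on_linear[OF assms] by (auto simp: C2_map_on_def)
qed

lemma C2_map_on_fst: "open U \<Longrightarrow> C2_map_on U fst (\<lambda>_ v. fst v)"
  by (rule C2_map_on_linear) (auto intro!: continuous_intros)

lemma C2_map_on_snd: "open U \<Longrightarrow> C2_map_on U snd (\<lambda>_ v. snd v)"
  by (rule C2_map_on_linear) (auto intro!: continuous_intros)

text \<open>Directions are stored as sequences there; precomposing with constant sequences recovers
  continuity in a single direction.\<close>

lemma bastiani_imp_C1: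
  assumes "bastiani k U f" "1 \<le> k"
  shows "C1_map_on U f (dir_deriv f)"
  unfolding C1_map_on_def
proof (intro conjI ballI allI)
  have k: "enat (Suc 0) \<le> k" "enat 0 \<le> k" using assms(2) by (simp_all add: one_enat_def zero_enat_def[symmetric])
  show "open U" using assms(1) by (simp add: bastiani_def)
  have c0: "continuous_on (U \<times> UNIV) (\<lambda>(x, v::nat \<Rightarrow> 'a). f x)"
  proof -
    have "continuous_on (U \<times> UNIV) (\<lambda>(x, v). iter_deriv 0 f x v)"
      using assms(1) k(2) unfolding bastiani_def by blast
    then show ?thesis by simp
  qed
  have "continuous_on U (\<lambda>x. (x, (\<lambda>_. 0)::nat \<Rightarrow> 'a))" by (intro continuous_intros)
  from continuous_on_compose2[OF c0 this] show "continuous_on U f" by auto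
  have "continuous_on (U \<times> UNIV) (\<lambda>(x, v). iter_deriv (Suc 0) f x v)"
    using assms(1) k(1) unfolding bastiani_def by blast
  then have c1: "continuous_on (U \<times> UNIV) (\<lambda>z. dir_deriv f (fst z) (snd z (0::nat)))"
    by (simp add: split_beta)
  have "continuous_on (U \<times> UNIV) (\<lambda>z. (fst z, (\<lambda>_. snd z)::nat \<Rightarrow> 'a))"
    by (intro continuous_intros continuous_on_coordinatewise_then_product)
  from continuous_on_compose2[OF c1 this]
  show "continuous_on (U \<times> UNIV) (\<lambda>z. dir_deriv f (fst z) (snd z))" by (auto simp: image_subset_iff)
  show "has_dir_deriv f x v (dir_deriv f x v)" if "x \<in> U" for x v
  proof -
    have "\<exists>d. has_dir_deriv (\<lambda>y. iter_deriv 0 f y (\<lambda>_. v)) x v d"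
      using assms(1) k(1) that unfolding bastiani_def by blast
    then show ?thesis using dir_deriv_eqI by fastforce
  qed
qed

text \<open>The derivative of the joint map of \<open>dir_deriv f\<close> has two parts: the second
  derivative in the base point and, by linearity, \<open>dir_deriv f\<close> applied to the
  increment of the direction.\<close>

lemma bastiani_imp_C2:
  assumes "bastiani k U f" "2 \<le> k"
  shows "C2_map_on U f (dir_deriv f)"
proof -
  have "1 \<le> k" using order_trans[OF one_le_numeral assms(2)] .
  then have C1: "C1_map_on U f (dir_deriv f)" using assms(1) by (intro bastiani_imp_C1)
  note U = C1_map_onD(1)[OF C1]
  have k: "enat (Suc (Suc 0)) \<le> k" using assms(2) by (simp add: numeral_eq_enat numeral_2_eq_2)
  define d2 where "d2 x v w = dir_deriv (\<lambda>y. dir_deriv f y v) x w" for x v w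
  have D2: "has_dir_deriv (\<lambda>y. dir_deriv f y v) x w (d2 x v w)" if "x \<in> U" for x v w
  proof -
    have "\<exists>d. has_dir_deriv (\<lambda>y. iter_deriv (Suc 0) f y (\<lambda>i. if i = 0 then v else w)) x
        (if Suc 0 = 0 then v else w) d"
      using assms(1) k that unfolding bastiani_def by blast
    then obtain d where "has_dir_deriv (\<lambda>y. dir_deriv f y v) x w d" by auto
    then show ?thesis using dir_deriv_eqI unfolding d2_def by fastforce
  qed
  have "continuous_on (U \<times> UNIV) (\<lambda>(x, v). iter_deriv (Suc (Suc 0)) f x v)"
    using assms(1) k unfolding bastiani_def by blast
  then have c: "continuous_on (U \<times> UNIV) (\<lambda>z. d2 (fst z) (snd z (0::nat)) (snd z (Suc 0)))"
    by (simp add: split_beta d2_def)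
  have "continuous_on ((U \<times> UNIV) \<times> UNIV)
      (\<lambda>z. (fst (fst z), (\<lambda>i. if i = 0 then snd (fst z) else fst (snd z :: 'a \<times> 'a)) :: nat \<Rightarrow> 'a))"
  proof (intro continuous_on_Pair continuous_on_coordinatewise_then_product)
    fix i :: nat
    show "continuous_on ((U \<times> UNIV) \<times> UNIV) (\<lambda>z. if i = 0 then snd (fst z) else fst (snd z) :: 'a)"
      by (cases "i = 0") (auto intro!: continuous_intros)
  qed (intro continuous_intros)
  from continuous_on_compose2[OF c this]
  have c2: "continuous_on ((U \<times> UNIV) \<times> UNIV) (\<lambda>z. d2 (fst (fst z)) (snd (fst z)) (fst (snd z :: 'a \<times> 'a)))"
    by (auto simp: image_subset_iff)
  define ddf where "ddf z u = d2 (fst z) (snd z) (fst u) + dir_deriv f (fst z) (snd u)" for z u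
  have "C1_map_on (U \<times> UNIV) (\<lambda>z. dir_deriv f (fst z) (snd z)) ddf"
    unfolding C1_map_on_def
  proof (intro conjI ballI allI)
    show "open (U \<times> (UNIV::'a set))" using U by (simp add: open_Times)
    show "continuous_on (U \<times> UNIV) (\<lambda>z. dir_deriv f (fst z) (snd z))" by (rule C1_map_onD(4)[OF C1])
    have "continuous_on ((U \<times> UNIV) \<times> UNIV) (\<lambda>z. (fst (fst z), snd (snd z)) :: 'a \<times> 'a)"
      by (intro continuous_intros)
    from continuous_on_compose2[OF C1_map_onD(4)[OF C1] this]
    have "continuous_on ((U \<times> UNIV) \<times> UNIV) (\<lambda>z. dir_deriv f (fst (fst z)) (snd (snd z)))"
      by (auto simp: image_subset_iff)
    with c2 show "continuous_on ((U \<times> UNIV) \<times> UNIV) (\<lambda>z. ddf (fst z) (snd z))"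
      unfolding ddf_def by (intro continuous_intros)
    fix z u :: "'a \<times> 'a" assume "z \<in> U \<times> UNIV"
    then have z: "fst z \<in> U" by auto
    have lim: "((\<lambda>h. x + h *\<^sub>R w) \<longlongrightarrow> x) (at (0::real))" for x w :: 'a
    proof -
      have "((\<lambda>h. x + h *\<^sub>R w) \<longlongrightarrow> x + 0 *\<^sub>R w) (at (0::real))"
        by (intro tendsto_add tendsto_const tendsto_scaleR_lcs tendsto_ident_at)
      then show ?thesis by simp
    qed
    \<comment> \<open>The quotient of the joint map, split by linearity in the direction. Its second
      part still has the moving base point, which joint continuity handles.\<close>
    have "((\<lambda>h. (dir_deriv f (fst z + h *\<^sub>R fst u) (snd z) - dir_deriv f (fst z) (snd z)) /\<^sub>R h
          + dir_deriv f (fst z + h *\<^sub>R fst u) (snd u)) \<longlongrightarrow> ddf z u) (at 0)"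
      unfolding ddf_def
      using D2[OF z] by (intro tendsto_add C1_map_on_tendsto[OF C1 z] lim tendsto_const)
        (simp add: has_dir_deriv_def)
    moreover have "eventually (\<lambda>h. (dir_deriv f (fst z + h *\<^sub>R fst u) (snd z) - dir_deriv f (fst z) (snd z)) /\<^sub>R h
          + dir_deriv f (fst z + h *\<^sub>R fst u) (snd u)
        = (dir_deriv f (fst (z + h *\<^sub>R u)) (snd (z + h *\<^sub>R u)) - dir_deriv f (fst z) (snd z)) /\<^sub>R h) (at 0)"
    proof -
      have "eventually (\<lambda>h. fst z + h *\<^sub>R fst u \<in> U) (at (0::real))"
        using topological_tendstoD[OF lim U z] .
      moreover have "eventually (\<lambda>h. h \<noteq> 0) (at (0::real))" by (simp add: eventually_at_filter)
      ultimately show ?thesis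
      proof eventually_elim
        case (elim h)
        then show ?case
          by (simp add: C1_map_on_deriv_add[OF C1] C1_map_on_deriv_scaleR[OF C1] scaleR_add_right scaleR_diff_right)
      qed
    qed
    ultimately show "has_dir_deriv (\<lambda>z. dir_deriv f (fst z) (snd z)) z u (ddf z u)"
      unfolding has_dir_deriv_def by (rule Lim_transform_eventually)
  qed
  then show ?thesis using C1 by (auto simp: C2_map_on_def)
qed

section \<open>Sequences of curves with controlled derivatives\<close>

text \<open>The rate \<open>r\<close> is common to all seminorms and only the factor
  \<open>C\<close> depends on \<open>p\<close>. A single curve is treated as a constant sequence
  with rate 1.\<close>

definition mackey_bounded :: "real set \<Rightarrow> (nat \<Rightarrow> real) \<Rightarrow> (nat \<Rightarrow> real \<Rightarrow> 'e::locally_convex_space) \<Rightarrow> bool" where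
  "mackey_bounded S r \<gamma> \<longleftrightarrow> (\<forall>p. continuous_seminorm p \<longrightarrow>
     (\<exists>C\<ge>0. \<forall>n. \<forall>t\<in>S. p (\<gamma> n t) \<le> C * r n))"

primrec mackey_Ck ::
  "nat \<Rightarrow> real set \<Rightarrow> (nat \<Rightarrow> real) \<Rightarrow> (nat \<Rightarrow> real \<Rightarrow> 'e::locally_convex_space) \<Rightarrow> bool" where
  "mackey_Ck 0 S r \<gamma> \<longleftrightarrow> mackey_bounded S r \<gamma> \<and> (\<forall>n. continuous_on S (\<gamma> n))"
| "mackey_Ck (Suc j) S r \<gamma> \<longleftrightarrow> mackey_bounded S r \<gamma> \<and>
     (\<exists>\<gamma>'. (\<forall>n. \<forall>t\<in>S. has_curve_deriv (\<gamma> n) (\<gamma>' n t) t S) \<and> mackey_Ck j S r \<gamma>')"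

lemma mackey_boundedI:
  "(\<And>p. continuous_seminorm p \<Longrightarrow> \<exists>C\<ge>0. \<forall>n. \<forall>t\<in>S. p (\<gamma> n t) \<le> C * r n) \<Longrightarrow> mackey_bounded S r \<gamma>"
  by (simp add: mackey_bounded_def)

lemma mackey_boundedE:
  assumes "mackey_bounded S r \<gamma>" "continuous_seminorm p"
  obtains C where "C \<ge> 0" "\<And>n t. t \<in> S \<Longrightarrow> p (\<gamma> n t) \<le> C * r n"
  using assms unfolding mackey_bounded_def by blast

lemma mackey_bounded_add:
  assumes "mackey_bounded S r \<gamma>" "mackey_bounded S r \<delta>"
  shows "mackey_bounded S r (\<lambda>n t. \<gamma> n t + \<delta> n t)"
proof (rule mackey_boundedI)
  fix p :: "'a \<Rightarrow> real" assume p: "continuous_seminorm p"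
  obtain C where C: "C \<ge> 0" "\<And>n t. t \<in> S \<Longrightarrow> p (\<gamma> n t) \<le> C * r n"
    using mackey_boundedE[OF assms(1) p] by blast
  obtain D where D: "D \<ge> 0" "\<And>n t. t \<in> S \<Longrightarrow> p (\<delta> n t) \<le> D * r n"
    using mackey_boundedE[OF assms(2) p] by blast
  have "p (\<gamma> n t + \<delta> n t) \<le> (C + D) * r n" if "t \<in> S" for n t
    using order_trans[OF seminorm_triangle[OF p] add_mono[OF C(2)[OF that] D(2)[OF that]]]
    by (simp add: distrib_right)
  then show "\<exists>C\<ge>0. \<forall>n. \<forall>t\<in>S. p (\<gamma> n t + \<delta> n t) \<le> C * r n"
    using C(1) D(1) by (intro exI[of _ "C + D"]) simp
qed

lemma mackey_bounded_bilinear: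
  assumes b: "continuous_bilinear b" and "mackey_bounded S r \<gamma>" "mackey_bounded S r' \<delta>"
  shows "mackey_bounded S (\<lambda>n. r n * r' n) (\<lambda>n t. b (\<gamma> n t) (\<delta> n t))"
proof (rule mackey_boundedI)
  fix p :: "'c \<Rightarrow> real" assume p: "continuous_seminorm p"
  obtain q q' where q: "continuous_seminorm q" "continuous_seminorm q'" "\<And>x y. p (b x y) \<le> q x * q' y"
    using bilinear_bounded[OF b p] by blast
  obtain C where C: "C \<ge> 0" "\<And>n t. t \<in> S \<Longrightarrow> q (\<gamma> n t) \<le> C * r n"
    using mackey_boundedE[OF assms(2) q(1)] by blast
  obtain D where D: "D \<ge> 0" "\<And>n t. t \<in> S \<Longrightarrow> q' (\<delta> n t) \<le> D * r' n"
    using mackey_boundedE[OF assms(3) q(2)] by blast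
  have "p (b (\<gamma> n t) (\<delta> n t)) \<le> (C * D) * (r n * r' n)" if "t \<in> S" for n t
  proof -
    have "q (\<gamma> n t) * q' (\<delta> n t) \<le> (C * r n) * (D * r' n)"
      by (intro mult_mono C(2) D(2) that seminorm_nonneg[OF q(2)]
          order_trans[OF seminorm_nonneg[OF q(1)] C(2)[OF that]])
    then show ?thesis using q(3)[of "\<gamma> n t" "\<delta> n t"] by (simp add: ac_simps)
  qed
  then show "\<exists>C\<ge>0. \<forall>n. \<forall>t\<in>S. p (b (\<gamma> n t) (\<delta> n t)) \<le> C * (r n * r' n)"
    using C(1) D(1) by (intro exI[of _ "C * D"]) simp
qed

lemma mackey_bounded_operator:
  assumes "compact S" "continuous_on (S \<times> UNIV) (\<lambda>(t, x). A t x)"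
    and "\<And>t a x. t \<in> S \<Longrightarrow> A t (a *\<^sub>R x) = a *\<^sub>R A t x"
    and "mackey_bounded S r \<gamma>"
  shows "mackey_bounded S r (\<lambda>n t. A t (\<gamma> n t))"
proof (rule mackey_boundedI)
  fix p :: "'b \<Rightarrow> real" assume p: "continuous_seminorm p"
  obtain q where q: "continuous_seminorm q" "\<And>t x. t \<in> S \<Longrightarrow> p (A t x) \<le> q x"
    using compact_family_bounded[OF p assms(1-3)] by blast
  obtain C where C: "C \<ge> 0" "\<And>n t. t \<in> S \<Longrightarrow> q (\<gamma> n t) \<le> C * r n"
    using mackey_boundedE[OF assms(4) q(1)] by blast
  then show "\<exists>C\<ge>0. \<forall>n. \<forall>t\<in>S. p (A t (\<gamma> n t)) \<le> C * r n"
    by (intro exI[of _ C] conjI allI ballI order_trans[OF q(2) C(2)])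
qed

lemma mackey_bounded_const: "mackey_bounded S (\<lambda>n. \<bar>c n\<bar>) (\<lambda>n _. c n *\<^sub>R v)"
proof (rule mackey_boundedI)
  fix p :: "'a \<Rightarrow> real" assume p: "continuous_seminorm p"
  show "\<exists>C\<ge>0. \<forall>n. \<forall>t\<in>S. p (c n *\<^sub>R v) \<le> C * \<bar>c n\<bar>"
    by (intro exI[of _ "p v"]) (simp add: seminorm_scaleR[OF p] seminorm_nonneg[OF p])
qed

lemma mackey_Ck_imp_bounded: "mackey_Ck j S r \<gamma> \<Longrightarrow> mackey_bounded S r \<gamma>"
  by (cases j) auto

lemma mackey_Ck_continuous_on: "mackey_Ck j S r \<gamma> \<Longrightarrow> continuous_on S (\<gamma> n)"
  by (cases j) (auto intro: has_curve_deriv_continuous_on)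

lemma mackey_Ck_SucD: "mackey_Ck (Suc j) S r \<gamma> \<Longrightarrow> mackey_Ck j S r \<gamma>"
proof (induction j arbitrary: \<gamma>)
  case 0
  then show ?case using mackey_Ck_continuous_on[OF 0] mackey_Ck_imp_bounded[OF 0] by simp
next
  case (Suc j)
  then show ?case by (metis mackey_Ck.simps(2))
qed

lemma mackey_Ck_add:
  "mackey_Ck j S r \<gamma> \<Longrightarrow> mackey_Ck j S r \<delta> \<Longrightarrow> mackey_Ck j S r (\<lambda>n t. \<gamma> n t + \<delta> n t)"
proof (induction j arbitrary: \<gamma> \<delta>)
  case 0
  then show ?case by (auto intro: mackey_bounded_add continuous_on_add)
next
  case (Suc j)
  obtain \<gamma>' where \<gamma>': "\<And>n t. t \<in> S \<Longrightarrow> has_curve_deriv (\<gamma> n) (\<gamma>' n t) t S" "mackey_Ck j S r \<gamma>'"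
    using Suc.prems(1) by auto
  obtain \<delta>' where \<delta>': "\<And>n t. t \<in> S \<Longrightarrow> has_curve_deriv (\<delta> n) (\<delta>' n t) t S" "mackey_Ck j S r \<delta>'"
    using Suc.prems(2) by auto
  show ?case
    unfolding mackey_Ck.simps
    using Suc.prems \<gamma>'(1) \<delta>'(1) Suc.IH[OF \<gamma>'(2) \<delta>'(2)]
    by (intro conjI exI[of _ "\<lambda>n t. \<gamma>' n t + \<delta>' n t"])
      (auto intro: mackey_bounded_add has_curve_deriv_add)
qed

text \<open>Leibniz rule by induction on the order. Each summand of the derivative pairs a
  derivative with an undifferentiated factor, whose order is lowered by
  \<open>mackey_Ck_SucD\<close> to match.\<close>

lemma mackey_Ck_bilinear:
  assumes b: "continuous_bilinear b"
  shows "mackey_Ck j S r \<gamma> \<Longrightarrow> mackey_Ck j S r' \<delta> \<Longrightarrow>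
    mackey_Ck j S (\<lambda>n. r n * r' n) (\<lambda>n t. b (\<gamma> n t) (\<delta> n t))"
proof (induction j arbitrary: \<gamma> \<delta>)
  case 0
  then show ?case
    by (auto intro: mackey_bounded_bilinear[OF b] bilinear_continuous_on[OF b])
next
  case (Suc j)
  obtain \<gamma>' where \<gamma>': "\<And>n t. t \<in> S \<Longrightarrow> has_curve_deriv (\<gamma> n) (\<gamma>' n t) t S" "mackey_Ck j S r \<gamma>'"
    using Suc.prems(1) by auto
  obtain \<delta>' where \<delta>': "\<And>n t. t \<in> S \<Longrightarrow> has_curve_deriv (\<delta> n) (\<delta>' n t) t S" "mackey_Ck j S r' \<delta>'"
    using Suc.prems(2) by auto
  have "mackey_Ck j S (\<lambda>n. r n * r' n) (\<lambda>n t. b (\<gamma>' n t) (\<delta> n t) + b (\<gamma> n t) (\<delta>' n t))"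
    by (rule mackey_Ck_add[OF Suc.IH[OF \<gamma>'(2) mackey_Ck_SucD[OF Suc.prems(2)]]
          Suc.IH[OF mackey_Ck_SucD[OF Suc.prems(1)] \<delta>'(2)]])
  then show ?case
    unfolding mackey_Ck.simps
    using Suc.prems \<gamma>'(1) \<delta>'(1)
    by (intro conjI exI[of _ "\<lambda>n t. b (\<gamma>' n t) (\<delta> n t) + b (\<gamma> n t) (\<delta>' n t)"])
      (auto intro: mackey_bounded_bilinear[OF b] has_curve_deriv_bilinear[OF b])
qed

lemma mackey_Ck_const: "mackey_Ck j S (\<lambda>n. \<bar>c n\<bar>) (\<lambda>n _. c n *\<^sub>R v)"
proof (induction j arbitrary: v)
  case (Suc j)
  then show ?case
    using mackey_bounded_const[of S c v] has_curve_deriv_const Suc.IH[of 0]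
    by (auto intro!: exI[of _ "\<lambda>_ _. 0"])
qed (auto intro: mackey_bounded_const)

text \<open>Later \<open>c n\<close> is the dilation factor \<open>2 ^ Suc n\<close> of the
  concatenation, and its cost is recorded in the rate.\<close>

lemma mackey_Ck_scale:
  assumes "mackey_Ck j S r \<gamma>"
  shows "mackey_Ck j S (\<lambda>n. \<bar>c n\<bar> * r n) (\<lambda>n t. c n *\<^sub>R \<gamma> n t)"
  using mackey_Ck_bilinear[OF continuous_bilinear_scaleR mackey_Ck_const[of j S c 1] assms] by simp

text \<open>The derivative is \<open>\<beta>\<close> times a composition of the same kind, so the
  induction closes as soon as \<open>\<beta>\<close> itself has derivatives bounded with rate 1; no
  formula for higher chain rules is needed.\<close>

lemma mackey_Ck_compose:
  fixes \<sigma> :: "real \<Rightarrow> real" and \<gamma> :: "nat \<Rightarrow> real \<Rightarrow> 'e::locally_convex_space"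
  assumes \<sigma>: "\<And>t. t \<in> S \<Longrightarrow> has_curve_deriv \<sigma> (\<beta> t) t S" "\<And>t. t \<in> S \<Longrightarrow> \<sigma> t \<in> T"
  shows "mackey_Ck j S (\<lambda>_. 1) (\<lambda>_. \<beta>) \<Longrightarrow> mackey_Ck j T r \<gamma> \<Longrightarrow> mackey_Ck j S r (\<lambda>n t. \<gamma> n (\<sigma> t))"
proof (induction j arbitrary: \<gamma>)
  have bnd: "mackey_bounded S r (\<lambda>n t. \<gamma> n (\<sigma> t))" if "mackey_bounded T r \<gamma>"
    for \<gamma> :: "nat \<Rightarrow> real \<Rightarrow> 'e"
    using that \<sigma>(2) unfolding mackey_bounded_def by meson
  {
    case 0
    have "continuous_on S \<sigma>" by (rule has_curve_deriv_continuous_on[OF \<sigma>(1)])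
    then have "continuous_on S (\<lambda>t. \<gamma> n (\<sigma> t))" for n
      using 0 \<sigma>(2) by (auto intro: continuous_on_compose2)
    then show ?case using 0 bnd by auto
  next
    case (Suc j)
    obtain \<gamma>' where \<gamma>': "\<And>n t. t \<in> T \<Longrightarrow> has_curve_deriv (\<gamma> n) (\<gamma>' n t) t T" "mackey_Ck j T r \<gamma>'"
      using Suc.prems(2) by auto
    have "mackey_Ck j S (\<lambda>n. 1 * r n) (\<lambda>n t. \<beta> t *\<^sub>R \<gamma>' n (\<sigma> t))"
      by (rule mackey_Ck_bilinear[OF continuous_bilinear_scaleR mackey_Ck_SucD[OF Suc.prems(1)]
            Suc.IH[OF mackey_Ck_SucD[OF Suc.prems(1)] \<gamma>'(2)]])
    moreover have "has_curve_deriv (\<lambda>t. \<gamma> n (\<sigma> t)) (\<beta> t *\<^sub>R \<gamma>' n (\<sigma> t)) t S" if "t \<in> S" for n t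
      using that \<sigma> \<gamma>'(1) by (intro has_curve_deriv_comp_real) auto
    ultimately show ?case
      unfolding mackey_Ck.simps using bnd[OF mackey_Ck_imp_bounded[OF Suc.prems(2)]]
      by (intro conjI exI[of _ "\<lambda>n t. \<beta> t *\<^sub>R \<gamma>' n (\<sigma> t)"]) simp_all
  }
qed

lemma mackey_Ck_chain:
  assumes "\<And>i n t. i < j \<Longrightarrow> t \<in> S \<Longrightarrow> has_curve_deriv (D i n) (D (Suc i) n t) t S"
    and "\<And>i n. i \<le> j \<Longrightarrow> continuous_on S (D i n)"
    and "\<And>i. i \<le> j \<Longrightarrow> mackey_bounded S r (D i)"
  shows "mackey_Ck j S r (D 0)"
  using assms
proof (induction j arbitrary: D)
  case (Suc j)
  have "mackey_Ck j S r (D (Suc 0))"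
    using Suc.prems by (intro Suc.IH[of "\<lambda>i. D (Suc i)"]) auto
  then show ?case using Suc.prems(1)[of 0] Suc.prems(3)[of 0] by auto
qed simp

text \<open>The increment splits as \<open>A s (\<gamma> s - \<gamma> t)\<close> plus
  \<open>A s (\<gamma> t) - A t (\<gamma> t)\<close>. Joint continuity settles the first part and
  pointwise differentiability the second. Keeping \<open>A t\<close> in front of the result is what
  makes iteration possible.\<close>

lemma has_curve_deriv_operator:
  assumes cont: "continuous_on (S \<times> UNIV) (\<lambda>(t, x). A t x)" and t: "t \<in> S"
    and add: "\<And>t x y. t \<in> S \<Longrightarrow> A t (x + y) = A t x + A t y"
    and hom: "\<And>t a x. t \<in> S \<Longrightarrow> A t (a *\<^sub>R x) = a *\<^sub>R A t x"
    and A': "has_curve_deriv (\<lambda>s. A s (\<gamma> t)) (A t B) t S" and \<gamma>: "has_curve_deriv \<gamma> D t S"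
  shows "has_curve_deriv (\<lambda>s. A s (\<gamma> s)) (A t (D + B)) t S"
proof -
  have diff: "A t (x - y) = A t x - A t y" if "t \<in> S" for t x y
    using add[OF that, of "x - y" y] by simp
  have "((\<lambda>s. (s, (\<gamma> s - \<gamma> t) /\<^sub>R (s - t))) \<longlongrightarrow> (t, D)) (at t within S)"
    using \<gamma> unfolding has_curve_deriv_def by (intro tendsto_Pair tendsto_ident_at)
  then have "((\<lambda>s. A s ((\<gamma> s - \<gamma> t) /\<^sub>R (s - t))) \<longlongrightarrow> A t D) (at t within S)"
    using continuous_on_tendsto_compose[OF cont, of "\<lambda>s. (s, (\<gamma> s - \<gamma> t) /\<^sub>R (s - t))" "(t, D)"] t
    by (simp add: eventually_at_filter)
  from tendsto_add[OF this A'[unfolded has_curve_deriv_def]]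
  have "((\<lambda>s. A s ((\<gamma> s - \<gamma> t) /\<^sub>R (s - t)) + (A s (\<gamma> t) - A t (\<gamma> t)) /\<^sub>R (s - t)) \<longlongrightarrow> A t (D + B)) (at t within S)"
    by (simp add: add t)
  then show ?thesis
    unfolding has_curve_deriv_def
    by (rule Lim_transform_eventually)
      (auto simp: eventually_at_filter diff hom scaleR_diff_right)
qed

text \<open>The derivative of \<open>A t (\<gamma> n t)\<close> is \<open>A t\<close> applied to
  \<open>\<gamma>' n t + b (\<phi> t) (\<gamma> n t)\<close>, a sequence with the same rate and one
  order less. The induction is thus on the argument, with \<open>A\<close> fixed, and asks for
  regularity of \<open>\<phi>\<close> and \<open>\<gamma>\<close> only.\<close>

lemma mackey_Ck_operator:
  assumes S: "compact S" and cont: "continuous_on (S \<times> UNIV) (\<lambda>(t, x). A t x)"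
    and add: "\<And>t x y. t \<in> S \<Longrightarrow> A t (x + y) = A t x + A t y"
    and hom: "\<And>t a x. t \<in> S \<Longrightarrow> A t (a *\<^sub>R x) = a *\<^sub>R A t x"
    and b: "continuous_bilinear b"
    and A': "\<And>t x. t \<in> S \<Longrightarrow> has_curve_deriv (\<lambda>s. A s x) (A t (b (\<phi> t) x)) t S"
  shows "mackey_Ck j S (\<lambda>_. 1) (\<lambda>_. \<phi>) \<Longrightarrow> mackey_Ck j S r \<gamma> \<Longrightarrow> mackey_Ck j S r (\<lambda>n t. A t (\<gamma> n t))"
proof (induction j arbitrary: \<gamma>)
  case 0
  have "continuous_on S (\<lambda>t. A t (\<gamma> n t))" for n
    using continuous_on_compose2[OF cont continuous_on_Pair[OF continuous_on_id mackey_Ck_continuous_on[OF 0(2), of n]]]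
    by auto
  then show ?case using mackey_bounded_operator[OF S cont hom mackey_Ck_imp_bounded[OF 0(2)]] by simp
next
  case (Suc j)
  obtain \<gamma>' where \<gamma>': "\<And>n t. t \<in> S \<Longrightarrow> has_curve_deriv (\<gamma> n) (\<gamma>' n t) t S" "mackey_Ck j S r \<gamma>'"
    using Suc.prems(2) by auto
  have "mackey_Ck j S (\<lambda>n. 1 * r n) (\<lambda>n t. b (\<phi> t) (\<gamma> n t))"
    by (rule mackey_Ck_bilinear[OF b Suc.prems[THEN mackey_Ck_SucD]])
  then have "mackey_Ck j S r (\<lambda>n t. \<gamma>' n t + b (\<phi> t) (\<gamma> n t))"
    by (intro mackey_Ck_add[OF \<gamma>'(2)]) simp
  then have "mackey_Ck j S r (\<lambda>n t. A t (\<gamma>' n t + b (\<phi> t) (\<gamma> n t)))"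
    by (rule Suc.IH[OF mackey_Ck_SucD[OF Suc.prems(1)]])
  moreover have "has_curve_deriv (\<lambda>t. A t (\<gamma> n t)) (A t (\<gamma>' n t + b (\<phi> t) (\<gamma> n t))) t S" if "t \<in> S" for n t
    by (rule has_curve_deriv_operator[OF cont that add hom A'[OF that] \<gamma>'(1)[OF that]])
  ultimately show ?case
    unfolding mackey_Ck.simps
    using mackey_bounded_operator[OF S cont hom mackey_Ck_imp_bounded[OF Suc.prems(2)]]
    by (intro conjI exI[of _ "\<lambda>n t. A t (\<gamma>' n t + b (\<phi> t) (\<gamma> n t))"]) simp_all
qed

section \<open>Sequences of Lipschitz curves\<close>

text \<open>One constant per seminorm serves for both the supremum and the Lipschitz bound, matching
  the maximum in \<open>curve_seminorm\<close> for \<open>Lip\<close>.\<close>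

definition mackey_Lip :: "real set \<Rightarrow> (nat \<Rightarrow> real) \<Rightarrow> (nat \<Rightarrow> real \<Rightarrow> 'e::locally_convex_space) \<Rightarrow> bool" where
  "mackey_Lip S r \<gamma> \<longleftrightarrow> (\<forall>p. continuous_seminorm p \<longrightarrow> (\<exists>C\<ge>0. \<forall>n.
     (\<forall>t\<in>S. p (\<gamma> n t) \<le> C * r n) \<and> (\<forall>s\<in>S. \<forall>t\<in>S. p (\<gamma> n s - \<gamma> n t) \<le> C * r n * \<bar>s - t\<bar>)))"

lemma mackey_LipI:
  assumes "\<And>p. continuous_seminorm p \<Longrightarrow> \<exists>C\<ge>0. \<forall>n. (\<forall>t\<in>S. p (\<gamma> n t) \<le> C * r n) \<and>
    (\<forall>s\<in>S. \<forall>t\<in>S. p (\<gamma> n s - \<gamma> n t) \<le> C * r n * \<bar>s - t\<bar>)"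
  shows "mackey_Lip S r \<gamma>"
  using assms by (simp add: mackey_Lip_def)

lemma mackey_LipE:
  assumes "mackey_Lip S r \<gamma>" "continuous_seminorm p"
  obtains C where "C \<ge> 0" "\<And>n t. t \<in> S \<Longrightarrow> p (\<gamma> n t) \<le> C * r n"
    "\<And>n s t. s \<in> S \<Longrightarrow> t \<in> S \<Longrightarrow> p (\<gamma> n s - \<gamma> n t) \<le> C * r n * \<bar>s - t\<bar>"
proof -
  have "\<exists>C\<ge>0. \<forall>n. (\<forall>t\<in>S. p (\<gamma> n t) \<le> C * r n) \<and>
      (\<forall>s\<in>S. \<forall>t\<in>S. p (\<gamma> n s - \<gamma> n t) \<le> C * r n * \<bar>s - t\<bar>)"
    using assms by (simp add: mackey_Lip_def)
  then show ?thesis using that by blast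
qed

lemma mackey_Lip_scale:
  assumes "mackey_Lip S r \<gamma>"
  shows "mackey_Lip S (\<lambda>n. \<bar>c n\<bar> * r n) (\<lambda>n t. c n *\<^sub>R \<gamma> n t)"
proof (rule mackey_LipI)
  fix p :: "'a \<Rightarrow> real" assume p: "continuous_seminorm p"
  obtain C where C: "C \<ge> 0" "\<And>n t. t \<in> S \<Longrightarrow> p (\<gamma> n t) \<le> C * r n"
    "\<And>n s t. s \<in> S \<Longrightarrow> t \<in> S \<Longrightarrow> p (\<gamma> n s - \<gamma> n t) \<le> C * r n * \<bar>s - t\<bar>"
    by (rule mackey_LipE[OF assms p], rule that)
  have "p (c n *\<^sub>R \<gamma> n t) \<le> C * (\<bar>c n\<bar> * r n)" if "t \<in> S" for n t
    using mult_left_mono[OF C(2)[OF that], of "\<bar>c n\<bar>"] by (simp add: seminorm_scaleR[OF p] ac_simps)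
  moreover have "p (c n *\<^sub>R \<gamma> n s - c n *\<^sub>R \<gamma> n t) \<le> C * (\<bar>c n\<bar> * r n) * \<bar>s - t\<bar>" if "s \<in> S" "t \<in> S" for n s t
    using mult_left_mono[OF C(3)[OF that], of "\<bar>c n\<bar>"]
    by (simp add: scaleR_diff_right[symmetric] seminorm_scaleR[OF p] ac_simps del: scaleR_diff_right)
  ultimately show "\<exists>C\<ge>0. \<forall>n. (\<forall>t\<in>S. p (c n *\<^sub>R \<gamma> n t) \<le> C * (\<bar>c n\<bar> * r n)) \<and>
      (\<forall>s\<in>S. \<forall>t\<in>S. p (c n *\<^sub>R \<gamma> n s - c n *\<^sub>R \<gamma> n t) \<le> C * (\<bar>c n\<bar> * r n) * \<bar>s - t\<bar>)"
    using C(1) by (intro exI[of _ C]) simp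
qed

text \<open>The splitting is that of the product rule: one part inherits the Lipschitz bound of
  \<open>\<gamma>\<close>, the other varies only the operator. The seminorm \<open>q\<close>
  dominates all \<open>A t\<close> at once by compactness.\<close>

lemma mackey_Lip_operator:
  fixes A :: "real \<Rightarrow> 'e::locally_convex_space \<Rightarrow> 'f::locally_convex_space"
  assumes cont: "continuous_on ({c..d} \<times> UNIV) (\<lambda>(t, x). A t x)"
    and add: "\<And>t x y. t \<in> {c..d} \<Longrightarrow> A t (x + y) = A t x + A t y"
    and hom: "\<And>t a x. t \<in> {c..d} \<Longrightarrow> A t (a *\<^sub>R x) = a *\<^sub>R A t x"
    and b: "continuous_bilinear b"
    and A': "\<And>t x. t \<in> {c..d} \<Longrightarrow> has_curve_deriv (\<lambda>s. A s x) (A t (b (\<phi> t) x)) t {c..d}"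
    and \<phi>: "mackey_bounded {c..d} (\<lambda>_. 1) (\<lambda>_. \<phi>)"
    and \<gamma>: "mackey_Lip {c..d} r \<gamma>" and r: "\<And>n. 0 \<le> r n"
  shows "mackey_Lip {c..d} r (\<lambda>n t. A t (\<gamma> n t))"
proof (rule mackey_LipI)
  fix p :: "'f \<Rightarrow> real" assume p: "continuous_seminorm p"
  obtain q where q: "continuous_seminorm q" "\<And>t x. t \<in> {c..d} \<Longrightarrow> p (A t x) \<le> q x"
    using compact_family_bounded[OF p compact_Icc cont hom] by blast
  obtain q1 q2 where q12: "continuous_seminorm q1" "continuous_seminorm q2" "\<And>x y. q (b x y) \<le> q1 x * q2 y"
    using bilinear_bounded[OF b q(1)] by blast
  obtain M where M: "M \<ge> 0" "\<And>t. t \<in> {c..d} \<Longrightarrow> q1 (\<phi> t) \<le> M"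
    using \<phi> q12(1) unfolding mackey_bounded_def by auto
  obtain C where C: "C \<ge> 0" "\<And>n t. t \<in> {c..d} \<Longrightarrow> q (\<gamma> n t) \<le> C * r n"
    "\<And>n s t. s \<in> {c..d} \<Longrightarrow> t \<in> {c..d} \<Longrightarrow> q (\<gamma> n s - \<gamma> n t) \<le> C * r n * \<bar>s - t\<bar>"
    by (rule mackey_LipE[OF \<gamma> q(1)], rule that)
  obtain D where D: "D \<ge> 0" "\<And>n t. t \<in> {c..d} \<Longrightarrow> q2 (\<gamma> n t) \<le> D * r n"
    by (rule mackey_LipE[OF \<gamma> q12(2)], rule that)
  have diff: "A t (x - y) = A t x - A t y" if "t \<in> {c..d}" for t x y
    using add[OF that, of "x - y" y] by simp
  have ordered: "p (A t (\<gamma> n t) - A s (\<gamma> n s)) \<le> (C + M * D) * r n * \<bar>t - s\<bar>"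
    if st: "s \<in> {c..d}" "t \<in> {c..d}" "s \<le> t" for s t n
  proof -
    \<comment> \<open>With the vector frozen at \<open>\<gamma> n s\<close>, the operator curve is
      differentiable, so a bound on \<open>\<phi>\<close> is enough for the mean value
      estimate.\<close>
    have 1: "p (A t (\<gamma> n s) - A s (\<gamma> n s)) \<le> (M * (D * r n)) * (t - s)"
    proof (rule curve_mean_value[OF p st(3), of "\<lambda>u. A u (\<gamma> n s)" "\<lambda>u. A u (b (\<phi> u) (\<gamma> n s))"])
      fix u assume "u \<in> {s..t}"
      then have u: "u \<in> {c..d}" using st by auto
      show "has_curve_deriv (\<lambda>u. A u (\<gamma> n s)) (A u (b (\<phi> u) (\<gamma> n s))) u {s..t}"
        using A'[OF u, of "\<gamma> n s"] by (rule has_curve_deriv_mono) (use st in auto)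
      have "p (A u (b (\<phi> u) (\<gamma> n s))) \<le> q1 (\<phi> u) * q2 (\<gamma> n s)" by (rule order_trans[OF q(2)[OF u] q12(3)])
      also have "\<dots> \<le> M * (D * r n)"
        by (rule mult_mono[OF M(2)[OF u] D(2)[OF st(1)] M(1) seminorm_nonneg[OF q12(2)]])
      finally show "p (A u (b (\<phi> u) (\<gamma> n s))) \<le> M * (D * r n)" .
    qed
    have 2: "p (A t (\<gamma> n t - \<gamma> n s)) \<le> C * r n * (t - s)"
      using order_trans[OF q(2)[OF st(2)] C(3)[OF st(2,1)]] st(3) by simp
    have "A t (\<gamma> n t) - A s (\<gamma> n s) = A t (\<gamma> n t - \<gamma> n s) + (A t (\<gamma> n s) - A s (\<gamma> n s))"
      by (simp add: diff[OF st(2)])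
    then have "p (A t (\<gamma> n t) - A s (\<gamma> n s)) \<le> C * r n * (t - s) + (M * (D * r n)) * (t - s)"
      by (simp only: order_trans[OF seminorm_triangle[OF p] add_mono[OF 2 1]])
    then show ?thesis using st(3) by (simp add: distrib_right mult.assoc)
  qed
  have "p (A s (\<gamma> n s) - A t (\<gamma> n t)) \<le> (C + M * D) * r n * \<bar>s - t\<bar>" if "s \<in> {c..d}" "t \<in> {c..d}" for s t n
  proof (cases "s \<le> t")
    case True
    then show ?thesis using ordered[OF that True, of n]
      by (simp only: seminorm_minus_commute[OF p, of "A s (\<gamma> n s)" "A t (\<gamma> n t)"] abs_minus_commute[of s t])
  next
    case False
    then show ?thesis using ordered[OF that(2,1)] by simp
  qed
  moreover have "p (A t (\<gamma> n t)) \<le> (C + M * D) * r n" if "t \<in> {c..d}" for t n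
  proof -
    have "p (A t (\<gamma> n t)) \<le> C * r n" by (rule order_trans[OF q(2)[OF that] C(2)[OF that]])
    also have "\<dots> \<le> (C + M * D) * r n" using M(1) D(1) r by (intro mult_right_mono) auto
    finally show ?thesis .
  qed
  ultimately show "\<exists>C\<ge>0. \<forall>n. (\<forall>t\<in>{c..d}. p (A t (\<gamma> n t)) \<le> C * r n) \<and>
      (\<forall>s\<in>{c..d}. \<forall>t\<in>{c..d}. p (A s (\<gamma> n s) - A t (\<gamma> n t)) \<le> C * r n * \<bar>s - t\<bar>)"
    using C(1) M(1) D(1) by (intro exI[of _ "C + M * D"]) simp
qed

lemma mackey_Lip_compose:
  fixes \<gamma> :: "nat \<Rightarrow> real \<Rightarrow> 'e::locally_convex_space"
  assumes \<gamma>: "mackey_Lip T r \<gamma>" and r: "\<And>n. 0 \<le> r n"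
    and \<sigma>: "\<And>t. \<sigma> t \<in> T" "\<And>s t. \<bar>\<sigma> s - \<sigma> t\<bar> \<le> K * \<bar>s - t\<bar>"
    and \<beta>: "\<And>t. \<bar>\<beta> t\<bar> \<le> K" "\<And>s t. \<bar>\<beta> s - \<beta> t\<bar> \<le> K * \<bar>s - t\<bar>"
  shows "mackey_Lip UNIV r (\<lambda>n t. \<beta> t *\<^sub>R \<gamma> n (\<sigma> t))"
proof (rule mackey_LipI)
  fix p :: "'e \<Rightarrow> real" assume p: "continuous_seminorm p"
  have K: "K \<ge> 0" using \<beta>(1)[of 0] by linarith
  obtain C where C: "C \<ge> 0" "\<And>n t. t \<in> T \<Longrightarrow> p (\<gamma> n t) \<le> C * r n"
    "\<And>n s t. s \<in> T \<Longrightarrow> t \<in> T \<Longrightarrow> p (\<gamma> n s - \<gamma> n t) \<le> C * r n * \<bar>s - t\<bar>"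
    by (rule mackey_LipE[OF \<gamma> p], rule that)
  have Cr: "0 \<le> C * r n" for n using C(1) r by simp
  \<comment> \<open>The first summand comes from varying \<open>\<beta>\<close>, the second from
    varying \<open>\<sigma>\<close> inside \<open>\<gamma>\<close>.\<close>
  let ?L = "K * C + K * (K * C)"
  have "p (\<beta> s *\<^sub>R \<gamma> n (\<sigma> s) - \<beta> t *\<^sub>R \<gamma> n (\<sigma> t)) \<le> ?L * r n * \<bar>s - t\<bar>" for n s t
  proof -
    have "\<beta> s *\<^sub>R \<gamma> n (\<sigma> s) - \<beta> t *\<^sub>R \<gamma> n (\<sigma> t)
        = \<beta> s *\<^sub>R (\<gamma> n (\<sigma> s) - \<gamma> n (\<sigma> t)) + (\<beta> s - \<beta> t) *\<^sub>R \<gamma> n (\<sigma> t)"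
      by (simp add: scaleR_diff_right scaleR_diff_left)
    then have "p (\<beta> s *\<^sub>R \<gamma> n (\<sigma> s) - \<beta> t *\<^sub>R \<gamma> n (\<sigma> t))
        \<le> \<bar>\<beta> s\<bar> * p (\<gamma> n (\<sigma> s) - \<gamma> n (\<sigma> t)) + \<bar>\<beta> s - \<beta> t\<bar> * p (\<gamma> n (\<sigma> t))"
      using seminorm_triangle[OF p, of "\<beta> s *\<^sub>R (\<gamma> n (\<sigma> s) - \<gamma> n (\<sigma> t))" "(\<beta> s - \<beta> t) *\<^sub>R \<gamma> n (\<sigma> t)"]
      by (simp only: seminorm_scaleR[OF p])
    also have "\<dots> \<le> K * (C * r n * (K * \<bar>s - t\<bar>)) + (K * \<bar>s - t\<bar>) * (C * r n)"
      by (intro add_mono mult_mono \<beta> C(2) \<sigma>(1) K seminorm_nonneg[OF p] mult_nonneg_nonneg abs_ge_zero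
          order_trans[OF C(3)[OF \<sigma>(1) \<sigma>(1)] mult_left_mono[OF \<sigma>(2) Cr]])
    finally show ?thesis by (simp add: algebra_simps)
  qed
  moreover have "p (\<beta> t *\<^sub>R \<gamma> n (\<sigma> t)) \<le> ?L * r n" for n t
  proof -
    have "p (\<beta> t *\<^sub>R \<gamma> n (\<sigma> t)) \<le> K * (C * r n)"
      unfolding seminorm_scaleR[OF p] by (rule mult_mono[OF \<beta>(1) C(2)[OF \<sigma>(1)] K seminorm_nonneg[OF p]])
    also have "\<dots> \<le> ?L * r n" using K C(1) r by (simp add: distrib_right)
    finally show ?thesis .
  qed
  ultimately show "\<exists>C\<ge>0. \<forall>n. (\<forall>t\<in>UNIV. p (\<beta> t *\<^sub>R \<gamma> n (\<sigma> t)) \<le> C * r n) \<and>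
      (\<forall>s\<in>UNIV. \<forall>t\<in>UNIV. p (\<beta> s *\<^sub>R \<gamma> n (\<sigma> s) - \<beta> t *\<^sub>R \<gamma> n (\<sigma> t)) \<le> C * r n * \<bar>s - t\<bar>)"
    using K C(1) by (intro exI[of _ ?L]) simp
qed

section \<open>A smooth step function\<close>

text \<open>The polynomial parameter makes this family closed under differentiation, so that all
  derivatives of \<open>exp (- (1 / x))\<close> are treated at once.\<close>

definition flat :: "real poly \<Rightarrow> real \<Rightarrow> real" where
  "flat q x = (if x > 0 then poly q (1 / x) * exp (- (1 / x)) else 0)"

text \<open>In the variable \<open>y = 1 / x\<close>, whose derivative is
  \<open>- y\<^sup>2\<close>, the function \<open>q(y) exp(- y)\<close> has the derivative
  \<open>y\<^sup>2 (q - q')(y) exp(- y)\<close>.\<close>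

definition flat_deriv :: "real poly \<Rightarrow> real poly" where
  "flat_deriv q = [:0, 0, 1:] * (q - pderiv q)"

text \<open>For each monomial, \<open>(y / i) ^ i\<close> is at most \<open>(1 + y / i) ^ i\<close>,
  which is at most \<open>exp y\<close>; summing over the coefficients bounds
  \<open>q(y) exp(- y)\<close> for \<open>y \<ge> 0\<close>.\<close>

lemma flat_bounded: "\<exists>K. \<forall>x. \<bar>flat q x\<bar> \<le> K"
proof -
  have pow: "y ^ i \<le> real i ^ i * exp y" if "y \<ge> 0" for y :: real and i
  proof (cases "i = 0")
    case False
    have "(y / real i) ^ i \<le> (1 + y / real i) ^ i"
      using that False by (intro power_mono) auto
    also have "\<dots> \<le> exp y" using that False by (intro exp_ge_one_plus_x_over_n_power_n) auto
    finally show ?thesis using False by (simp add: power_divide field_simps)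
  qed (use that in auto)
  define K where "K = (\<Sum>i\<le>degree q. \<bar>coeff q i\<bar> * real i ^ i)"
  have K0: "K \<ge> 0" by (simp add: K_def sum_nonneg)
  have "\<bar>poly q y\<bar> \<le> K * exp y" if "y \<ge> 0" for y
  proof -
    have "\<bar>poly q y\<bar> \<le> (\<Sum>i\<le>degree q. \<bar>coeff q i * y ^ i\<bar>)"
      unfolding poly_altdef by (rule sum_abs)
    also have "\<dots> \<le> (\<Sum>i\<le>degree q. \<bar>coeff q i\<bar> * (real i ^ i * exp y))"
      using that by (intro sum_mono) (auto simp: abs_mult intro!: mult_left_mono pow)
    finally show ?thesis by (simp add: K_def sum_distrib_right mult.assoc)
  qed
  then have "\<bar>flat q x\<bar> \<le> K" for x
    using K0 by (auto simp: flat_def abs_mult exp_minus field_simps)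
  then show ?thesis by blast
qed

lemma flat_has_deriv: "(flat q has_real_derivative flat (flat_deriv q) x) (at x)"
proof -
  consider "x > 0" | "x < 0" | "x = 0" by linarith
  then show ?thesis
  proof cases
    case 1
    have "((\<lambda>x. poly q (1 / x) * exp (- (1 / x))) has_real_derivative flat (flat_deriv q) x) (at x)"
    proof -
      have inv: "((\<lambda>x. 1 / x) has_real_derivative - (1 / x\<^sup>2)) (at x)"
        using 1 by (auto intro!: derivative_eq_intros simp: power2_eq_square)
      have "((\<lambda>x. exp (- (1 / x))) has_real_derivative exp (- (1 / x)) * - (- (1 / x\<^sup>2))) (at x)"
        by (rule DERIV_chain2[OF DERIV_exp DERIV_minus[OF inv]])
      from DERIV_mult[OF DERIV_chain2[OF poly_DERIV inv] this]
      have "((\<lambda>x. poly q (1 / x) * exp (- (1 / x))) has_real_derivative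
          poly (pderiv q) (1 / x) * - (1 / x\<^sup>2) * exp (- (1 / x))
          + exp (- (1 / x)) * - (- (1 / x\<^sup>2)) * poly q (1 / x)) (at x)" .
      moreover have "flat (flat_deriv q) x = (1 / x\<^sup>2 * (poly q (1 / x) - poly (pderiv q) (1 / x))) * exp (- (1 / x))"
        using 1 by (simp add: flat_def flat_deriv_def power2_eq_square)
      ultimately show ?thesis by (simp only:) (simp add: algebra_simps)
    qed
    then show ?thesis
      by (rule has_field_derivative_transform_within_open[of _ _ _ "{0<..}"]) (use 1 in \<open>auto simp: flat_def\<close>)
  next
    case 2
    have "((\<lambda>_. 0) has_real_derivative flat (flat_deriv q) x) (at x)"
      using 2 by (simp add: flat_def)
    then show ?thesis
      by (rule has_field_derivative_transform_within_open[of _ _ _ "{..<0}"]) (use 2 in \<open>auto simp: flat_def\<close>)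
  next
    case 3
    \<comment> \<open>The factor \<open>[:0, 0, 1:]\<close> stands for the square of
      \<open>1 / h\<close>, so \<open>flat q h / h\<close> is \<open>h\<close> times a bounded
      function and tends to 0.\<close>
    obtain K where K: "\<And>x. \<bar>flat ([:0, 0, 1:] * q) x\<bar> \<le> K" using flat_bounded by blast
    have "\<bar>flat q h / h\<bar> \<le> K * \<bar>h\<bar>" for h
    proof (cases "h > 0")
      case True
      have "flat ([:0, 0, 1:] * q) h = (1 / h * (1 / h)) * flat q h"
        using True by (simp add: flat_def)
      then have "flat q h / h = flat ([:0, 0, 1:] * q) h * h"
        using True by simp
      then have "\<bar>flat q h / h\<bar> = \<bar>flat ([:0, 0, 1:] * q) h\<bar> * \<bar>h\<bar>"
        by (simp only: abs_mult)
      then show ?thesis using mult_right_mono[OF K[of h] abs_ge_zero[of h]] by simp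
    next
      case False
      have "K \<ge> 0" using K[of 0] by linarith
      then have "0 \<le> K * \<bar>h\<bar>" by simp
      moreover have "flat q h = 0" using False by (simp add: flat_def)
      ultimately show ?thesis by simp
    qed
    then have ev: "eventually (\<lambda>h. norm (flat q h / h) \<le> K * \<bar>h\<bar>) (at 0)" by simp
    have "((\<lambda>h. K * \<bar>h\<bar>) \<longlongrightarrow> 0) (at 0)"
      by (rule tendsto_mult_right_zero[OF tendsto_rabs_zero[OF tendsto_ident_at]])
    from Lim_null_comparison[OF ev this]
    have "((\<lambda>h. flat q h / h) \<longlongrightarrow> 0) (at 0)" .
    moreover have "flat r 0 = 0" for r by (simp add: flat_def)
    ultimately show ?thesis using 3 by (simp add: DERIV_def)
  qed
qed

lemma mackey_bounded_real:
  fixes f :: "real \<Rightarrow> real"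
  assumes "\<And>x. \<bar>f x\<bar> \<le> K"
  shows "mackey_bounded S (\<lambda>_. 1) (\<lambda>_. f)"
proof (rule mackey_boundedI)
  fix p :: "real \<Rightarrow> real" assume p: "continuous_seminorm p"
  have "p (f t) \<le> (K * p 1) * 1" for t
    using seminorm_scaleR[OF p, of "f t" 1] mult_right_mono[OF assms seminorm_nonneg[OF p]] by simp
  moreover have "K \<ge> 0" using assms[of 0] by linarith
  ultimately show "\<exists>C\<ge>0. \<forall>n::nat. \<forall>t\<in>S. p (f t) \<le> C * 1"
    using seminorm_nonneg[OF p, of 1] by (intro exI[of _ "K * p 1"]) auto
qed

text \<open>The constant slope of \<open>s\<close> is absorbed into the polynomial by
  \<open>smult\<close>, so the derivative stays in the family and the induction closes.\<close>

lemma mackey_Ck_flat: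
  assumes "\<And>t. has_curve_deriv s c t UNIV"
  shows "mackey_Ck j UNIV (\<lambda>_. 1) (\<lambda>_ t. flat q (s t))"
proof (induction j arbitrary: q)
  case 0
  have "continuous_on UNIV (flat q)"
    using flat_has_deriv by (intro DERIV_continuous_on) auto
  then have "continuous_on UNIV (\<lambda>t. flat q (s t))"
    by (rule continuous_on_compose2[OF _ has_curve_deriv_continuous_on[OF assms]]) auto
  moreover obtain K where "\<And>x. \<bar>flat q x\<bar> \<le> K" using flat_bounded by blast
  ultimately show ?case by (auto intro: mackey_bounded_real)
next
  case (Suc j)
  obtain K where K: "\<And>x. \<bar>flat q x\<bar> \<le> K" using flat_bounded by blast
  have "has_curve_deriv (flat q) (flat (flat_deriv q) (s t)) (s t) UNIV" for t
    using flat_has_deriv by (simp add: has_curve_deriv_real)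
  then have "has_curve_deriv (\<lambda>t. flat q (s t)) (c *\<^sub>R flat (flat_deriv q) (s t)) t UNIV" for t
    by (rule has_curve_deriv_comp_real[OF _ assms]) simp
  moreover have "c *\<^sub>R flat (flat_deriv q) (s t) = flat (smult c (flat_deriv q)) (s t)" for t
    by (simp add: flat_def)
  ultimately have "has_curve_deriv (\<lambda>t. flat q (s t)) (flat (smult c (flat_deriv q)) (s t)) t UNIV" for t
    by simp
  then show ?case
    unfolding mackey_Ck.simps using Suc.IH mackey_bounded_real[of "\<lambda>t. flat q (s t)" K UNIV] K
    by (intro conjI exI[of _ "\<lambda>_ t. flat (smult c (flat_deriv q)) (s t)"]) simp_all
qed

lemma smooth_bump:
  obtains \<beta> :: "real \<Rightarrow> real" where "\<And>j. mackey_Ck j UNIV (\<lambda>_. 1) (\<lambda>_. \<beta>)"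
    "\<And>t. t \<le> 0 \<or> 1 \<le> t \<Longrightarrow> \<beta> t = 0" "\<And>t. 0 < t \<Longrightarrow> t < 1 \<Longrightarrow> 0 < \<beta> t"
proof -
  define \<beta> where "\<beta> t = flat 1 t *\<^sub>R flat 1 (1 - t)" for t
  have "has_curve_deriv (\<lambda>t. t) 1 t UNIV" "has_curve_deriv (\<lambda>t. 1 - t) (-1) t UNIV" for t
    unfolding has_curve_deriv_real by (auto intro!: derivative_eq_intros)
  from mackey_Ck_bilinear[OF continuous_bilinear_scaleR mackey_Ck_flat[OF this(1), of _ 1]
      mackey_Ck_flat[OF this(2), of _ 1]]
  have "mackey_Ck j UNIV (\<lambda>_. 1) (\<lambda>_. \<beta>)" for j
    by (simp add: \<beta>_def[abs_def])
  then show ?thesis by (rule that) (auto simp: \<beta>_def flat_def)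
qed

lemma has_curve_deriv_real_Lipschitz:
  fixes f :: "real \<Rightarrow> real"
  assumes "\<And>t. has_curve_deriv f (f' t) t UNIV" "\<And>t. \<bar>f' t\<bar> \<le> K"
  shows "\<bar>f s - f t\<bar> \<le> K * \<bar>s - t\<bar>"
proof -
  have "\<bar>f t - f s\<bar> \<le> K * (t - s)" if "s \<le> t" for s t
    using curve_mean_value[OF continuous_seminorm_abs that, of f f' K] assms
    by (auto intro: has_curve_deriv_mono)
  from this[of s t] this[of t s] show ?thesis
    by (cases "s \<le> t") (simp_all add: abs_minus_commute[of "f s" "f t"] abs_minus_commute[of s t])
qed

text \<open>The normalised antiderivative of a bump. Its derivative \<open>\<beta>\<close> vanishes
  with all derivatives at 0 and 1, which lets consecutive pieces fit together; the three bounds with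
  \<open>K\<close> serve the Lipschitz class.\<close>

lemma smooth_step:
  obtains \<sigma> \<beta> :: "real \<Rightarrow> real" and K where
    "\<And>t. has_curve_deriv \<sigma> (\<beta> t) t UNIV" "\<And>t. \<sigma> t \<in> {0..1}" "\<And>t. t \<le> 0 \<Longrightarrow> \<sigma> t = 0"
    "\<And>t. 1 \<le> t \<Longrightarrow> \<sigma> t = 1" "\<And>t. t \<le> 0 \<or> 1 \<le> t \<Longrightarrow> \<beta> t = 0"
    "\<And>j. mackey_Ck j UNIV (\<lambda>_. 1) (\<lambda>_. \<beta>)" "\<And>t. \<bar>\<beta> t\<bar> \<le> K"
    "\<And>s t. \<bar>\<sigma> s - \<sigma> t\<bar> \<le> K * \<bar>s - t\<bar>" "\<And>s t. \<bar>\<beta> s - \<beta> t\<bar> \<le> K * \<bar>s - t\<bar>"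
proof -
  obtain \<alpha> :: "real \<Rightarrow> real" where \<alpha>: "\<And>j. mackey_Ck j UNIV (\<lambda>_. 1) (\<lambda>_. \<alpha>)"
    "\<And>t. t \<le> 0 \<or> 1 \<le> t \<Longrightarrow> \<alpha> t = 0" "\<And>t. 0 < t \<Longrightarrow> t < 1 \<Longrightarrow> 0 < \<alpha> t"
    by (rule smooth_bump, rule that)
  have "continuous_on UNIV \<alpha>" using mackey_Ck_continuous_on[OF \<alpha>(1)] .
  \<comment> \<open>The interval exceeds \<open>{0..1}\<close> so that the antiderivative has
    two-sided derivatives at 0 and 1.\<close>
  then have "continuous_on {-1..2} \<alpha>" using continuous_on_subset by blast
  then obtain g where g: "\<And>x. x \<in> {-1..2} \<Longrightarrow> (g has_vector_derivative \<alpha> x) (at x within {-1..2})"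
    using antiderivative_continuous by blast
  have g': "(g has_real_derivative \<alpha> x) (at x)" if "-1 < x" "x < 2" for x
  proof -
    have "(g has_vector_derivative \<alpha> x) (at x within {-1<..<2})"
      using g[of x] that by (intro has_vector_derivative_within_subset[OF g]) auto
    then show ?thesis
      using that by (subst (asm) at_within_open) (auto simp: has_real_derivative_iff_has_vector_derivative)
  qed
  have const: "g y = g x" if "-1 < x" "x \<le> y" "y < 2" "\<And>z. z \<in> {x..y} \<Longrightarrow> \<alpha> z = 0" for x y
  proof (cases "x = y")
    case False
    then have "x < y" using that(2) by simp
    moreover have "(g has_real_derivative \<alpha> z) (at z)" if "x \<le> z" "z \<le> y" for z
      using \<open>-1 < x\<close> \<open>y < 2\<close> that by (intro g') auto
    ultimately obtain z where "z > x" "z < y" "g y - g x = (y - x) * \<alpha> z"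
      using MVT2[of x y g \<alpha>] by blast
    then show ?thesis using that(4)[of z] by auto
  qed simp
  define c where "c = g 1 - g 0"
  have "c > 0"
  proof -
    obtain z where "0 < z" "z < 1" "g 1 - g 0 = (1 - 0) * \<alpha> z"
      using MVT2[of 0 1 g \<alpha>] g' by force
    then show ?thesis using \<alpha>(3)[of z] by (simp add: c_def)
  qed
  have \<alpha>_nonneg: "\<alpha> t \<ge> 0" for t using \<alpha>(2,3)[of t] by (cases "t \<le> 0 \<or> 1 \<le> t") auto
  have mono: "g x \<le> g y" if "-1 < x" "x \<le> y" "y < 2" for x y
  proof (rule DERIV_nonneg_imp_nondecreasing[OF that(2)])
    fix z assume "x \<le> z" "z \<le> y"
    then show "\<exists>d. (g has_real_derivative d) (at z) \<and> 0 \<le> d"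
      using g'[of z] \<alpha>_nonneg[of z] that by (intro exI[of _ "\<alpha> z"]) auto
  qed
  define \<beta> where "\<beta> t = inverse c *\<^sub>R \<alpha> t" for t
  \<comment> \<open>The antiderivative \<open>g\<close> is controlled on \<open>{-1..2}\<close>
    only, so the step is continued by constants; \<open>const\<close> shows that both descriptions
    agree on the overlaps.\<close>
  define \<sigma> where "\<sigma> t = (if t < 0 then 0 else if t > 1 then 1 else (g t - g 0) / c)" for t
  have \<sigma>_g: "\<sigma> t = (g t - g 0) / c" if "-1 < t" "t < 2" for t
  proof -
    have "g t = g 0" if "t < 0" using \<open>-1 < t\<close> that \<alpha>(2) by (intro const[of t 0, symmetric]) auto
    moreover have "g t = g 1" if "t > 1" using \<open>t < 2\<close> that \<alpha>(2) by (intro const[of 1 t]) auto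
    ultimately show ?thesis using \<open>c > 0\<close> by (auto simp: \<sigma>_def c_def)
  qed
  have \<sigma>: "has_curve_deriv \<sigma> (\<beta> t) t UNIV" for t
  proof -
    consider "-1 < t" "t < 2" | "t < 0" | "t > 1" by linarith
    then have "(\<sigma> has_real_derivative \<beta> t) (at t)"
    proof cases
      case 1
      then have "((\<lambda>t. (g t - g 0) / c) has_real_derivative \<beta> t) (at t)"
        using g'[of t] \<open>c > 0\<close> by (auto intro!: derivative_eq_intros simp: \<beta>_def field_simps)
      then show ?thesis
        by (rule has_field_derivative_transform_within_open[of _ _ _ "{-1<..<2}"]) (use 1 \<sigma>_g in auto)
    next
      case 2
      then have "((\<lambda>t. 0) has_real_derivative \<beta> t) (at t)" using \<alpha>(2)[of t] by (simp add: \<beta>_def)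
      then show ?thesis
        by (rule has_field_derivative_transform_within_open[of _ _ _ "{..<0}"]) (use 2 in \<open>auto simp: \<sigma>_def\<close>)
    next
      case 3
      then have "((\<lambda>t. 1) has_real_derivative \<beta> t) (at t)" using \<alpha>(2)[of t] by (simp add: \<beta>_def)
      then show ?thesis
        by (rule has_field_derivative_transform_within_open[of _ _ _ "{1<..}"]) (use 3 in \<open>auto simp: \<sigma>_def\<close>)
    qed
    then show ?thesis by (simp add: has_curve_deriv_real)
  qed
  have \<beta>: "mackey_Ck j UNIV (\<lambda>_. 1) (\<lambda>_. \<beta>)" for j
  proof -
    have "mackey_Ck j UNIV (\<lambda>_. 1) (\<lambda>_ _. inverse c)"
      using mackey_Ck_const[of j UNIV "\<lambda>_. 1" "inverse c"] by simp
    from mackey_Ck_bilinear[OF continuous_bilinear_scaleR this \<alpha>(1)]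
    show ?thesis unfolding \<beta>_def by simp
  qed
  \<comment> \<open>Order one already supplies a bounded derivative of \<open>\<beta>\<close> and
    hence its Lipschitz constant.\<close>
  have "mackey_Ck (Suc 0) UNIV (\<lambda>_. 1) (\<lambda>_. \<beta>)" using \<beta> .
  then obtain \<beta>' where \<beta>': "\<And>n::nat. \<And>t. has_curve_deriv \<beta> (\<beta>' n t) t UNIV"
    "mackey_bounded UNIV (\<lambda>_. 1) \<beta>'"
    by auto
  obtain L where L: "\<And>t. \<bar>\<beta>' 0 t\<bar> \<le> L"
    using \<beta>'(2)[unfolded mackey_bounded_def, rule_format, OF continuous_seminorm_abs] by auto
  obtain M where M: "\<And>t. \<bar>\<beta> t\<bar> \<le> M"
    using mackey_Ck_imp_bounded[OF \<beta>[of 0], unfolded mackey_bounded_def, rule_format, OF continuous_seminorm_abs]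
    by auto
  define K where "K = max L M"
  have \<beta>K: "\<bar>\<beta> t\<bar> \<le> K" for t using M[of t] by (simp add: K_def)
  have "\<bar>\<beta>' 0 t\<bar> \<le> K" for t using L[of t] by (simp add: K_def)
  then have \<beta>_Lip: "\<bar>\<beta> s - \<beta> t\<bar> \<le> K * \<bar>s - t\<bar>" for s t
    by (rule has_curve_deriv_real_Lipschitz[OF \<beta>'(1)])
  have \<sigma>_Lip: "\<bar>\<sigma> s - \<sigma> t\<bar> \<le> K * \<bar>s - t\<bar>" for s t
    using has_curve_deriv_real_Lipschitz[OF \<sigma> \<beta>K] .
  have \<sigma>_01: "\<sigma> t \<in> {0..1}" for t
  proof -
    have "g 0 \<le> g t" "g t \<le> g 1" if "0 \<le> t" "t \<le> 1" using mono[of 0 t] mono[of t 1] that by auto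
    then show ?thesis using \<open>c > 0\<close> by (auto simp: \<sigma>_def c_def)
  qed
  show ?thesis
  proof (rule that[OF \<sigma> \<sigma>_01 _ _ _ \<beta> \<beta>K \<sigma>_Lip \<beta>_Lip])
    fix t :: real
    show "\<sigma> t = 0" if "t \<le> 0" using that by (auto simp: \<sigma>_def)
    show "\<sigma> t = 1" if "1 \<le> t" using that \<open>c > 0\<close> by (auto simp: \<sigma>_def c_def)
    show "\<beta> t = 0" if "t \<le> 0 \<or> 1 \<le> t" using \<alpha>(2)[OF that] by (simp add: \<beta>_def)
  qed
qed

section \<open>Curves of class Ck\<close>

primrec Ck_on :: "nat \<Rightarrow> real set \<Rightarrow> (real \<Rightarrow> 'e::locally_convex_space) \<Rightarrow> bool" where
  "Ck_on 0 S \<gamma> \<longleftrightarrow> continuous_on S \<gamma>"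
| "Ck_on (Suc j) S \<gamma> \<longleftrightarrow> (\<exists>\<gamma>'. (\<forall>t\<in>S. has_curve_deriv \<gamma> (\<gamma>' t) t S) \<and> Ck_on j S \<gamma>')"

lemma Ck_on_continuous_on: "Ck_on j S \<gamma> \<Longrightarrow> continuous_on S \<gamma>"
  by (cases j) (auto intro: has_curve_deriv_continuous_on)

lemma Ck_on_linear:
  fixes L :: "'e::locally_convex_space \<Rightarrow> 'f::locally_convex_space"
  assumes "\<And>x y. L (x + y) = L x + L y" "\<And>a x. L (a *\<^sub>R x) = a *\<^sub>R L x" "continuous_on UNIV L"
  shows "Ck_on j S \<gamma> \<Longrightarrow> Ck_on j S (\<lambda>t. L (\<gamma> t))"
proof (induction j arbitrary: \<gamma>)
  case 0
  then have "continuous_on S \<gamma>" by simp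
  then show ?case using continuous_on_compose2[OF assms(3)] by simp
next
  case (Suc j)
  then obtain \<gamma>' where \<gamma>': "\<And>t. t \<in> S \<Longrightarrow> has_curve_deriv \<gamma> (\<gamma>' t) t S" "Ck_on j S \<gamma>'"
    by auto
  have "has_curve_deriv (\<lambda>t. L (\<gamma> t)) (L (\<gamma>' t)) t S" if "t \<in> S" for t
    using C1_map_on_chain_curve[OF C1_map_on_linear[OF open_UNIV assms] \<gamma>'(1)[OF that]] by simp
  then show ?case
    using Suc.IH[OF \<gamma>'(2)] by (auto intro!: exI[of _ "\<lambda>t. L (\<gamma>' t)"])
qed

lemma Ck_on_chain:
  assumes "Ck_on j S \<gamma>"
  obtains D where "D 0 = \<gamma>" "\<And>i t. i < j \<Longrightarrow> t \<in> S \<Longrightarrow> has_curve_deriv (D i) (D (Suc i) t) t S"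
    "\<And>i. i \<le> j \<Longrightarrow> continuous_on S (D i)"
proof -
  have "\<exists>D. D 0 = \<gamma> \<and> (\<forall>i<j. \<forall>t\<in>S. has_curve_deriv (D i) (D (Suc i) t) t S) \<and> (\<forall>i\<le>j. continuous_on S (D i))"
    using assms
  proof (induction j arbitrary: \<gamma>)
    case 0
    then show ?case by (intro exI[of _ "\<lambda>_. \<gamma>"]) auto
  next
    case (Suc j)
    obtain \<gamma>' where \<gamma>': "\<And>t. t \<in> S \<Longrightarrow> has_curve_deriv \<gamma> (\<gamma>' t) t S" "Ck_on j S \<gamma>'"
      using Suc.prems by auto
    obtain D where D: "D 0 = \<gamma>'" "\<And>i t. i < j \<Longrightarrow> t \<in> S \<Longrightarrow> has_curve_deriv (D i) (D (Suc i) t) t S"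
      "\<And>i. i \<le> j \<Longrightarrow> continuous_on S (D i)"
      using Suc.IH[OF \<gamma>'(2)] by auto
    define D' where "D' i = (case i of 0 \<Rightarrow> \<gamma> | Suc i \<Rightarrow> D i)" for i
    have "has_curve_deriv (D' i) (D' (Suc i) t) t S" if "i < Suc j" "t \<in> S" for i t
      using that D(1,2) \<gamma>'(1) by (cases i) (auto simp: D'_def)
    moreover have "continuous_on S (D' i)" if "i \<le> Suc j" for i
      using that D(3) Ck_on_continuous_on[OF Suc.prems] by (cases i) (auto simp: D'_def)
    moreover have "D' 0 = \<gamma>" by (simp add: D'_def)
    ultimately show ?case by blast
  qed
  then show ?thesis using that by auto
qed

section \<open>Passage between derivatives of curves and the Bastiani classes\<close>

lemma has_curve_deriv_imp_dir_deriv: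
  assumes "has_curve_deriv f d t UNIV"
  shows "has_dir_deriv f t v (v *\<^sub>R d)"
proof -
  have "has_curve_deriv (\<lambda>s. t + s * v) v 0 UNIV"
    unfolding has_curve_deriv_real by (auto intro!: derivative_eq_intros)
  then have "has_curve_deriv (\<lambda>s. f (t + s * v)) (v *\<^sub>R d) 0 UNIV"
    using assms by (intro has_curve_deriv_comp_real[where T = UNIV and \<sigma> = "\<lambda>s. t + s * v"]) auto
  then show ?thesis by (simp add: has_dir_deriv_iff_curve_zero)
qed

text \<open>On the real line every direction is a scalar, so the \<open>i\<close>-th iterated
  directional derivative is the ordinary one times the product of the directions.\<close>

lemma Ck_on_imp_bastiani:
  fixes \<gamma> :: "real \<Rightarrow> 'e::locally_convex_space"
  assumes "Ck_on j UNIV \<gamma>" "open U"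
  shows "bastiani (enat j) U \<gamma>"
proof -
  obtain D where D: "D 0 = \<gamma>" "\<And>i t. i < j \<Longrightarrow> has_curve_deriv (D i) (D (Suc i) t) t UNIV"
    "\<And>i. i \<le> j \<Longrightarrow> continuous_on UNIV (D i)"
    using Ck_on_chain[OF assms(1)] by (metis UNIV_I)
  have step: "has_dir_deriv (\<lambda>t. (\<Prod>l<i. v l) *\<^sub>R D i t) t w (((\<Prod>l<i. v l) * w) *\<^sub>R D (Suc i) t)"
    if "i < j" for i and v :: "nat \<Rightarrow> real" and w t
  proof -
    have "has_curve_deriv (\<lambda>t. (\<Prod>l<i. v l) *\<^sub>R D i t) ((\<Prod>l<i. v l) *\<^sub>R D (Suc i) t) t UNIV"
      using has_curve_deriv_bilinear[OF continuous_bilinear_scaleR has_curve_deriv_const D(2)[OF that]]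
      by simp
    then show ?thesis using has_curve_deriv_imp_dir_deriv by (fastforce simp: mult.commute)
  qed
  have iter: "iter_deriv i \<gamma> t v = (\<Prod>l<i. v l) *\<^sub>R D i t" if "i \<le> j" for i t v
    using that
  proof (induction i arbitrary: t)
    case (Suc i)
    then have "(\<lambda>y. iter_deriv i \<gamma> y v) = (\<lambda>t. (\<Prod>l<i. v l) *\<^sub>R D i t)" by auto
    then show ?case using dir_deriv_eqI[OF step[of i v t "v i"]] Suc.prems by simp
  qed (simp add: D(1))
  have "\<exists>d. has_dir_deriv (\<lambda>y. iter_deriv i \<gamma> y v) t (v i) d" if "i < j" for i t v
  proof -
    have "(\<lambda>y. iter_deriv i \<gamma> y v) = (\<lambda>t. (\<Prod>l<i. v l) *\<^sub>R D i t)" using that iter by auto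
    then show ?thesis using step[OF that, of v t "v i"] by auto
  qed
  moreover have "continuous_on (U \<times> UNIV) (\<lambda>(x, v). iter_deriv i \<gamma> x v)" if "i \<le> j" for i
  proof -
    have "continuous_on (U \<times> UNIV) (\<lambda>z::real \<times> (nat \<Rightarrow> real). snd z l)" for l
      by (rule continuous_on_compose2[OF continuous_on_product_coordinates continuous_on_snd[OF continuous_on_id]]) simp
    moreover have "continuous_on (U \<times> UNIV) (\<lambda>z::real \<times> (nat \<Rightarrow> real). D i (fst z))"
      by (rule continuous_on_compose2[OF D(3)[OF that] continuous_on_fst[OF continuous_on_id]]) simp
    ultimately have "continuous_on (U \<times> UNIV) (\<lambda>z. (\<Prod>l<i. snd z l) *\<^sub>R D i (fst z))"
      by (intro continuous_on_scaleR_lcs continuous_on_prod)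
    then show ?thesis by (simp add: split_beta iter[OF that])
  qed
  ultimately show ?thesis using assms(2) by (simp add: bastiani_def Suc_le_eq)
qed

lemma Ck_curve_fin: "Ck_on j UNIV \<gamma> \<Longrightarrow> Ck_curve (enat j) \<gamma>"
  unfolding Ck_curve_def using Ck_on_imp_bastiani[of j \<gamma> "{-1<..<2}"]
  by (intro exI[of _ "-1"] exI[of _ 2] exI[of _ \<gamma>]) auto

text \<open>The curve itself serves as extension beyond \<open>{0..1}\<close> for every order, so
  there are no different extensions to reconcile.\<close>

lemma Ck_curve_infinity:
  assumes "\<And>j. Ck_on j UNIV \<gamma>"
  shows "Ck_curve \<infinity> \<gamma>"
proof -
  have b: "bastiani (enat j) {-1<..<2} \<gamma>" for j using Ck_on_imp_bastiani[OF assms] by simp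
  have "bastiani \<infinity> {-1<..<2} \<gamma>"
    unfolding bastiani_def
  proof (intro conjI allI impI)
    fix p
    show "\<forall>x\<in>{-1<..<2}. \<forall>v. \<exists>d. has_dir_deriv (\<lambda>y. iter_deriv p \<gamma> y v) x (v p) d"
      using b[of "Suc p"] unfolding bastiani_def by blast
    show "continuous_on ({-1<..<2} \<times> UNIV) (\<lambda>(x, v). iter_deriv p \<gamma> x v)"
      using b[of p] unfolding bastiani_def by blast
  qed simp
  then show ?thesis
    unfolding Ck_curve_def by (intro exI[of _ "-1"] exI[of _ 2] exI[of _ \<gamma>]) auto
qed

lemma Ck_curve_mono: "Ck_curve k \<gamma> \<Longrightarrow> l \<le> k \<Longrightarrow> Ck_curve l \<gamma>"
  unfolding Ck_curve_def bastiani_def by (meson order_trans)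

lemma Ck_curve_chain:
  assumes "Ck_curve (enat k) \<gamma>"
  obtains D where "D 0 = \<gamma>"
    "\<And>i t. i < k \<Longrightarrow> t \<in> {0..1} \<Longrightarrow> has_curve_deriv (D i) (D (Suc i) t) t {0..1}"
    "\<And>i. i \<le> k \<Longrightarrow> continuous_on {0..1} (D i)"
proof -
  obtain a b \<eta> where ab: "a < 0" "1 < b" and \<eta>: "bastiani (enat k) {a<..<b} \<eta>" "\<And>t. t \<in> {0..1} \<Longrightarrow> \<eta> t = \<gamma> t"
    using assms unfolding Ck_curve_def by blast
  define D where "D i t = iter_deriv i \<eta> t (\<lambda>_. 1)" for i t
  have deriv: "has_curve_deriv (D i) (D (Suc i) t) t {0..1}" if "i < k" "t \<in> {0..1}" for i t
  proof -
    have "t \<in> {a<..<b}" using that ab by auto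
    then have "\<exists>d. has_dir_deriv (\<lambda>y. iter_deriv i \<eta> y (\<lambda>_. 1)) t 1 d"
      using \<eta>(1) that(1) unfolding bastiani_def enat_ord_simps Suc_le_eq by blast
    then obtain d where d: "has_dir_deriv (D i) t 1 d" by (auto simp: D_def[abs_def])
    then have "d = D (Suc i) t" using dir_deriv_eqI by (fastforce simp: D_def[abs_def])
    then have "has_curve_deriv (D i) (D (Suc i) t) t UNIV"
      using d has_dir_deriv_iff_curve[of "D i" 0 t 1 d] by simp
    then show ?thesis by (rule has_curve_deriv_mono) simp
  qed
  have cont: "continuous_on {0..1} (D i)" if "i \<le> k" for i
  proof -
    have "continuous_on ({a<..<b} \<times> UNIV) (\<lambda>(x, v). iter_deriv i \<eta> x v)"
      using \<eta>(1) that unfolding bastiani_def enat_ord_simps by blast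
    moreover have "continuous_on {0..1} (\<lambda>t::real. (t, (\<lambda>_. 1) :: nat \<Rightarrow> real))"
      by (intro continuous_on_Pair continuous_on_id continuous_on_const)
    ultimately have "continuous_on {0..1} (\<lambda>t. case (t, \<lambda>_. 1) of (x, v) \<Rightarrow> iter_deriv i \<eta> x v)"
      by (rule continuous_on_compose2) (use ab in auto)
    then show ?thesis by (simp add: D_def[abs_def])
  qed
  \<comment> \<open>The extension \<open>\<eta>\<close> agrees with \<open>\<gamma>\<close> on
    \<open>{0..1}\<close> only; replacing the entry of index 0 gives an equality of functions
    there.\<close>
  define D' where "D' i = (if i = 0 then \<gamma> else D i)" for i
  have eq: "D i t = D' i t" if "t \<in> {0..1}" for i t
    using \<eta>(2)[OF that] by (simp add: D_def D'_def)
  show ?thesis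
  proof (rule that[of D'])
    show "D' 0 = \<gamma>" by (simp add: D'_def)
    show "has_curve_deriv (D' i) (D' (Suc i) t) t {0..1}" if "i < k" "t \<in> {0..1}" for i t
      using has_curve_deriv_cong[OF deriv[OF that] eq that(2)] by (simp add: D'_def)
    show "continuous_on {0..1} (D' i)" if "i \<le> k" for i
      using cont[OF that] by (rule continuous_on_eq) (rule eq)
  qed
qed

lemma at_within_unit_interval: "t \<in> {0..1::real} \<Longrightarrow> at t within {0..1} \<noteq> bot"
  using islimpt_Icc[of 0 1 t] trivial_limit_within[of t "{0..1}"] by auto

lemma curve_deriv_eqI: "has_curve_deriv \<gamma> D t {0..1} \<Longrightarrow> t \<in> {0..1} \<Longrightarrow> curve_deriv \<gamma> t = D"
  unfolding has_curve_deriv_def curve_deriv_def by (intro tendsto_Lim at_within_unit_interval)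

lemma funpow_curve_deriv_chain:
  assumes "\<And>t. t \<in> {0..1} \<Longrightarrow> D 0 t = \<gamma> t"
    and "\<And>i t. i < k \<Longrightarrow> t \<in> {0..1} \<Longrightarrow> has_curve_deriv (D i) (D (Suc i) t) t {0..1}"
  shows "i \<le> k \<Longrightarrow> t \<in> {0..1} \<Longrightarrow> (curve_deriv ^^ i) \<gamma> t = D i t"
proof (induction i arbitrary: t)
  case (Suc i)
  have "has_curve_deriv ((curve_deriv ^^ i) \<gamma>) (D (Suc i) t) t {0..1}"
    using Suc by (intro has_curve_deriv_cong[OF assms(2)]) auto
  then show ?case using Suc.prems(2) by (simp add: curve_deriv_eqI)
qed (use assms(1) in simp)

section \<open>Concatenation of curves on shrinking intervals\<close>

text \<open>The curve \<open>P i\<close>, supported in the unit interval, is placed on the interval from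
  \<open>2 powr (- (i + 1))\<close> to \<open>2 powr (- i)\<close>.\<close>

definition glue :: "(nat \<Rightarrow> real \<Rightarrow> 'e::locally_convex_space) \<Rightarrow> real \<Rightarrow> 'e" where
  "glue P t = (\<Sum>i | 1 < 2 ^ Suc i * t \<and> 2 ^ Suc i * t < 2. P i (2 ^ Suc i * t - 1))"

definition unit_supported :: "(nat \<Rightarrow> real \<Rightarrow> 'e::locally_convex_space) \<Rightarrow> bool" where
  "unit_supported P \<longleftrightarrow> (\<forall>i u. u \<le> 0 \<or> 1 \<le> u \<longrightarrow> P i u = 0)"

text \<open>The power \<open>m\<close> accounts for \<open>m\<close> derivatives of a curve squeezed
  into an interval of length \<open>inverse (2 ^ Suc i)\<close>.\<close>

definition rapidly_decreasing :: "(nat \<Rightarrow> real) \<Rightarrow> bool" where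
  "rapidly_decreasing r \<longleftrightarrow> (\<forall>i. 0 \<le> r i) \<and> (\<forall>m. (\<lambda>i. (2 ^ Suc i) ^ m * r i) \<longlonglongrightarrow> 0)"

lemma rapidly_decreasing_scale:
  assumes "rapidly_decreasing r"
  shows "rapidly_decreasing (\<lambda>i. \<bar>2 ^ Suc i\<bar> * r i)"
  unfolding rapidly_decreasing_def
proof (intro conjI allI)
  fix m
  have "(\<lambda>i. (2 ^ Suc i) ^ Suc m * r i) \<longlonglongrightarrow> 0"
    using assms unfolding rapidly_decreasing_def by blast
  then show "(\<lambda>i. (2 ^ Suc i) ^ m * (\<bar>2 ^ Suc i\<bar> * r i)) \<longlonglongrightarrow> 0"
    by (simp add: ac_simps)
qed (use assms in \<open>auto simp: rapidly_decreasing_def\<close>)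

lemma ex_rapidly_decreasing:
  obtains r where "rapidly_decreasing r" "\<And>i. 0 < r i"
proof -
  \<comment> \<open>The exponent \<open>i\<close> eventually exceeds each fixed \<open>m\<close>;
    from \<open>i = Suc m\<close> on, the product is at most
    \<open>inverse (2 ^ Suc i)\<close>.\<close>
  define r :: "nat \<Rightarrow> real" where "r i = inverse ((2 ^ Suc i) ^ i)" for i
  have "(\<lambda>i. (2 ^ Suc i) ^ m * r i) \<longlonglongrightarrow> 0" for m
  proof (rule tendsto_sandwich[OF _ _ tendsto_const])
    show "eventually (\<lambda>i. (2 ^ Suc i) ^ m * r i \<le> inverse (2 ^ Suc i)) sequentially"
      using eventually_ge_at_top[of "Suc m"]
    proof eventually_elim
      case (elim i)
      have "(2 ^ Suc i) ^ m * (2::real) ^ Suc i = (2 ^ Suc i) ^ Suc m" by simp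
      also have "\<dots> \<le> (2 ^ Suc i) ^ i" by (intro power_increasing elim one_le_power) simp
      finally show ?case by (simp add: r_def field_simps)
    qed
    show "(\<lambda>i. inverse (2 ^ Suc i) :: real) \<longlonglongrightarrow> 0"
      using LIMSEQ_Suc[OF LIMSEQ_inverse_realpow_zero[of 2]] by simp
  qed (simp add: r_def)
  then show ?thesis by (intro that[of r]) (auto simp: rapidly_decreasing_def r_def)
qed

lemma dyadic_pos:
  assumes "1 \<le> 2 ^ n * (t :: real)"
  shows "0 < t"
proof (rule ccontr)
  assume "\<not> 0 < t"
  then have "2 ^ n * t \<le> 0" by (intro mult_nonneg_nonpos) auto
  then show False using assms by simp
qed

section \<open>Values of the glued curve\<close>

lemma glue_nonpos: "t \<le> 0 \<Longrightarrow> glue P t = 0"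
proof -
  assume t: "t \<le> 0"
  have "2 ^ Suc i * t \<le> 0" for i using t by (intro mult_nonneg_nonpos) auto
  then have "\<not> (1 < 2 ^ Suc i * t \<and> 2 ^ Suc i * t < 2)" for i
    using less_le_trans[of 1 "2 ^ Suc i * t" 0] by auto
  then have "{i. 1 < 2 ^ Suc i * t \<and> 2 ^ Suc i * t < 2} = {}" by blast
  then show ?thesis by (simp only: glue_def sum.empty)
qed

lemma glue_finite:
  assumes P: "unit_supported P" and t: "1 < 2 ^ N * t"
  shows "glue P t = (\<Sum>i<N. P i (2 ^ Suc i * t - 1))"
  unfolding glue_def
proof (rule sum.mono_neutral_left)
  have "t > 0" using dyadic_pos[OF less_imp_le[OF t]] .
  have "i < N" if "2 ^ Suc i * t < 2" for i
  proof (rule ccontr)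
    assume "\<not> i < N"
    then have "(2::real) ^ N \<le> 2 ^ i" by (intro power_increasing) auto
    then have "2 ^ N * t \<le> 2 ^ i * t" using \<open>t > 0\<close> by simp
    then show False using that t by simp
  qed
  then show "{i. 1 < 2 ^ Suc i * t \<and> 2 ^ Suc i * t < 2} \<subseteq> {..<N}" by auto
  show "\<forall>i\<in>{..<N} - {i. 1 < 2 ^ Suc i * t \<and> 2 ^ Suc i * t < 2}. P i (2 ^ Suc i * t - 1) = 0"
  proof
    fix i assume "i \<in> {..<N} - {i. 1 < 2 ^ Suc i * t \<and> 2 ^ Suc i * t < 2}"
    then have "2 ^ Suc i * t - 1 \<le> 0 \<or> 1 \<le> 2 ^ Suc i * t - 1" by auto
    then show "P i (2 ^ Suc i * t - 1) = 0" using P unfolding unit_supported_def by blast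
  qed
qed simp

text \<open>Raising the index by one at least doubles \<open>2 ^ Suc i * t\<close>, so two indices
  cannot both keep it between 1 and 2. One range is closed so that end points of the intervals are
  covered as well.\<close>

lemma glue_unique_index:
  assumes "1 \<le> 2 ^ Suc i * t" "2 ^ Suc i * t \<le> (2::real)" "1 < 2 ^ Suc j * t" "2 ^ Suc j * t < 2"
  shows "j = i"
proof (rule ccontr)
  assume "j \<noteq> i"
  have "t > 0" using dyadic_pos[OF assms(1)] .
  have le: "2 * (2 ^ Suc a * t) \<le> 2 ^ Suc b * t" if "a < b" for a b :: nat
  proof -
    have "(2::real) ^ Suc (Suc a) \<le> 2 ^ Suc b" using that by (intro power_increasing) auto
    then have "2 ^ Suc (Suc a) * t \<le> 2 ^ Suc b * t" using \<open>t > 0\<close> by (intro mult_right_mono) auto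
    then show ?thesis by simp
  qed
  show False using le[of i j] le[of j i] assms \<open>j \<noteq> i\<close> by (cases "i < j") linarith+
qed

lemma glue_eq:
  assumes P: "unit_supported P" and t: "1 \<le> 2 ^ Suc i * t" "2 ^ Suc i * t \<le> 2"
  shows "glue P t = P i (2 ^ Suc i * t - 1)"
proof -
  have "glue P t = (\<Sum>j\<in>{i}. P j (2 ^ Suc j * t - 1))"
    unfolding glue_def
  proof (rule sum.mono_neutral_left)
    show "{j. 1 < 2 ^ Suc j * t \<and> 2 ^ Suc j * t < 2} \<subseteq> {i}"
      using glue_unique_index[OF t] by blast
    have "2 ^ Suc i * t - 1 \<le> 0 \<or> 1 \<le> 2 ^ Suc i * t - 1"
      if "\<not> (1 < 2 ^ Suc i * t \<and> 2 ^ Suc i * t < 2)" using that by auto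
    then show "\<forall>j\<in>{i} - {j. 1 < 2 ^ Suc j * t \<and> 2 ^ Suc j * t < 2}. P j (2 ^ Suc j * t - 1) = 0"
      using P unfolding unit_supported_def by blast
  qed simp
  then show ?thesis by simp
qed

lemma glue_cases:
  assumes P: "unit_supported P"
  obtains "glue P t = 0" "\<And>i. P i (2 ^ Suc i * t - 1) = 0"
  | i where "glue P t = P i (2 ^ Suc i * t - 1)" "1 < 2 ^ Suc i * t" "2 ^ Suc i * t < 2"
    "\<And>j. j \<noteq> i \<Longrightarrow> P j (2 ^ Suc j * t - 1) = 0"
proof -
  have zero: "P j (2 ^ Suc j * t - 1) = 0" if "\<not> (1 < 2 ^ Suc j * t \<and> 2 ^ Suc j * t < 2)" for j
  proof -
    have "2 ^ Suc j * t - 1 \<le> 0 \<or> 1 \<le> 2 ^ Suc j * t - 1" using that by auto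
    then show ?thesis using P unfolding unit_supported_def by blast
  qed
  show ?thesis
  proof (cases "\<exists>i. 1 < 2 ^ Suc i * t \<and> 2 ^ Suc i * t < 2")
    case True
    then obtain i where i: "1 < 2 ^ Suc i * t" "2 ^ Suc i * t < 2" by blast
    show ?thesis
    proof (rule that(2)[OF _ i])
      show "glue P t = P i (2 ^ Suc i * t - 1)" using i by (intro glue_eq P) auto
      show "P j (2 ^ Suc j * t - 1) = 0" if "j \<noteq> i" for j
        using glue_unique_index[of i t j] i that by (intro zero) auto
    qed
  next
    case False
    then have "{i. 1 < 2 ^ Suc i * t \<and> 2 ^ Suc i * t < 2} = {}" by blast
    then have "glue P t = 0" by (simp only: glue_def sum.empty)
    then show ?thesis using False zero by (intro that(1)) blast+
  qed
qed

text \<open>At a point \<open>s\<close> of the \<open>i\<close>-th interval, dividing by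
  \<open>s\<close> costs at most the factor \<open>2 ^ Suc i\<close>, and \<open>i\<close> tends to
  infinity as \<open>s\<close> approaches 0 from the right. To the left of 0 the curve
  vanishes.\<close>

lemma glue_has_deriv_zero:
  fixes P :: "nat \<Rightarrow> real \<Rightarrow> 'e::locally_convex_space"
  assumes P: "unit_supported P" "mackey_bounded UNIV r P" and r: "rapidly_decreasing r"
  shows "has_curve_deriv (glue P) 0 0 UNIV"
  unfolding has_curve_deriv_def
proof (rule tendsto_seminormI)
  fix p :: "'e \<Rightarrow> real" and e :: real assume p: "continuous_seminorm p" and e: "e > 0"
  obtain C where C: "C \<ge> 0" "\<And>n t. t \<in> UNIV \<Longrightarrow> p (P n t) \<le> C * r n"
    by (rule mackey_boundedE[OF P(2) p], rule that)
  have "(\<lambda>i. (2 ^ Suc i) ^ 1 * r i) \<longlonglongrightarrow> 0" using r unfolding rapidly_decreasing_def by blast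
  then have "(\<lambda>i. C * ((2 ^ Suc i) ^ 1 * r i)) \<longlonglongrightarrow> 0" by (rule tendsto_mult_right_zero)
  then have "eventually (\<lambda>i. C * ((2 ^ Suc i) ^ 1 * r i) < e) sequentially"
    using e by (rule order_tendstoD)
  then obtain M where M: "\<And>i. i \<ge> M \<Longrightarrow> C * (2 ^ Suc i * r i) < e"
    unfolding eventually_sequentially by auto
  have "eventually (\<lambda>s. s \<in> {- (1 / 2 ^ M)<..<1 / 2 ^ M}) (at (0::real))"
    by (intro eventually_at_in_open') auto
  then show "eventually (\<lambda>s. p ((glue P s - glue P 0) /\<^sub>R (s - 0) - 0) < e) (at 0)"
  proof eventually_elim
    case (elim s)
    show ?case
    proof (cases rule: glue_cases[OF P(1), of s])
      case 1
      then show ?thesis using e by (simp add: glue_nonpos seminorm_zero[OF p])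
    next
      case (2 i)
      have s: "s > 0" using dyadic_pos[OF less_imp_le[OF 2(2)]] .
      have "s * 2 ^ M \<le> 1" using elim s by (simp add: field_simps)
      then have "s * 2 ^ M < s * 2 ^ Suc i" using 2(2) by (simp only: mult.commute)
      then have "(2::real) ^ M < 2 ^ Suc i" using s by (simp only: mult_less_cancel_left_pos)
      then have i: "M \<le> i" by (simp only: power_strict_increasing_iff less_Suc_eq_le numeral_less_iff)
      have "p ((glue P s - glue P 0) /\<^sub>R (s - 0) - 0) = inverse s * p (P i (2 ^ Suc i * s - 1))"
        using s by (simp add: 2(1) glue_nonpos seminorm_scaleR[OF p])
      also have "\<dots> \<le> 2 ^ Suc i * (C * r i)"
        using 2(2) s C(2) seminorm_nonneg[OF p]
        by (intro mult_mono) (auto simp: field_simps)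
      also have "\<dots> < e" using M[OF i] by (simp add: ac_simps)
      finally show ?thesis .
    qed
  qed
qed

lemma has_curve_deriv_sum:
  "(\<And>i. i < N \<Longrightarrow> has_curve_deriv (f i) (f' i) t S) \<Longrightarrow>
    has_curve_deriv (\<lambda>s. \<Sum>i<N. f i s) (\<Sum>i<(N::nat). f' i) t S"
  by (induction N) (auto intro: has_curve_deriv_const has_curve_deriv_add)

lemma has_curve_deriv_dilate:
  assumes "has_curve_deriv f D (c * t - 1) UNIV"
  shows "has_curve_deriv (\<lambda>s. f (c * s - 1)) (c *\<^sub>R D) t UNIV"
proof -
  have "has_curve_deriv (\<lambda>s. c * s - 1) c t UNIV"
    unfolding has_curve_deriv_real by (auto intro!: derivative_eq_intros)
  then show ?thesis
    using assms by (intro has_curve_deriv_comp_real[where T = UNIV and \<sigma> = "\<lambda>s. c * s - 1"]) auto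
qed

text \<open>The bound \<open>N\<close> depends on \<open>t\<close> alone and is chosen before
  \<open>P\<close>, so that a sequence of pieces and the sequence of their derivatives can share
  it.\<close>

lemma glue_locally_finite:
  assumes "t \<noteq> 0"
  shows "\<exists>N. \<forall>P :: nat \<Rightarrow> real \<Rightarrow> 'e::locally_convex_space. unit_supported P \<longrightarrow>
    eventually (\<lambda>s. glue P s = (\<Sum>i<N. P i (2 ^ Suc i * s - 1))) (nhds t)"
proof (cases "t < 0")
  case True
  have "eventually (\<lambda>s. glue P s = (\<Sum>i<0. P i (2 ^ Suc i * s - 1))) (nhds t)" for P :: "nat \<Rightarrow> real \<Rightarrow> 'e"
  proof (rule eventually_mono)
    show "eventually (\<lambda>s. s \<in> {..<0}) (nhds t)" using True by (intro eventually_nhds_in_open) auto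
  qed (simp add: glue_nonpos)
  then show ?thesis by blast
next
  case False
  then have t: "t > 0" using assms by simp
  obtain N where "1 / t < 2 ^ N" using real_arch_pow[of 2 "1 / t"] by auto
  then have N: "t > 1 / 2 ^ N" using t by (simp add: field_simps)
  have "eventually (\<lambda>s. glue P s = (\<Sum>i<N. P i (2 ^ Suc i * s - 1))) (nhds t)"
    if "unit_supported P" for P :: "nat \<Rightarrow> real \<Rightarrow> 'e"
  proof (rule eventually_mono)
    show "eventually (\<lambda>s. s \<in> {1 / 2 ^ N<..}) (nhds t)" using N by (intro eventually_nhds_in_open) auto
    show "glue P s = (\<Sum>i<N. P i (2 ^ Suc i * s - 1))" if "s \<in> {1 / 2 ^ N<..}" for s
      using that by (intro glue_finite \<open>unit_supported P\<close>) (auto simp: field_simps)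
  qed
  then show ?thesis by blast
qed

text \<open>From outside the open unit interval, end points included, the curve is constantly 0 on
  one side; the one-sided derivative there is 0 and equals the two-sided one.\<close>

lemma unit_supported_deriv:
  assumes "unit_supported P" "\<And>i u. has_curve_deriv (P i) (P' i u) u UNIV"
  shows "unit_supported P'"
  unfolding unit_supported_def
proof (intro allI impI)
  fix i :: nat and u :: real assume "u \<le> 0 \<or> 1 \<le> u"
  then show "P' i u = 0"
  proof
    assume u: "u \<le> 0"
    have "has_curve_deriv (P i) 0 u {..u}"
      by (rule has_curve_deriv_cong[OF has_curve_deriv_const[of 0]])
        (use u assms(1) in \<open>auto simp: unit_supported_def\<close>)
    moreover have "has_curve_deriv (P i) (P' i u) u {..u}"
      by (rule has_curve_deriv_mono[OF assms(2)]) simp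
    moreover have "at u within {..u} \<noteq> bot"
      using trivial_limit_at_left_real[of u] by (metis at_within_Iic_at_left)
    ultimately show ?thesis using has_curve_deriv_unique by metis
  next
    assume u: "1 \<le> u"
    have "has_curve_deriv (P i) 0 u {u..}"
      by (rule has_curve_deriv_cong[OF has_curve_deriv_const[of 0]])
        (use u assms(1) in \<open>auto simp: unit_supported_def\<close>)
    moreover have "has_curve_deriv (P i) (P' i u) u {u..}"
      by (rule has_curve_deriv_mono[OF assms(2)]) simp
    moreover have "at u within {u..} \<noteq> bot"
      using trivial_limit_at_right_real[of u] by (metis at_within_Ici_at_right)
    ultimately show ?thesis using has_curve_deriv_unique by metis
  qed
qed

text \<open>The derivative of a glued curve is glued from the pieces
  \<open>2 ^ Suc i *\<^sub>R P' i\<close>, whose rate is again rapidly decreasing. Induction on the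
  order therefore runs over all pieces and rates.\<close>

lemma glue_Ck_on:
  fixes P :: "nat \<Rightarrow> real \<Rightarrow> 'e::locally_convex_space"
  assumes "unit_supported P" "mackey_Ck j UNIV r P" "rapidly_decreasing r"
  shows "Ck_on j UNIV (glue P)"
  using assms
proof (induction j arbitrary: P r)
  case 0
  have "isCont (glue P) t" for t
  proof (cases "t = 0")
    case True
    then show ?thesis
      using has_curve_deriv_continuous[OF glue_has_deriv_zero[OF 0(1) mackey_Ck_imp_bounded[OF 0(2)] 0(3)]]
      by (simp add: isCont_def)
  next
    case False
    then obtain N where "\<forall>P :: nat \<Rightarrow> real \<Rightarrow> 'e. unit_supported P \<longrightarrow>
        eventually (\<lambda>s. glue P s = (\<Sum>i<N. P i (2 ^ Suc i * s - 1))) (nhds t)"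
      using glue_locally_finite[of t, where ?'e = 'e] by auto
    then have "eventually (\<lambda>s. glue P s = (\<Sum>i<N. P i (2 ^ Suc i * s - 1))) (nhds t)"
      using 0(1) by blast
    moreover have "isCont (\<lambda>s. \<Sum>i<N. P i (2 ^ Suc i * s - 1)) t"
    proof -
      have "continuous_on UNIV (\<lambda>s. P i (2 ^ Suc i * s - 1))" for i
        by (rule continuous_on_compose2[OF mackey_Ck_continuous_on[OF 0(2)]]) (auto intro!: continuous_intros)
      then have "continuous_on UNIV (\<lambda>s. \<Sum>i<N. P i (2 ^ Suc i * s - 1))"
        by (intro continuous_on_sum)
      then show ?thesis by (simp add: continuous_on_eq_continuous_at)
    qed
    ultimately show ?thesis by (simp only: isCont_cong)
  qed
  then show ?case by (simp add: continuous_at_imp_continuous_on)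
next
  case (Suc j)
  obtain P' where P': "\<And>i u. has_curve_deriv (P i) (P' i u) u UNIV" "mackey_Ck j UNIV r P'"
    using Suc.prems(2) by auto
  define Q where "Q i u = (2 ^ Suc i :: real) *\<^sub>R P' i u" for i u
  have Q: "unit_supported Q"
    using unit_supported_deriv[OF Suc.prems(1) P'(1)] by (simp add: Q_def unit_supported_def)
  have "mackey_Ck j UNIV (\<lambda>i. \<bar>2 ^ Suc i\<bar> * r i) Q"
    unfolding Q_def by (rule mackey_Ck_scale[OF P'(2)])
  then have "Ck_on j UNIV (glue Q)"
    by (rule Suc.IH[OF Q _ rapidly_decreasing_scale[OF Suc.prems(3)]])
  moreover have "has_curve_deriv (glue P) (glue Q t) t UNIV" for t
  proof (cases "t = 0")
    case True
    then show ?thesis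
      using glue_has_deriv_zero[OF Suc.prems(1) mackey_Ck_imp_bounded[OF Suc.prems(2)] Suc.prems(3)]
      by (simp add: glue_nonpos)
  next
    case False
    then obtain N where "\<forall>P :: nat \<Rightarrow> real \<Rightarrow> 'e. unit_supported P \<longrightarrow>
        eventually (\<lambda>s. glue P s = (\<Sum>i<N. P i (2 ^ Suc i * s - 1))) (nhds t)"
      using glue_locally_finite[of t, where ?'e = 'e] by auto
    then have N: "eventually (\<lambda>s. glue P s = (\<Sum>i<N. P i (2 ^ Suc i * s - 1))) (nhds t)"
      if "unit_supported P" for P :: "nat \<Rightarrow> real \<Rightarrow> 'e"
      using that by blast
    have "has_curve_deriv (\<lambda>s. \<Sum>i<N. P i (2 ^ Suc i * s - 1)) (\<Sum>i<N. Q i (2 ^ Suc i * t - 1)) t UNIV"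
      unfolding Q_def by (intro has_curve_deriv_sum has_curve_deriv_dilate P'(1))
    moreover have "glue Q t = (\<Sum>i<N. Q i (2 ^ Suc i * t - 1))"
      using eventually_nhds_x_imp_x[OF N[OF Q]] .
    ultimately have "has_curve_deriv (\<lambda>s. \<Sum>i<N. P i (2 ^ Suc i * s - 1)) (glue Q t) t UNIV" by simp
    moreover have "eventually (\<lambda>s. (\<Sum>i<N. P i (2 ^ Suc i * s - 1)) = glue P s) (at t)"
      using N[OF Suc.prems(1)] by (auto simp: eventually_at_filter elim: eventually_mono)
    moreover have "(\<Sum>i<N. P i (2 ^ Suc i * t - 1)) = glue P t"
      using eventually_nhds_x_imp_x[OF N[OF Suc.prems(1)]] by simp
    ultimately show ?thesis by (rule has_curve_deriv_transform_eventually)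
  qed
  ultimately show ?case by auto
qed

text \<open>The dilated pieces are Lipschitz on the whole line with one constant, because
  \<open>2 ^ Suc i * r i\<close> is bounded.\<close>

lemma glue_Lipschitz:
  fixes P :: "nat \<Rightarrow> real \<Rightarrow> 'e::locally_convex_space"
  assumes P: "unit_supported P" "mackey_Lip UNIV r P" and r: "rapidly_decreasing r"
    and p: "continuous_seminorm p"
  obtains K where "\<And>s t. p (glue P s - glue P t) \<le> K * \<bar>s - t\<bar>"
proof -
  define Q where "Q i t = P i (2 ^ Suc i * t - 1)" for i t
  obtain C where C: "C \<ge> 0" "\<And>n s t. p (P n s - P n t) \<le> C * r n * \<bar>s - t\<bar>"
    using mackey_LipE[OF P(2) p] by (metis UNIV_I)
  have "(\<lambda>i. (2 ^ Suc i) ^ 1 * r i) \<longlonglongrightarrow> 0" using r unfolding rapidly_decreasing_def by blast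
  then have "Bseq (\<lambda>i. (2 ^ Suc i) ^ 1 * r i)" by (rule convergent_imp_Bseq[OF convergentI])
  then obtain B where B: "B > 0" "\<And>i. norm ((2 ^ Suc i) ^ 1 * r i) \<le> B" unfolding Bseq_def by blast
  define K where "K = C * B"
  have K: "p (Q i s - Q i t) \<le> K * \<bar>s - t\<bar>" for i s t
  proof -
    have "\<bar>(2 ^ Suc i * s - 1) - (2 ^ Suc i * t - 1)\<bar> = 2 ^ Suc i * \<bar>s - t\<bar>"
      by (simp add: right_diff_distrib[symmetric] abs_mult)
    then have "p (Q i s - Q i t) \<le> C * r i * (2 ^ Suc i * \<bar>s - t\<bar>)"
      using C(2)[of i "2 ^ Suc i * s - 1" "2 ^ Suc i * t - 1"] unfolding Q_def by simp
    also have "\<dots> = (C * (2 ^ Suc i * r i)) * \<bar>s - t\<bar>" by (simp only: ac_simps)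
    also have "\<dots> \<le> K * \<bar>s - t\<bar>"
      using B(2)[of i] C(1) unfolding K_def by (intro mult_right_mono mult_left_mono) (auto simp: abs_le_iff)
    finally show ?thesis .
  qed
  have "K \<ge> 0" using C(1) B(1) by (simp add: K_def)
  have idx: "\<exists>i. glue P t = Q i t \<and> (\<forall>j. j \<noteq> i \<longrightarrow> Q j t = 0)" for t
    by (cases rule: glue_cases[OF P(1), of t]) (auto simp: Q_def)
  have "p (glue P s - glue P t) \<le> (2 * K) * \<bar>s - t\<bar>" for s t
  proof -
    obtain i j where i: "glue P s = Q i s" "\<And>l. l \<noteq> i \<Longrightarrow> Q l s = 0"
      and j: "glue P t = Q j t" "\<And>l. l \<noteq> j \<Longrightarrow> Q l t = 0"
      using idx[of s] idx[of t] by blast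
    have K0: "K * \<bar>s - t\<bar> \<ge> 0" using \<open>K \<ge> 0\<close> by simp
    show ?thesis
    proof (cases "i = j")
      case True
      then show ?thesis using K[of i s t] K0 by (simp add: i(1) j(1))
    next
      case False
      \<comment> \<open>Each of the two pieces vanishes at the other point, so the difference is a
        sum of increments of single pieces; this is the origin of the factor 2.\<close>
      then have "glue P s - glue P t = (Q i s - Q i t) + (Q j s - Q j t)"
        using i j by simp
      then have "p (glue P s - glue P t) \<le> p (Q i s - Q i t) + p (Q j s - Q j t)"
        by (simp only: seminorm_triangle[OF p])
      then show ?thesis using K[of i s t] K[of j s t] by simp
    qed
  qed
  then show ?thesis by (rule that)
qed

section \<open>Lie groups in a chart around the unit\<close>

lemma has_curve_deriv_Pair:
  assumes "has_curve_deriv \<gamma> D t S" "has_curve_deriv \<gamma>' D' t S"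
  shows "has_curve_deriv (\<lambda>s. (\<gamma> s, \<gamma>' s)) (D, D') t S"
  using tendsto_Pair[OF assms[unfolded has_curve_deriv_def]]
  by (simp add: has_curve_deriv_def scaleR_prod_def)

text \<open>Chart expressions are composed on whatever part of the domain makes sense; continuity
  keeps this preimage open.\<close>

lemma C2_map_on_compose_vimage:
  assumes f: "C2_map_on U f df" and g: "C2_map_on V g dg"
  shows "C2_map_on (U \<inter> f -` V) (\<lambda>x. g (f x)) (\<lambda>x v. dg (f x) (df x v))"
proof -
  have "open (U \<inter> f -` V)"
    using C1_map_onD(1,2)[OF C2_map_on_imp_C1[OF f]] C1_map_onD(1)[OF C2_map_on_imp_C1[OF g]]
    by (intro continuous_open_preimage)
  then have "C2_map_on (U \<inter> f -` V) f df" by (rule C2_map_on_subset[OF f]) auto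
  then show ?thesis by (rule C2_map_on_compose[OF _ g]) auto
qed

lemma C2_map_on_const: "open U \<Longrightarrow> C2_map_on U (\<lambda>_. c) (\<lambda>_ _. 0)"
  using C1_map_on_const[of U c] C1_map_on_const[of "U \<times> UNIV" 0]
  by (auto simp: C2_map_on_def open_Times)

lemma C2_map_on_id: "open U \<Longrightarrow> C2_map_on U (\<lambda>x. x) (\<lambda>_ v. v)"
  by (rule C2_map_on_linear) auto

text \<open>Serves to compute derivatives of chart expressions from group identities: along a line
  the expression becomes an explicit curve, and agreement is required only while the line stays in
  \<open>U\<close>.\<close>

lemma dir_deriv_eq_line:
  assumes f: "has_dir_deriv f x v d" and g: "has_curve_deriv g e 0 UNIV"
    and U: "open U" "x \<in> U" "\<And>h. x + h *\<^sub>R v \<in> U \<Longrightarrow> f (x + h *\<^sub>R v) = g h"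
  shows "d = e"
proof -
  have "((\<lambda>h. x + h *\<^sub>R v) \<longlongrightarrow> x + 0 *\<^sub>R v) (at (0::real))"
    by (intro tendsto_add tendsto_const tendsto_scaleR_lcs tendsto_ident_at)
  then have "eventually (\<lambda>h. x + h *\<^sub>R v \<in> U) (at (0::real))"
    using U(1,2) by (auto dest: topological_tendstoD)
  then have "eventually (\<lambda>h. f (x + h *\<^sub>R v) = g h) (at (0::real))"
    by eventually_elim (rule U(3))
  moreover have "f (x + 0 *\<^sub>R v) = g 0" using U(2) by (intro U(3)) simp
  ultimately have "has_curve_deriv g d 0 UNIV"
    using f unfolding has_dir_deriv_iff_curve_zero by (blast intro: has_curve_deriv_transform_eventually)
  then show ?thesis using g by (rule has_curve_deriv_unique) simp
qed

lemma has_curve_deriv_line: "has_curve_deriv (\<lambda>h. h *\<^sub>R v) v t S"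
proof -
  have "has_curve_deriv (\<lambda>h. h) 1 t S"
    unfolding has_curve_deriv_real by (auto intro!: derivative_eq_intros)
  from has_curve_deriv_bilinear[OF continuous_bilinear_scaleR this has_curve_deriv_const[of v]]
  show ?thesis by simp
qed

context charted_lie_group
begin

abbreviation X :: "'g \<Rightarrow> 'e" where "X \<equiv> cmap \<Xi>"
abbreviation Y :: "'e \<Rightarrow> 'g" where "Y \<equiv> cinv \<Xi>"
abbreviation W :: "'g set" where "W \<equiv> cdom \<Xi>"
abbreviation V :: "'e set" where "V \<equiv> X ` W"

lemma group_cancel: "inv x \<otimes> (x \<otimes> y) = y" "x \<otimes> (inv x \<otimes> y) = y"
  by (metis UNIV_I carrier_UNIV inv_closed l_inv l_one m_assoc)
    (metis UNIV_I carrier_UNIV inv_closed r_inv l_one m_assoc)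

lemma group_laws:
  "(x \<otimes> y) \<otimes> z = x \<otimes> (y \<otimes> z)" "\<one> \<otimes> x = x" "x \<otimes> \<one> = x" "inv x \<otimes> x = \<one>" "x \<otimes> inv x = \<one>"
  "inv (x \<otimes> y) = inv y \<otimes> inv x" "inv (inv x) = x" "inv \<one> = \<one>"
  by (simp_all add: carrier_UNIV m_assoc inv_mult_group)

lemmas group_simps = group_laws group_cancel

lemma atlas: "smooth_atlas A"
  using smooth_structure by (simp add: smooth_structure_def)

lemma Xi_in_atlas: "\<Xi> \<in> A" and one_in_W: "\<one> \<in> W"
  using chart_Xi by (auto simp: charts_at_def)

lemma atlas_chart: "c \<in> A \<Longrightarrow> topological_chart c"
  using atlas by (simp add: smooth_atlas_def)

lemma ex_chart: obtains c where "c \<in> A" "g \<in> cdom c"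
  using atlas unfolding smooth_atlas_def by blast

lemma chart_inverse:
  assumes "c \<in> A"
  shows "g \<in> cdom c \<Longrightarrow> cinv c (cmap c g) = g" "v \<in> cmap c ` cdom c \<Longrightarrow> cmap c (cinv c v) = v"
    "v \<in> cmap c ` cdom c \<Longrightarrow> cinv c v \<in> cdom c" "inj_on (cmap c) (cdom c)"
    "open (cdom c)" "open (cmap c ` cdom c)" "continuous_on (cdom c) (cmap c)"
    "continuous_on (cmap c ` cdom c) (cinv c)"
proof -
  have h: "homeomorphism (cdom c) (cmap c ` cdom c) (cmap c) (cinv c)"
    using atlas_chart[OF assms] by (simp add: topological_chart_def)
  show "g \<in> cdom c \<Longrightarrow> cinv c (cmap c g) = g" "v \<in> cmap c ` cdom c \<Longrightarrow> cmap c (cinv c v) = v"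
    "v \<in> cmap c ` cdom c \<Longrightarrow> cinv c v \<in> cdom c"
    "continuous_on (cdom c) (cmap c)" "continuous_on (cmap c ` cdom c) (cinv c)"
    using h by (auto simp: homeomorphism_def inv_into_into)
  show "inj_on (cmap c) (cdom c)"
    using h unfolding homeomorphism_def by (metis inj_on_inverseI)
  show "open (cdom c)" "open (cmap c ` cdom c)"
    using atlas_chart[OF assms] by (auto simp: topological_chart_def)
qed

lemmas Xi_inverse = chart_inverse[OF Xi_in_atlas]

lemma zero_in_V: "0 \<in> V"
  using one_in_W Xi_one by (metis imageI)

lemma Y_zero: "Y 0 = \<one>"
  using Xi_inverse(1)[OF one_in_W] by (simp add: Xi_one)

lemma tendsto_mult_group:
  assumes "(f \<longlongrightarrow> a) F" "(g \<longlongrightarrow> b) F"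
  shows "((\<lambda>x. f x \<otimes> g x) \<longlongrightarrow> a \<otimes> b) F"
proof -
  have "continuous_on UNIV (\<lambda>(x, y). x \<otimes> y)" using smooth_mult by (simp add: Ck_map_def)
  from continuous_on_tendsto_compose[OF this tendsto_Pair[OF assms]] show ?thesis by simp
qed

lemma tendsto_inv_group:
  assumes "(f \<longlongrightarrow> a) F"
  shows "((\<lambda>x. inv (f x)) \<longlongrightarrow> inv a) F"
proof -
  have "continuous_on UNIV (\<lambda>x. inv x)" using smooth_inv by (simp add: Ck_map_def)
  from continuous_on_tendsto_compose[OF this assms] show ?thesis by simp
qed

lemma tendsto_Xi:
  assumes "(f \<longlongrightarrow> g) F" "g \<in> W"
  shows "((\<lambda>x. X (f x)) \<longlongrightarrow> X g) F"
  using continuous_on_tendsto_compose[OF Xi_inverse(7) assms] topological_tendstoD[OF assms(1) Xi_inverse(5) assms(2)]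
  by simp

subsection \<open>Group operations in charts\<close>

text \<open>Smoothness of multiplication is stated in charts of the product atlas, whose inverse is
  an \<open>inv_into\<close> of \<open>map_prod\<close>. On the relevant set it is the pair of the
  two chart inverses.\<close>

lemma mult_in_charts:
  assumes c: "c \<in> A" "c' \<in> A" "d \<in> A"
  shows "\<exists>df. C2_map_on
    {z \<in> cmap c ` cdom c \<times> cmap c' ` cdom c'. cinv c (fst z) \<otimes> cinv c' (snd z) \<in> cdom d}
    (\<lambda>z. cmap d (cinv c (fst z) \<otimes> cinv c' (snd z))) df" (is "\<exists>df. C2_map_on ?S ?f df")
proof -
  define C where "C = (cdom c \<times> cdom c', map_prod (cmap c) (cmap c'))"
  have "C \<in> prod_atlas A A" unfolding prod_atlas_def C_def using c by blast
  then have bast: "bastiani \<infinity> (cmap C ` {x \<in> UNIV \<inter> cdom C. (\<lambda>(x, y). x \<otimes> y) x \<in> cdom d})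
      (cmap d \<circ> (\<lambda>(x, y). x \<otimes> y) \<circ> cinv C)"
    using smooth_mult c(3) unfolding Ck_map_def by blast
  have inj: "inj_on (cmap C) (cdom C)"
    using chart_inverse(4)[OF c(1)] chart_inverse(4)[OF c(2)] by (simp add: C_def map_prod_inj_on)
  have S: "cmap C ` {x \<in> UNIV \<inter> cdom C. (\<lambda>(x, y). x \<otimes> y) x \<in> cdom d} = ?S"
  proof (intro Set.set_eqI iffI)
    fix z assume "z \<in> cmap C ` {x \<in> UNIV \<inter> cdom C. (\<lambda>(x, y). x \<otimes> y) x \<in> cdom d}"
    then obtain g h where "z = (cmap c g, cmap c' h)" "g \<in> cdom c" "h \<in> cdom c'" "g \<otimes> h \<in> cdom d"
      by (auto simp: C_def)
    then show "z \<in> ?S" using chart_inverse(1)[OF c(1)] chart_inverse(1)[OF c(2)] by auto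
  next
    fix z assume z: "z \<in> ?S"
    then have "z = cmap C (cinv c (fst z), cinv c' (snd z))"
      using chart_inverse(2)[OF c(1)] chart_inverse(2)[OF c(2)] by (auto simp: C_def)
    moreover have "(cinv c (fst z), cinv c' (snd z)) \<in> {x \<in> UNIV \<inter> cdom C. (\<lambda>(x, y). x \<otimes> y) x \<in> cdom d}"
      using z chart_inverse(3)[OF c(1)] chart_inverse(3)[OF c(2)] by (auto simp: C_def)
    ultimately show "z \<in> cmap C ` {x \<in> UNIV \<inter> cdom C. (\<lambda>(x, y). x \<otimes> y) x \<in> cdom d}"
      by (rule image_eqI)
  qed
  have "(cmap d \<circ> (\<lambda>(x, y). x \<otimes> y) \<circ> cinv C) z = ?f z" if "z \<in> ?S" for z
  proof -
    have "cinv c (fst z) \<in> cdom c" "cinv c' (snd z) \<in> cdom c'"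
      using that chart_inverse(3)[OF c(1)] chart_inverse(3)[OF c(2)] by auto
    then have "(cinv c (fst z), cinv c' (snd z)) \<in> cdom C" by (simp add: C_def)
    moreover have "z = cmap C (cinv c (fst z), cinv c' (snd z))"
      using that chart_inverse(2)[OF c(1)] chart_inverse(2)[OF c(2)] by (auto simp: C_def)
    ultimately have "cinv C z = (cinv c (fst z), cinv c' (snd z))"
      using inv_into_f_f[OF inj] by metis
    then show ?thesis by simp
  qed
  note eq = this
  have "C2_map_on ?S (cmap d \<circ> (\<lambda>(x, y). x \<otimes> y) \<circ> cinv C) (dir_deriv (cmap d \<circ> (\<lambda>(x, y). x \<otimes> y) \<circ> cinv C))"
    by (rule bastiani_imp_C2[OF bast[unfolded S]]) simp
  from C2_map_on_cong[OF this, of "\<lambda>z. ?f z"] show ?thesis using eq by blast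
qed

lemma inv_in_chart:
  "\<exists>df. C2_map_on (X ` {g \<in> W. inv g \<in> W}) (\<lambda>x. X (inv (Y x))) df"
proof -
  have "bastiani \<infinity> (X ` {x \<in> UNIV \<inter> W. inv x \<in> W}) (X \<circ> (\<lambda>x. inv x) \<circ> Y)"
    using smooth_inv Xi_in_atlas unfolding Ck_map_def by blast
  from bastiani_imp_C2[OF this] show ?thesis by (auto simp: o_def)
qed

definition mult_dom :: "('e \<times> 'e) set" where
  "mult_dom = {z \<in> V \<times> V. Y (fst z) \<otimes> Y (snd z) \<in> W}"

lemma mult_in_Xi: "\<exists>df. C2_map_on mult_dom (\<lambda>z. X (Y (fst z) \<otimes> Y (snd z))) df"
  unfolding mult_dom_def by (rule mult_in_charts[OF Xi_in_atlas Xi_in_atlas Xi_in_atlas])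

lemma zero_mult_dom: "v \<in> V \<Longrightarrow> (0, v) \<in> mult_dom"
  using zero_in_V Xi_inverse(3) by (auto simp: mult_dom_def Y_zero group_simps)

text \<open>Composing the chart forms of inversion and multiplication inserts \<open>Y (X h)\<close>
  for an intermediate element \<open>h\<close>. Shrinking the domain keeps \<open>h\<close> in
  \<open>W\<close>, where this detour disappears.\<close>

lemma quotient_in_Xi:
  "\<exists>Q dq. (0, 0) \<in> Q \<and> C2_map_on Q (\<lambda>z. X (inv (Y (fst z)) \<otimes> Y (snd z))) dq \<and>
     (\<forall>z\<in>Q. fst z \<in> V \<and> snd z \<in> V \<and> inv (Y (fst z)) \<otimes> Y (snd z) \<in> W)"
proof -
  obtain dm where m: "C2_map_on mult_dom (\<lambda>z. X (Y (fst z) \<otimes> Y (snd z))) dm"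
    using mult_in_Xi by blast
  define I where "I = X ` {g \<in> W. inv g \<in> W}"
  obtain di where i: "C2_map_on I (\<lambda>x. X (inv (Y x))) di"
    using inv_in_chart unfolding I_def by blast
  have ID: "x \<in> V" "inv (Y x) \<in> W" if "x \<in> I" for x
    using that Xi_inverse(1) by (auto simp: I_def)
  have I0: "0 \<in> I" unfolding I_def by (rule image_eqI[of _ _ \<one>]) (auto simp: Xi_one one_in_W group_simps)
  have "C2_map_on (UNIV \<inter> fst -` I :: ('e \<times> 'e) set) (\<lambda>z. X (inv (Y (fst z)))) (\<lambda>z v. di (fst z) (fst v))"
    by (rule C2_map_on_compose_vimage[OF C2_map_on_fst i]) simp
  moreover have op: "open (UNIV \<inter> fst -` I :: ('e \<times> 'e) set)"
    using C1_map_onD(1)[OF C2_map_on_imp_C1[OF i]] by (auto intro!: open_vimage_fst)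
  ultimately have "C2_map_on (UNIV \<inter> fst -` I) (\<lambda>z :: 'e \<times> 'e. (X (inv (Y (fst z))), snd z)) (\<lambda>z v. (di (fst z) (fst v), snd v))"
    by (intro C2_map_on_Pair C2_map_on_snd)
  note compose = C2_map_on_compose_vimage[OF this m]
  define R where "R = (UNIV \<inter> fst -` I) \<inter> (\<lambda>z. (X (inv (Y (fst z))), snd z)) -` mult_dom"
  obtain d where C: "C2_map_on R (\<lambda>z. X (Y (X (inv (Y (fst z)))) \<otimes> Y (snd z))) d"
    using compose unfolding R_def[symmetric] by auto
  have RD: "fst z \<in> V" "snd z \<in> V" "Y (X (inv (Y (fst z)))) = inv (Y (fst z))"
    "inv (Y (fst z)) \<otimes> Y (snd z) \<in> W" if "z \<in> R" for z
  proof -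
    have fz: "fst z \<in> I" and md: "(X (inv (Y (fst z))), snd z) \<in> mult_dom" using that by (simp_all add: R_def)
    show "fst z \<in> V" by (rule ID(1)[OF fz])
    show *: "Y (X (inv (Y (fst z)))) = inv (Y (fst z))" by (rule Xi_inverse(1)[OF ID(2)[OF fz]])
    show "snd z \<in> V" "inv (Y (fst z)) \<otimes> Y (snd z) \<in> W" using md by (simp_all add: mult_dom_def *)
  qed
  have "(0, 0) \<in> R" using I0 zero_mult_dom[OF zero_in_V] by (simp add: R_def Y_zero group_simps Xi_one)
  moreover have "C2_map_on R (\<lambda>z. X (inv (Y (fst z)) \<otimes> Y (snd z))) d"
    by (rule C2_map_on_cong[OF C]) (simp only: RD(3))
  ultimately show ?thesis
    by (intro exI[of _ R] exI[of _ d] conjI ballI RD)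
qed

text \<open>Conjugation by \<open>inv (Y x)\<close> is the quotient map followed by right
  multiplication with \<open>Y x\<close>, so the two chart forms compose near the origin.\<close>

lemma conj_in_Xi:
  "\<exists>Q dk. (0, 0) \<in> Q \<and> C2_map_on Q (\<lambda>z. X (inv (Y (fst z)) \<otimes> Y (snd z) \<otimes> Y (fst z))) dk"
proof -
  obtain dm where m: "C2_map_on mult_dom (\<lambda>z. X (Y (fst z) \<otimes> Y (snd z))) dm"
    using mult_in_Xi by blast
  obtain Q dq where Q: "(0, 0) \<in> Q" "C2_map_on Q (\<lambda>z. X (inv (Y (fst z)) \<otimes> Y (snd z))) dq"
    "\<And>z. z \<in> Q \<Longrightarrow> inv (Y (fst z)) \<otimes> Y (snd z) \<in> W"
    using quotient_in_Xi by blast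
  have "open Q" by (rule C1_map_onD(1)[OF C2_map_on_imp_C1[OF Q(2)]])
  note compose = C2_map_on_compose_vimage[OF C2_map_on_Pair[OF Q(2) C2_map_on_fst[OF this]] m]
  define R where "R = Q \<inter> (\<lambda>z. (X (inv (Y (fst z)) \<otimes> Y (snd z)), fst z)) -` mult_dom"
  obtain d where C: "C2_map_on R (\<lambda>z. X (Y (X (inv (Y (fst z)) \<otimes> Y (snd z))) \<otimes> Y (fst z))) d"
    using compose unfolding R_def[symmetric] by auto
  have "(0, 0) \<in> R" using Q(1) zero_mult_dom[OF zero_in_V] by (simp add: R_def Y_zero group_simps Xi_one)
  moreover have "Y (X (inv (Y (fst z)) \<otimes> Y (snd z))) = inv (Y (fst z)) \<otimes> Y (snd z)" if "z \<in> R" for z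
    by (rule Xi_inverse(1), rule Q(3)) (use that in \<open>simp add: R_def\<close>)
  then have "C2_map_on R (\<lambda>z. X (inv (Y (fst z)) \<otimes> Y (snd z) \<otimes> Y (fst z))) d"
    by (intro C2_map_on_cong[OF C]) simp
  ultimately show ?thesis by blast
qed

subsection \<open>The adjoint action\<close>

text \<open>The adjoint action transported from the Lie algebra to the model space by the derivative
  of \<open>\<Xi>\<close> at the unit; conjugation fixes the unit, which has the coordinate
  0.\<close>

definition Ad :: "'g \<Rightarrow> 'e \<Rightarrow> 'e" where
  "Ad g v = dir_deriv (\<lambda>y. X (g \<otimes> Y y \<otimes> inv g)) 0 v"

definition conj_nbhd :: "'g \<Rightarrow> 'e set \<Rightarrow> ('e \<Rightarrow> 'e \<Rightarrow> 'e) \<Rightarrow> bool" where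
  "conj_nbhd g N d \<longleftrightarrow> 0 \<in> N \<and> C1_map_on N (\<lambda>y. X (g \<otimes> Y y \<otimes> inv g)) d \<and> (\<forall>v. d 0 v = Ad g v) \<and>
     (\<forall>y\<in>N. g \<otimes> Y y \<otimes> inv g \<in> W)"

lemma conj_nbhdD:
  assumes "conj_nbhd g N d"
  shows "0 \<in> N" "C1_map_on N (\<lambda>y. X (g \<otimes> Y y \<otimes> inv g)) d" "\<And>v. d 0 v = Ad g v"
    "\<And>y. y \<in> N \<Longrightarrow> g \<otimes> Y y \<otimes> inv g \<in> W"
  using assms by (simp_all add: conj_nbhd_def)

text \<open>The element \<open>g\<close> may be far from the unit, so conjugation is split into left
  multiplication by \<open>g\<close>, read in a chart around \<open>g\<close>, and right
  multiplication by \<open>inv g\<close>, which leads back to \<open>W\<close>.\<close>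

lemma ex_conj_nbhd: "\<exists>N d. conj_nbhd g N d"
proof -
  obtain c where c: "c \<in> A" "g \<in> cdom c" by (rule ex_chart)
  obtain c' where c': "c' \<in> A" "inv g \<in> cdom c'" by (rule ex_chart)
  define S where "S = {z \<in> cmap c ` cdom c \<times> V. cinv c (fst z) \<otimes> Y (snd z) \<in> cdom c}"
  define S' where "S' = {z \<in> cmap c ` cdom c \<times> cmap c' ` cdom c'. cinv c (fst z) \<otimes> cinv c' (snd z) \<in> W}"
  obtain df where f: "C2_map_on S (\<lambda>z. cmap c (cinv c (fst z) \<otimes> Y (snd z))) df"
    using mult_in_charts[OF c(1) Xi_in_atlas c(1)] unfolding S_def by blast
  obtain df' where f': "C2_map_on S' (\<lambda>z. X (cinv c (fst z) \<otimes> cinv c' (snd z))) df'"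
    using mult_in_charts[OF c(1) c'(1) Xi_in_atlas] unfolding S'_def by blast
  have inv: "cinv c (cmap c g) = g" "cinv c' (cmap c' (inv g)) = inv g"
    using chart_inverse(1)[OF c] chart_inverse(1)[OF c'] by auto
  have "C2_map_on (UNIV \<inter> (\<lambda>y. (cmap c g, y)) -` S)
      (\<lambda>y. cmap c (cinv c (fst (cmap c g, y)) \<otimes> Y (snd (cmap c g, y)))) (\<lambda>y v. df (cmap c g, y) (0, v))"
    by (rule C2_map_on_compose_vimage[OF C2_map_on_Pair[OF C2_map_on_const C2_map_on_id] f]) auto
  then have 1: "C2_map_on ((\<lambda>y. (cmap c g, y)) -` S) (\<lambda>y. cmap c (g \<otimes> Y y)) (\<lambda>y v. df (cmap c g, y) (0, v))"
    by (simp add: inv)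
  have "C2_map_on (UNIV \<inter> (\<lambda>y. (y, cmap c' (inv g))) -` S')
      (\<lambda>y. X (cinv c (fst (y, cmap c' (inv g))) \<otimes> cinv c' (snd (y, cmap c' (inv g)))))
      (\<lambda>y v. df' (y, cmap c' (inv g)) (v, 0))"
    by (rule C2_map_on_compose_vimage[OF C2_map_on_Pair[OF C2_map_on_id C2_map_on_const] f']) auto
  then have 2: "C2_map_on ((\<lambda>y. (y, cmap c' (inv g))) -` S') (\<lambda>y. X (cinv c y \<otimes> inv g))
      (\<lambda>y v. df' (y, cmap c' (inv g)) (v, 0))"
    by (simp add: inv)
  define N where "N = (\<lambda>y. (cmap c g, y)) -` S \<inter> (\<lambda>y. cmap c (g \<otimes> Y y)) -` (\<lambda>y. (y, cmap c' (inv g))) -` S'"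
  from C2_map_on_compose_vimage[OF 1 2]
  obtain d where C: "C2_map_on N (\<lambda>y. X (cinv c (cmap c (g \<otimes> Y y)) \<otimes> inv g)) d"
    unfolding N_def by auto
  have ND: "y \<in> V \<and> g \<otimes> Y y \<in> cdom c \<and> cinv c (cmap c (g \<otimes> Y y)) = g \<otimes> Y y \<and> g \<otimes> Y y \<otimes> inv g \<in> W" if "y \<in> N" for y
  proof -
    have "y \<in> V" "g \<otimes> Y y \<in> cdom c" using that by (auto simp: N_def S_def inv)
    then show ?thesis using that chart_inverse(1)[OF c(1), of "g \<otimes> Y y"] by (auto simp: N_def S'_def inv)
  qed
  have C': "C1_map_on N (\<lambda>y. X (g \<otimes> Y y \<otimes> inv g)) d"
    by (rule C2_map_on_imp_C1, rule C2_map_on_cong[OF C]) (use ND in auto)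
  have N0: "0 \<in> N"
    using c c' zero_in_V one_in_W by (auto simp: N_def S_def S'_def inv Y_zero group_simps)
  have Ad: "\<forall>v. d 0 v = Ad g v"
    unfolding Ad_def using dir_deriv_eqI[OF C1_map_onD(3)[OF C' N0]] by simp
  have NW: "\<forall>y\<in>N. g \<otimes> Y y \<otimes> inv g \<in> W" using ND by blast
  have "conj_nbhd g N d"
    unfolding conj_nbhd_def by (rule conjI[OF N0 conjI[OF C' conjI[OF Ad NW]]])
  then show ?thesis by blast
qed

lemma Ad_add: "Ad g (v + w) = Ad g v + Ad g w"
  and Ad_scaleR: "Ad g (a *\<^sub>R v) = a *\<^sub>R Ad g v"
  and Ad_continuous: "continuous_on UNIV (Ad g)"
proof -
  obtain N d where "conj_nbhd g N d" using ex_conj_nbhd by blast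
  note N = conj_nbhdD[OF this]
  show "Ad g (v + w) = Ad g v + Ad g w"
    using C1_map_on_deriv_add[OF N(2,1), of v w] by (simp only: N(3))
  show "Ad g (a *\<^sub>R v) = a *\<^sub>R Ad g v"
    using C1_map_on_deriv_scaleR[OF N(2,1), of a v] by (simp only: N(3))
  have "((\<lambda>x. d 0 x) \<longlongrightarrow> d 0 x) (at x)" for x
    by (rule C1_map_on_tendsto[OF N(2,1) tendsto_const tendsto_ident_at])
  then show "continuous_on UNIV (Ad g)"
    by (simp add: continuous_on_def N(3))
qed

lemma Ad_C1: "C1_map_on UNIV (Ad g) (\<lambda>_. Ad g)"
  by (rule C1_map_on_linear[OF open_UNIV Ad_add Ad_scaleR Ad_continuous])

lemma Ad_tendsto: "(f \<longlongrightarrow> v) F \<Longrightarrow> ((\<lambda>x. Ad g (f x)) \<longlongrightarrow> Ad g v) F"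
  using continuous_on_tendsto_compose[OF Ad_continuous] by simp

lemma Ad_mult: "Ad (g \<otimes> h) v = Ad g (Ad h v)"
proof -
  obtain N d where "conj_nbhd g N d" using ex_conj_nbhd by blast
  note N = conj_nbhdD[OF this]
  obtain M e where "conj_nbhd h M e" using ex_conj_nbhd by blast
  note M = conj_nbhdD[OF this]
  obtain L f where "conj_nbhd (g \<otimes> h) L f" using ex_conj_nbhd by blast
  note L = conj_nbhdD[OF this]
  have h0: "X (h \<otimes> Y 0 \<otimes> inv h) = 0" by (simp add: Y_zero group_simps Xi_one)
  have "has_curve_deriv (\<lambda>s. X (h \<otimes> Y (0 + s *\<^sub>R v) \<otimes> inv h)) (Ad h v) 0 UNIV"
    using C1_map_onD(3)[OF M(2,1), of v] unfolding has_dir_deriv_iff_curve_zero M(3) .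
  from C1_map_on_chain_curve[OF N(2) this]
  have "has_curve_deriv (\<lambda>s. X (g \<otimes> Y (X (h \<otimes> Y (s *\<^sub>R v) \<otimes> inv h)) \<otimes> inv g)) (Ad g (Ad h v)) 0 UNIV"
    by (simp add: h0 N)
  moreover have "X ((g \<otimes> h) \<otimes> Y (0 + s *\<^sub>R v) \<otimes> inv (g \<otimes> h)) = X (g \<otimes> Y (X (h \<otimes> Y (s *\<^sub>R v) \<otimes> inv h)) \<otimes> inv g)"
    if "0 + s *\<^sub>R v \<in> M" for s
    using Xi_inverse(1)[OF M(4)[OF that]] by (simp add: group_simps)
  ultimately have "f 0 v = Ad g (Ad h v)"
    using dir_deriv_eq_line[OF C1_map_onD(3)[OF L(2,1)] _ C1_map_onD(1)[OF M(2)] M(1)] by blast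
  then show ?thesis by (simp add: L(3))
qed

text \<open>The vector \<open>(v, w)\<close> is \<open>(v, v)\<close> plus
  \<open>(0, w - v)\<close>. Along the diagonal the quotient is constantly the unit, and along the
  second axis it is the identity in the chart.\<close>

lemma quotient_deriv_zero:
  assumes Q: "(0, 0) \<in> Q" "C1_map_on Q (\<lambda>z. X (inv (Y (fst z)) \<otimes> Y (snd z))) d"
    and QV: "\<And>z. z \<in> Q \<Longrightarrow> fst z \<in> V \<and> snd z \<in> V"
  shows "d (0, 0) (v, w) = w - v"
proof -
  have "d (0, 0) (0, w - v) = w - v"
    by (rule dir_deriv_eq_line[OF C1_map_onD(3)[OF Q(2,1)] has_curve_deriv_line C1_map_onD(1)[OF Q(2)] Q(1)])
      (use QV Xi_inverse(2) in \<open>auto simp: Y_zero group_simps scaleR_prod_def\<close>)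
  moreover have "d (0, 0) (v, v) = 0"
    by (rule dir_deriv_eq_line[OF C1_map_onD(3)[OF Q(2,1)] has_curve_deriv_const C1_map_onD(1)[OF Q(2)] Q(1)])
      (auto simp: group_simps scaleR_prod_def Xi_one)
  moreover have "d (0, 0) (v, w) = d (0, 0) (v, v) + d (0, 0) (0, w - v)"
    using C1_map_on_deriv_add[OF Q(2,1), of "(v, v)" "(0, w - v)"] by simp
  ultimately show ?thesis by simp
qed

subsection \<open>Right logarithmic derivatives in the chart\<close>

text \<open>Right translation by \<open>inv (\<alpha> t)\<close> moves the curve to the unit, where
  the fixed chart applies. Continuity is demanded separately because \<open>X\<close> carries no
  information outside \<open>W\<close>.\<close>

definition has_right_log_deriv :: "(real \<Rightarrow> 'g) \<Rightarrow> 'e \<Rightarrow> real \<Rightarrow> real set \<Rightarrow> bool" where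
  "has_right_log_deriv \<alpha> v t S \<longleftrightarrow>
     (\<alpha> \<longlongrightarrow> \<alpha> t) (at t within S) \<and> has_curve_deriv (\<lambda>s. X (\<alpha> s \<otimes> inv (\<alpha> t))) v t S"

lemma tendsto_right_quotient:
  assumes "(\<alpha> \<longlongrightarrow> \<alpha> t) (at t within S)"
  shows "((\<lambda>s. \<alpha> s \<otimes> inv (\<alpha> t)) \<longlongrightarrow> \<one>) (at t within S)"
  using tendsto_mult_group[OF assms tendsto_const[of "inv (\<alpha> t)"]] by (simp add: group_simps)

lemma eventually_right_quotient_in_W:
  assumes "(\<alpha> \<longlongrightarrow> \<alpha> t) (at t within S)"
  shows "eventually (\<lambda>s. \<alpha> s \<otimes> inv (\<alpha> t) \<in> W) (at t within S)"
  by (rule topological_tendstoD[OF tendsto_right_quotient[OF assms] Xi_inverse(5) one_in_W])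

lemma has_right_log_deriv_translate:
  assumes "has_right_log_deriv \<alpha> v t S"
  shows "has_right_log_deriv (\<lambda>s. \<alpha> s \<otimes> g) v t S"
proof -
  have "((\<lambda>s. \<alpha> s \<otimes> g) \<longlongrightarrow> \<alpha> t \<otimes> g) (at t within S)"
    using assms unfolding has_right_log_deriv_def by (intro tendsto_mult_group tendsto_const) auto
  then show ?thesis using assms by (simp add: has_right_log_deriv_def group_simps)
qed

text \<open>After translation to the unit, the quotient is a conjugate by
  \<open>inv (\<alpha> t)\<close> of the quotient of two curves through the unit. The latter has the
  derivative \<open>w - v\<close>, and conjugation contributes the adjoint action.\<close>

lemma has_right_log_deriv_quotient:
  assumes \<alpha>: "has_right_log_deriv \<alpha> v t S" and \<beta>: "has_right_log_deriv \<beta> w t S"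
  shows "has_right_log_deriv (\<lambda>s. inv (\<alpha> s) \<otimes> \<beta> s) (Ad (inv (\<alpha> t)) (w - v)) t S"
  unfolding has_right_log_deriv_def
proof
  have c: "(\<alpha> \<longlongrightarrow> \<alpha> t) (at t within S)" "(\<beta> \<longlongrightarrow> \<beta> t) (at t within S)"
    using assms by (auto simp: has_right_log_deriv_def)
  then show "((\<lambda>s. inv (\<alpha> s) \<otimes> \<beta> s) \<longlongrightarrow> inv (\<alpha> t) \<otimes> \<beta> t) (at t within S)"
    by (intro tendsto_mult_group tendsto_inv_group)
  obtain Q d where Q: "(0, 0) \<in> Q" "C2_map_on Q (\<lambda>z. X (inv (Y (fst z)) \<otimes> Y (snd z))) d"
    "\<And>z. z \<in> Q \<Longrightarrow> fst z \<in> V \<and> snd z \<in> V"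
    using quotient_in_Xi by blast
  note Q1 = C2_map_on_imp_C1[OF Q(2)]
  define g where "g = inv (\<alpha> t)"
  obtain N e where "conj_nbhd g N e" using ex_conj_nbhd by blast
  note N = conj_nbhdD[OF this]
  define a where "a s = \<alpha> s \<otimes> inv (\<alpha> t)" for s
  define b where "b s = \<beta> s \<otimes> inv (\<beta> t)" for s
  have ab_t: "a t = \<one>" "b t = \<one>" by (simp_all add: a_def b_def group_simps)
  have "has_curve_deriv (\<lambda>s. (X (a s), X (b s))) (v, w) t S"
    using assms unfolding has_right_log_deriv_def a_def b_def by (intro has_curve_deriv_Pair) auto
  from C1_map_on_chain_curve[OF Q1 this]
  have "has_curve_deriv (\<lambda>s. X (inv (Y (X (a s))) \<otimes> Y (X (b s)))) (w - v) t S"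
    using Q(1) quotient_deriv_zero[OF Q(1) Q1 Q(3)] by (simp add: ab_t Xi_one)
  from C1_map_on_chain_curve[OF N(2) this]
  have D: "has_curve_deriv (\<lambda>s. X (g \<otimes> Y (X (inv (Y (X (a s))) \<otimes> Y (X (b s)))) \<otimes> inv g)) (Ad g (w - v)) t S"
    using N(1) by (simp add: ab_t Xi_one Y_zero group_simps N(3))
  have "(a \<longlongrightarrow> \<one>) (at t within S)" "(b \<longlongrightarrow> \<one>) (at t within S)"
    unfolding a_def[abs_def] b_def[abs_def] using c by (auto intro: tendsto_right_quotient)
  then have "((\<lambda>s. inv (a s) \<otimes> b s) \<longlongrightarrow> inv \<one> \<otimes> \<one>) (at t within S)"
    by (intro tendsto_mult_group tendsto_inv_group)
  then have ev: "eventually (\<lambda>s. inv (a s) \<otimes> b s \<in> W) (at t within S)"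
    by (rule topological_tendstoD) (auto simp: group_simps Xi_inverse(5) one_in_W)
  \<comment> \<open>The group identity behind the chain rule:
    \<open>g \<otimes> (inv (a s) \<otimes> b s) \<otimes> inv g\<close> is the quotient at
    \<open>s\<close> times the inverse of the quotient at \<open>t\<close>. It holds in the chart
    wherever all intermediate elements lie in \<open>W\<close>.\<close>
  have eq: "X (g \<otimes> Y (X (inv (Y (X (a s))) \<otimes> Y (X (b s)))) \<otimes> inv g)
      = X ((inv (\<alpha> s) \<otimes> \<beta> s) \<otimes> inv (inv (\<alpha> t) \<otimes> \<beta> t))"
    if "a s \<in> W" "b s \<in> W" "inv (a s) \<otimes> b s \<in> W" for s
    using that by (simp add: Xi_inverse(1)) (simp add: a_def b_def g_def group_simps)
  have ev': "eventually (\<lambda>s. X (g \<otimes> Y (X (inv (Y (X (a s))) \<otimes> Y (X (b s)))) \<otimes> inv g)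
      = X ((inv (\<alpha> s) \<otimes> \<beta> s) \<otimes> inv (inv (\<alpha> t) \<otimes> \<beta> t))) (at t within S)"
    using eventually_right_quotient_in_W[OF c(1), folded a_def] eventually_right_quotient_in_W[OF c(2), folded b_def] ev
    by eventually_elim (rule eq)
  have "X (g \<otimes> Y (X (inv (Y (X (a t))) \<otimes> Y (X (b t)))) \<otimes> inv g)
      = X ((inv (\<alpha> t) \<otimes> \<beta> t) \<otimes> inv (inv (\<alpha> t) \<otimes> \<beta> t))"
    by (rule eq) (simp_all add: ab_t one_in_W group_simps)
  from has_curve_deriv_transform_eventually[where \<gamma>' = "\<lambda>s. X ((inv (\<alpha> s) \<otimes> \<beta> s) \<otimes> inv (inv (\<alpha> t) \<otimes> \<beta> t))", OF D ev' this]
  show "has_curve_deriv (\<lambda>s. X ((inv (\<alpha> s) \<otimes> \<beta> s) \<otimes> inv (inv (\<alpha> t) \<otimes> \<beta> t))) (Ad (inv (\<alpha> t)) (w - v)) t S"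
    by (simp only: g_def)
qed

lemma has_right_log_deriv_compose:
  assumes \<alpha>: "has_right_log_deriv \<alpha> v (\<sigma> t) T" and \<sigma>: "has_curve_deriv \<sigma> c t S"
    and T: "\<And>s. s \<in> S \<Longrightarrow> \<sigma> s \<in> T"
  shows "has_right_log_deriv (\<lambda>s. \<alpha> (\<sigma> s)) (c *\<^sub>R v) t S"
  unfolding has_right_log_deriv_def
proof
  have "continuous (at (\<sigma> t) within T) \<alpha>"
    using \<alpha> by (simp add: has_right_log_deriv_def continuous_within)
  then show "((\<lambda>s. \<alpha> (\<sigma> s)) \<longlongrightarrow> \<alpha> (\<sigma> t)) (at t within S)"
    by (rule continuous_within_tendsto_compose[OF _ _ has_curve_deriv_continuous[OF \<sigma>]])
      (use T in \<open>auto simp: eventually_at_filter\<close>)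
  show "has_curve_deriv (\<lambda>s. X (\<alpha> (\<sigma> s) \<otimes> inv (\<alpha> (\<sigma> t)))) (c *\<^sub>R v) t S"
    using has_curve_deriv_comp_real[OF _ \<sigma> T] \<alpha> unfolding has_right_log_deriv_def by blast
qed

lemma has_right_log_deriv_mono:
  "has_right_log_deriv \<alpha> v t S \<Longrightarrow> T \<subseteq> S \<Longrightarrow> has_right_log_deriv \<alpha> v t T"
  unfolding has_right_log_deriv_def using has_curve_deriv_mono tendsto_within_subset by blast

text \<open>Bisection again, since the curve need not stay in one chart. Near \<open>x\<close> the
  translate \<open>w s \<otimes> inv (w x)\<close> stays in \<open>W\<close>, its coordinate has
  derivative 0, and the chart is injective.\<close>

lemma has_right_log_deriv_zero_constant:
  assumes "a \<le> b" and w: "\<And>t. t \<in> {a..b} \<Longrightarrow> has_right_log_deriv w 0 t {a..b}"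
  shows "w b = w a"
proof -
  define P where "P u v \<longleftrightarrow> (a \<le> u \<and> v \<le> b \<longrightarrow> w v = w u)" for u v
  obtain dm where "C2_map_on mult_dom (\<lambda>z. X (Y (fst z) \<otimes> Y (snd z))) dm"
    using mult_in_Xi by blast
  then have m: "C1_map_on mult_dom (\<lambda>z. X (Y (fst z) \<otimes> Y (snd z))) dm"
    by (rule C2_map_on_imp_C1)
  have c: "(w \<longlongrightarrow> w t) (at t within {a..b})" if "t \<in> {a..b}" for t
    using w[OF that] by (simp add: has_right_log_deriv_def)
  have "P a b"
    using \<open>a \<le> b\<close>
  proof (induction rule: Bolzano)
    case (trans x y z)
    then show ?case by (auto simp: P_def)
  next
    case (local x)
    then have x: "x \<in> {a..b}" by simp
    obtain d where d: "d > 0" and dd: "\<And>s. s \<in> {a..b} \<Longrightarrow> s \<noteq> x \<Longrightarrow> dist s x < d \<Longrightarrow> w s \<otimes> inv (w x) \<in> W"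
      using eventually_right_quotient_in_W[OF c[OF x]] unfolding eventually_at by blast
    have inW: "w s \<otimes> inv (w x) \<in> W" if "s \<in> {a..b}" "\<bar>s - x\<bar> < d" for s
      using dd[OF that(1)] that(2) one_in_W by (cases "s = x") (auto simp: dist_real_def group_simps)
    have "w v = w u" if uv: "u \<le> x" "x \<le> v" "v - u < d" "a \<le> u" "v \<le> b" for u v
    proof -
      have sub: "s \<in> {a..b}" "\<bar>s - x\<bar> < d" if "s \<in> {u..v}" for s using that uv by auto
      define y where "y s = X (w s \<otimes> inv (w x))" for s
      have "has_curve_deriv y 0 s {u..v}" if s: "s \<in> {u..v}" for s
      proof -
        have ysV: "y s \<in> V" using inW[OF sub[OF s]] by (simp add: y_def)
        \<comment> \<open>The hypothesis is a derivative at the unit; multiplying by the fixed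
          element \<open>Y (y s)\<close> in the chart moves it to the point \<open>y s\<close>, and
          a zero derivative is preserved.\<close>
        have "has_curve_deriv (\<lambda>r. X (w r \<otimes> inv (w s))) 0 s {u..v}"
          using w[OF sub(1)[OF s]] uv unfolding has_right_log_deriv_def
          by (auto intro: has_curve_deriv_mono)
        from has_curve_deriv_Pair[OF this has_curve_deriv_const[of "y s"]]
        have "has_curve_deriv (\<lambda>r. (X (w r \<otimes> inv (w s)), y s)) 0 s {u..v}"
          by (simp add: zero_prod_def)
        from C1_map_on_chain_curve[OF m this]
        have D: "has_curve_deriv (\<lambda>r. X (Y (X (w r \<otimes> inv (w s))) \<otimes> Y (y s))) 0 s {u..v}"
          using zero_mult_dom[OF ysV] C1_map_on_deriv_zero[OF m zero_mult_dom[OF ysV]]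
          by (simp add: group_simps Xi_one)
        have Yy: "Y (y s) = w s \<otimes> inv (w x)"
          using Xi_inverse(1)[OF inW[OF sub[OF s]]] by (simp add: y_def)
        have "(w \<longlongrightarrow> w s) (at s within {u..v})"
          using c[OF sub(1)[OF s]] by (rule tendsto_within_subset) (use uv in auto)
        from eventually_right_quotient_in_W[OF this]
        have "eventually (\<lambda>r. X (Y (X (w r \<otimes> inv (w s))) \<otimes> Y (y s)) = y r) (at s within {u..v})"
          by eventually_elim (simp add: Xi_inverse(1) Yy, simp add: y_def group_simps)
        moreover have "X (Y (X (w s \<otimes> inv (w s))) \<otimes> Y (y s)) = y s"
          by (simp add: group_simps Xi_one Y_zero Yy) (simp add: y_def)
        ultimately show ?thesis by (rule has_curve_deriv_transform_eventually[OF D])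
      qed
      then have "y v = y u" using uv by (intro curve_constant) auto
      then have "w v \<otimes> inv (w x) = w u \<otimes> inv (w x)"
        unfolding y_def using uv by (intro inj_onD[OF Xi_inverse(4)] inW) auto
      then have "(w v \<otimes> inv (w x)) \<otimes> w x = (w u \<otimes> inv (w x)) \<otimes> w x" by simp
      then show ?thesis by (simp add: group_simps)
    qed
    then show ?case using d by (intro exI[of _ d]) (auto simp: P_def)
  qed
  then show ?thesis by (simp add: P_def)
qed

end

context charted_lie_group
begin

subsection \<open>Adjoint action along a curve\<close>

lemma tendsto_Xi_right_quotient:
  assumes "(\<alpha> \<longlongrightarrow> \<alpha> t) (at t within S)"
  shows "((\<lambda>s. X (\<alpha> s \<otimes> inv (\<alpha> t))) \<longlongrightarrow> 0) (at t within S)"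
  using tendsto_Xi[OF tendsto_right_quotient[OF assms] one_in_W] by (simp add: Xi_one)

text \<open>The map is conjugation of \<open>y\<close> by the inverse of \<open>x\<close> in the chart.\<close>

lemma Ad_inv_Y:
  assumes "C1_map_on Q (\<lambda>z. X (inv (Y (fst z)) \<otimes> Y (snd z) \<otimes> Y (fst z))) d" "(x, 0) \<in> Q"
  shows "Ad (inv (Y x)) v = d (x, 0) (0, v)"
proof -
  have "has_dir_deriv (\<lambda>z. X (inv (Y (fst z)) \<otimes> Y (snd z) \<otimes> Y (fst z))) (x, 0) (0, v) (d (x, 0) (0, v))"
    by (rule C1_map_onD(3)[OF assms])
  then have "has_dir_deriv (\<lambda>y. X (inv (Y x) \<otimes> Y y \<otimes> inv (inv (Y x)))) 0 v (d (x, 0) (0, v))"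
    by (simp add: has_dir_deriv_def group_laws(7))
  then show ?thesis unfolding Ad_def by (rule dir_deriv_eqI)
qed

text \<open>As \<open>Ad\<close> is multiplicative, \<open>Ad (inv (\<alpha> s))\<close> is the
  fixed map \<open>Ad (inv (\<alpha> t))\<close> after the adjoint action of an element near the
  unit, and there that action is a partial derivative of conjugation. This carries regularity from
  the unit to all points of the curve.\<close>

lemma eventually_Ad_inv_eq:
  assumes K: "C1_map_on Q (\<lambda>z. X (inv (Y (fst z)) \<otimes> Y (snd z) \<otimes> Y (fst z))) d" "(0, 0) \<in> Q"
    and \<alpha>: "(\<alpha> \<longlongrightarrow> \<alpha> t) (at t within S)"
  shows "eventually (\<lambda>s. (X (\<alpha> s \<otimes> inv (\<alpha> t)), 0) \<in> Q \<and>
    (\<forall>v. Ad (inv (\<alpha> t)) (d (X (\<alpha> s \<otimes> inv (\<alpha> t)), 0) (0, v)) = Ad (inv (\<alpha> s)) v)) (at t within S)"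
proof -
  have "((\<lambda>s. (X (\<alpha> s \<otimes> inv (\<alpha> t)), 0 :: 'e)) \<longlongrightarrow> (0, 0)) (at t within S)"
    by (intro tendsto_Pair tendsto_Xi_right_quotient[OF \<alpha>] tendsto_const)
  then have "eventually (\<lambda>s. (X (\<alpha> s \<otimes> inv (\<alpha> t)), 0) \<in> Q) (at t within S)"
    by (rule topological_tendstoD[OF _ C1_map_onD(1)[OF K(1)] K(2)])
  with eventually_right_quotient_in_W[OF \<alpha>] show ?thesis
  proof eventually_elim
    case (elim s)
    have "Ad (inv (\<alpha> t)) (d (X (\<alpha> s \<otimes> inv (\<alpha> t)), 0) (0, v)) = Ad (inv (\<alpha> s)) v" for v
    proof -
      have "Ad (inv (\<alpha> t)) (d (X (\<alpha> s \<otimes> inv (\<alpha> t)), 0) (0, v))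
          = Ad (inv (\<alpha> t)) (Ad (inv (\<alpha> s \<otimes> inv (\<alpha> t))) v)"
        using Ad_inv_Y[OF K(1) elim(2)] by (simp add: Xi_inverse(1)[OF elim(1)])
      also have "\<dots> = Ad (inv (\<alpha> t) \<otimes> inv (\<alpha> s \<otimes> inv (\<alpha> t))) v" by (simp only: Ad_mult)
      also have "inv (\<alpha> t) \<otimes> inv (\<alpha> s \<otimes> inv (\<alpha> t)) = inv (\<alpha> s)" by (simp add: group_simps)
      finally show ?thesis .
    qed
    then show ?case using elim(2) by blast
  qed
qed

lemma Ad_inv_continuous_on:
  fixes \<alpha> :: "real \<Rightarrow> 'g"
  assumes "continuous_on S \<alpha>"
  shows "continuous_on (S \<times> UNIV) (\<lambda>(t, v). Ad (inv (\<alpha> t)) v)"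
  unfolding continuous_on_def
proof
  fix z :: "real \<times> 'e" assume z: "z \<in> S \<times> UNIV"
  obtain t v where tv: "z = (t, v)" by (cases z)
  then have t: "t \<in> S" using z by simp
  obtain Q d where "(0, 0) \<in> Q" and K2: "C2_map_on Q (\<lambda>z. X (inv (Y (fst z)) \<otimes> Y (snd z) \<otimes> Y (fst z))) d"
    using conj_in_Xi by blast
  note K = C2_map_on_imp_C1[OF K2] \<open>(0, 0) \<in> Q\<close>
  have \<alpha>: "(\<alpha> \<longlongrightarrow> \<alpha> t) (at t within S)" using assms t by (simp add: continuous_on_def)
  let ?x = "\<lambda>s. X (\<alpha> s \<otimes> inv (\<alpha> t))"
  have x_t: "?x t = 0" by (simp add: group_simps Xi_one)
  have "continuous (at t within S) ?x"
    using tendsto_Xi_right_quotient[OF \<alpha>] x_t by (simp add: continuous_within)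
  moreover have fst: "(fst \<longlongrightarrow> t) (at z within S \<times> UNIV)" and snd: "(snd \<longlongrightarrow> v) (at z within S \<times> UNIV)"
    using tendsto_fst[OF tendsto_ident_at, of z] tendsto_snd[OF tendsto_ident_at, of z] tv by auto
  have inS: "eventually (\<lambda>y. fst y \<in> S) (at z within S \<times> UNIV)"
    unfolding eventually_at_filter by (rule always_eventually) auto
  ultimately have "((\<lambda>y. ?x (fst y)) \<longlongrightarrow> ?x t) (at z within S \<times> UNIV)"
    by (intro continuous_within_tendsto_compose[OF _ inS fst])
  then have "((\<lambda>y. d (?x (fst y), 0) (0, snd y)) \<longlongrightarrow> d (0, 0) (0, v)) (at z within S \<times> UNIV)"
    unfolding x_t by (intro C1_map_on_tendsto[OF K] tendsto_Pair tendsto_const snd)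
  then have lim: "((\<lambda>y. Ad (inv (\<alpha> t)) (d (?x (fst y), 0) (0, snd y))) \<longlongrightarrow> Ad (inv (\<alpha> t)) (d (0, 0) (0, v)))
      (at z within S \<times> UNIV)"
    by (rule Ad_tendsto)
  have "d (0, 0) (0, v) = v"
  proof -
    have "Ad \<one> v = Ad (inv (Y 0)) v" by (simp add: Y_zero group_simps)
    also have "\<dots> = d (0, 0) (0, v)" by (rule Ad_inv_Y[OF K])
    finally have "d (0, 0) (0, v) = Ad \<one> v" ..
    also have "\<dots> = v"
    proof -
      obtain N e where "conj_nbhd \<one> N e" using ex_conj_nbhd by blast
      note N = conj_nbhdD[OF this]
      have NV: "open (N \<inter> V)" "0 \<in> N \<inter> V"
        using C1_map_onD(1)[OF N(2)] N(1) Xi_inverse(6) zero_in_V by auto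
      have "e 0 v = v"
        by (rule dir_deriv_eq_line[OF C1_map_onD(3)[OF N(2,1)] has_curve_deriv_line NV])
          (simp add: group_simps Xi_inverse(2))
      then show ?thesis by (simp add: N(3))
    qed
    finally show ?thesis .
  qed
  obtain e where e: "e > 0" "\<And>s. s \<in> S \<Longrightarrow> s \<noteq> t \<Longrightarrow> dist s t < e \<Longrightarrow>
      (\<forall>v. Ad (inv (\<alpha> t)) (d (?x s, 0) (0, v)) = Ad (inv (\<alpha> s)) v)"
    using eventually_Ad_inv_eq[OF K \<alpha>] unfolding eventually_at by blast
  \<comment> \<open>Punctured neighbourhoods of \<open>(t, v)\<close> still contain points
    \<open>(t, w)\<close>, so the formula is also needed at \<open>s = t\<close>.\<close>
  have eq_t: "Ad (inv (\<alpha> t)) (d (?x t, 0) (0, w)) = Ad (inv (\<alpha> t)) w" for w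
    unfolding x_t using Ad_inv_Y[OF K, of w] Ad_mult[of "inv (\<alpha> t)" \<one> w] by (simp add: Y_zero group_simps)
  have "eventually (\<lambda>y. dist (fst y) t < e) (at z within S \<times> UNIV)"
    using tendstoD[OF fst e(1)] .
  with inS have "eventually (\<lambda>y. Ad (inv (\<alpha> t)) (d (?x (fst y), 0) (0, snd y)) = Ad (inv (\<alpha> (fst y))) (snd y)) (at z within S \<times> UNIV)"
    by eventually_elim (metis e(2) eq_t)
  from Lim_transform_eventually[OF lim this]
  show "((\<lambda>(t, v). Ad (inv (\<alpha> t)) v) \<longlongrightarrow> (case z of (t, v) \<Rightarrow> Ad (inv (\<alpha> t)) v)) (at z within S \<times> UNIV)"
    by (simp add: tv case_prod_beta' \<open>d (0, 0) (0, v) = v\<close>)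
qed

text \<open>The map \<open>b\<close> is chosen before the curve and the time, so a single bilinear
  bound controls the whole interval. Differentiating the local formula for
  \<open>Ad (inv (\<alpha> s))\<close> in the base point produces it.\<close>

lemma Ad_inv_has_curve_deriv:
  "\<exists>b. continuous_bilinear b \<and> (\<forall>\<alpha> u t S v. has_right_log_deriv \<alpha> u t S \<longrightarrow>
     has_curve_deriv (\<lambda>s. Ad (inv (\<alpha> s)) v) (Ad (inv (\<alpha> t)) (b u v)) t S)"
proof -
  obtain Q d where "(0, 0) \<in> Q" and K2: "C2_map_on Q (\<lambda>z. X (inv (Y (fst z)) \<otimes> Y (snd z) \<otimes> Y (fst z))) d"
    using conj_in_Xi by blast
  note K = C2_map_on_imp_C1[OF K2] \<open>(0, 0) \<in> Q\<close>
  obtain dd where dd: "C1_map_on (Q \<times> UNIV) (\<lambda>z. d (fst z) (snd z)) dd"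
    using K2 by (auto simp: C2_map_on_def)
  \<comment> \<open>The mixed second derivative of conjugation at the origin: direction
    \<open>v\<close> in the conjugated element, then \<open>u\<close> in the conjugating
    one.\<close>
  define b where "b u v = dd ((0, 0), (0, v)) ((u, 0), (0, 0))" for u v :: 'e
  have inQ: "((0, 0), w) \<in> Q \<times> UNIV" for w :: "'e \<times> 'e" using K(2) by simp
  have b_deriv: "has_curve_deriv (\<lambda>s. d (s *\<^sub>R u, 0) (0, v)) (b u v) 0 UNIV" for u v
    using C1_map_onD(3)[OF dd inQ, of "(0, v)" "((u, 0), (0, 0))"]
    unfolding has_dir_deriv_iff_curve_zero b_def by (simp add: scaleR_prod_def)
  have near: "eventually (\<lambda>s. (s *\<^sub>R u, 0) \<in> Q) (at (0::real))" for u
  proof -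
    have "((\<lambda>s. (s *\<^sub>R u, 0 :: 'e)) \<longlongrightarrow> (0 *\<^sub>R u, 0)) (at (0::real))"
      by (intro tendsto_Pair tendsto_scaleR_lcs tendsto_ident_at tendsto_const)
    then show ?thesis
      by (rule topological_tendstoD[OF _ C1_map_onD(1)[OF K(1)]]) (simp add: K(2))
  qed
  have b1: "b (u + u') v = b u v + b u' v" for u u' v
    using C1_map_on_deriv_add[OF dd inQ, of "(0, v)" "((u, 0), (0, 0))" "((u', 0), (0, 0))"] by (simp add: b_def)
  have b2: "b (a *\<^sub>R u) v = a *\<^sub>R b u v" for a u v
    using C1_map_on_deriv_scaleR[OF dd inQ, of "(0, v)" a "((u, 0), (0, 0))"] by (simp add: b_def scaleR_prod_def)
  \<comment> \<open>Linearity in \<open>v\<close> comes from differentiating the linearity of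
    \<open>d z\<close> in its direction. That identity holds for \<open>z\<close> in
    \<open>Q\<close> only, which \<open>near\<close> guarantees for small parameters.\<close>
  have b3: "b u (v + v') = b u v + b u v'" for u v v'
  proof (rule has_curve_deriv_unique[OF b_deriv])
    have eq: "d z (0, v) + d z (0, v') = d z (0, v + v')" if "z \<in> Q" for z
      using C1_map_on_deriv_add[OF K(1) that, of "(0, v)" "(0, v')"] by simp
    have "has_curve_deriv (\<lambda>s. d (s *\<^sub>R u, 0) (0, v) + d (s *\<^sub>R u, 0) (0, v')) (b u v + b u v') 0 UNIV"
      by (intro has_curve_deriv_add b_deriv)
    then show "has_curve_deriv (\<lambda>s. d (s *\<^sub>R u, 0) (0, v + v')) (b u v + b u v') 0 UNIV"
      by (rule has_curve_deriv_transform_eventually)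
        (use near[of u] K(2) in \<open>auto simp: eq elim: eventually_mono\<close>)
  qed simp
  have b4: "b u (a *\<^sub>R v) = a *\<^sub>R b u v" for a u v
  proof (rule has_curve_deriv_unique[OF b_deriv])
    have eq: "a *\<^sub>R d z (0, v) = d z (0, a *\<^sub>R v)" if "z \<in> Q" for z
      using C1_map_on_deriv_scaleR[OF K(1) that, of a "(0, v)"] by (simp add: scaleR_prod_def)
    have "has_curve_deriv (\<lambda>s. a *\<^sub>R d (s *\<^sub>R u, 0) (0, v)) (a *\<^sub>R b u v) 0 UNIV"
      using has_curve_deriv_bilinear[OF continuous_bilinear_scaleR has_curve_deriv_const[of a] b_deriv[of u v]]
      by simp
    then show "has_curve_deriv (\<lambda>s. d (s *\<^sub>R u, 0) (0, a *\<^sub>R v)) (a *\<^sub>R b u v) 0 UNIV"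
      by (rule has_curve_deriv_transform_eventually)
        (use near[of u] K(2) in \<open>auto simp: eq elim: eventually_mono\<close>)
  qed simp
  have "((\<lambda>z. b (fst z) (snd z)) \<longlongrightarrow> b (fst z) (snd z)) (at z)" for z :: "'e \<times> 'e"
    unfolding b_def
    by (intro C1_map_on_tendsto[OF dd inQ] tendsto_Pair tendsto_const tendsto_fst tendsto_snd tendsto_ident_at)
  then have "continuous_on UNIV (\<lambda>(u, v). b u v)"
    by (simp add: continuous_on_def split_beta)
  then have "continuous_bilinear b"
    unfolding continuous_bilinear_def using b1 b2 b3 b4 by blast
  moreover have "has_curve_deriv (\<lambda>s. Ad (inv (\<alpha> s)) v) (Ad (inv (\<alpha> t)) (b u v)) t S"
    if \<alpha>: "has_right_log_deriv \<alpha> u t S" for \<alpha> u t S v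
  proof -
    let ?x = "\<lambda>s. X (\<alpha> s \<otimes> inv (\<alpha> t))"
    have c: "(\<alpha> \<longlongrightarrow> \<alpha> t) (at t within S)" and x: "has_curve_deriv ?x u t S"
      using \<alpha> by (auto simp: has_right_log_deriv_def)
    have x_t: "?x t = 0" by (simp add: group_simps Xi_one)
    have "has_curve_deriv (\<lambda>s. ((?x s, 0), (0, v))) ((u, 0), 0) t S"
      by (intro has_curve_deriv_Pair x has_curve_deriv_const)
    from C1_map_on_chain_curve[OF dd this]
    have "has_curve_deriv (\<lambda>s. d (?x s, 0) (0, v)) (b u v) t S"
      using K(2) by (simp add: x_t b_def zero_prod_def)
    from C1_map_on_chain_curve[OF Ad_C1 this]
    have D: "has_curve_deriv (\<lambda>s. Ad (inv (\<alpha> t)) (d (?x s, 0) (0, v))) (Ad (inv (\<alpha> t)) (b u v)) t S"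
      by simp
    have "eventually (\<lambda>s. Ad (inv (\<alpha> t)) (d (?x s, 0) (0, v)) = Ad (inv (\<alpha> s)) v) (at t within S)"
      using eventually_Ad_inv_eq[OF K c] by eventually_elim blast
    moreover have "Ad (inv (\<alpha> t)) (d (?x t, 0) (0, v)) = Ad (inv (\<alpha> t)) v"
      unfolding x_t using Ad_inv_Y[OF K, of v] Ad_mult[of "inv (\<alpha> t)" \<one> v] by (simp add: Y_zero group_simps)
    ultimately show ?thesis by (rule has_curve_deriv_transform_eventually[OF D])
  qed
  ultimately show ?thesis by blast
qed

subsection \<open>The evolution map\<close>

text \<open>\<open>curve_deriv\<close> is a \<open>Lim\<close> and has a meaning only where the
  limit exists; the extension of the curve beyond \<open>{0..1}\<close> provides the
  existence.\<close>

lemma C1_curve_chart_deriv: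
  assumes \<mu>: "\<mu> \<in> C1_curves A" and t: "t \<in> {0..1}" and c: "c \<in> A" "\<mu> t \<in> cdom c"
  shows "has_curve_deriv (cmap c \<circ> \<mu>) (curve_deriv (cmap c \<circ> \<mu>) t) t {0..1}"
proof -
  obtain a b \<nu> where ab: "a < 0" "1 < b" and \<nu>: "Ck_map 1 model_atlas A {a<..<b} \<nu>" "\<And>t. t \<in> {0..1} \<Longrightarrow> \<nu> t = \<mu> t"
    using \<mu> unfolding C1_curves_def by auto
  have "bastiani 1 (cmap (UNIV, id) ` {x \<in> {a<..<b} \<inter> cdom (UNIV, id). \<nu> x \<in> cdom c}) (cmap c \<circ> \<nu> \<circ> cinv (UNIV, id))"
    using \<nu>(1) c(1) unfolding Ck_map_def model_atlas_def by blast
  moreover have "inv_into UNIV id = (id :: real \<Rightarrow> real)" by (auto simp: inv_id)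
  ultimately have "bastiani 1 {x \<in> {a<..<b}. \<nu> x \<in> cdom c} (cmap c \<circ> \<nu>)" by simp
  from bastiani_imp_C1[OF this]
  have "C1_map_on {x \<in> {a<..<b}. \<nu> x \<in> cdom c} (cmap c \<circ> \<nu>) (dir_deriv (cmap c \<circ> \<nu>))" by simp
  moreover have "t \<in> {x \<in> {a<..<b}. \<nu> x \<in> cdom c}" using t ab \<nu>(2) c(2) by auto
  ultimately have "has_dir_deriv (cmap c \<circ> \<nu>) t 1 (dir_deriv (cmap c \<circ> \<nu>) t 1)" by (rule C1_map_onD(3))
  then have "has_curve_deriv (cmap c \<circ> \<nu>) (dir_deriv (cmap c \<circ> \<nu>) t 1) t UNIV"
    using has_dir_deriv_iff_curve[of "cmap c \<circ> \<nu>" 0 t 1] by (simp add: o_def)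
  then have "has_curve_deriv (cmap c \<circ> \<nu>) (dir_deriv (cmap c \<circ> \<nu>) t 1) t {0..1}"
    by (rule has_curve_deriv_mono) simp
  then have D: "has_curve_deriv (cmap c \<circ> \<mu>) (dir_deriv (cmap c \<circ> \<nu>) t 1) t {0..1}"
    by (rule has_curve_deriv_cong) (use \<nu>(2) t in auto)
  then show ?thesis using curve_deriv_eqI[OF D t] by simp
qed

lemma C1_curve_continuous:
  assumes "\<mu> \<in> C1_curves A" "t \<in> {0..1}"
  shows "(\<mu> \<longlongrightarrow> \<mu> t) (at t within {0..1})"
proof -
  obtain a b \<nu> where ab: "a < 0" "1 < b" and \<nu>: "Ck_map 1 model_atlas A {a<..<b} \<nu>" "\<And>t. t \<in> {0..1} \<Longrightarrow> \<nu> t = \<mu> t"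
    using assms(1) unfolding C1_curves_def by auto
  have "continuous_on {0..1} \<nu>"
    using \<nu>(1) ab unfolding Ck_map_def by (auto intro: continuous_on_subset)
  then have "continuous_on {0..1} \<mu>" by (rule continuous_on_eq) (rule \<nu>(2))
  then show ?thesis using assms(2) by (simp add: continuous_on_def)
qed

text \<open>The link between the abstract logarithmic derivative, a set of coordinates in all
  charts, and its coordinate form. Each chart \<open>c\<close> around \<open>\<mu> t\<close>
  computes the derivative of the same curve \<open>X (\<mu> s \<otimes> g)\<close>.\<close>

lemma has_right_log_deriv_C1_curve:
  assumes \<mu>: "\<mu> \<in> C1_curves A" and t: "t \<in> {0..1}"
  shows "has_right_log_deriv \<mu> (chart_deriv \<Xi> (right_log_deriv \<mu> t)) t {0..1}"
proof -
  define g where "g = inv (\<mu> t)"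
  have g: "\<mu> t \<otimes> g = \<one>" by (simp add: g_def group_simps)
  have lim: "(\<mu> \<longlongrightarrow> \<mu> t) (at t within {0..1})" by (rule C1_curve_continuous[OF \<mu> t])
  have D: "has_curve_deriv (\<lambda>s. X (\<mu> s \<otimes> g)) (dir_deriv (X \<circ> (\<lambda>h. h \<otimes> g) \<circ> cinv c) (cmap c (\<mu> t))
      (curve_deriv (cmap c \<circ> \<mu>) t)) t {0..1}" if c: "c \<in> A" "\<mu> t \<in> cdom c" for c
  proof -
    obtain c' where c': "c' \<in> A" "g \<in> cdom c'" by (rule ex_chart)
    define S where "S = {z \<in> cmap c ` cdom c \<times> cmap c' ` cdom c'. cinv c (fst z) \<otimes> cinv c' (snd z) \<in> W}"
    obtain df where f: "C2_map_on S (\<lambda>z. X (cinv c (fst z) \<otimes> cinv c' (snd z))) df"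
      using mult_in_charts[OF c(1) c'(1) Xi_in_atlas] unfolding S_def by blast
    have "C2_map_on (UNIV \<inter> (\<lambda>y. (y, cmap c' g)) -` S)
        (\<lambda>y. X (cinv c (fst (y, cmap c' g)) \<otimes> cinv c' (snd (y, cmap c' g)))) (\<lambda>y v. df (y, cmap c' g) (v, 0))"
      by (rule C2_map_on_compose_vimage[OF C2_map_on_Pair[OF C2_map_on_id C2_map_on_const] f]) auto
    then have "C2_map_on ((\<lambda>y. (y, cmap c' g)) -` S) (X \<circ> (\<lambda>h. h \<otimes> g) \<circ> cinv c) (\<lambda>y v. df (y, cmap c' g) (v, 0))"
      by (simp add: chart_inverse(1)[OF c'] o_def)
    note R = C2_map_on_imp_C1[OF this]
    have in_dom: "cmap c (\<mu> t) \<in> (\<lambda>y. (y, cmap c' g)) -` S"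
      using c c' one_in_W by (simp add: S_def chart_inverse(1) g)
    have "has_curve_deriv (\<lambda>s. (X \<circ> (\<lambda>h. h \<otimes> g) \<circ> cinv c) ((cmap c \<circ> \<mu>) s))
        (df (cmap c (\<mu> t), cmap c' g) (curve_deriv (cmap c \<circ> \<mu>) t, 0)) t {0..1}"
      using C1_map_on_chain_curve[OF R C1_curve_chart_deriv[OF \<mu> t c]] in_dom by simp
    moreover have "dir_deriv (X \<circ> (\<lambda>h. h \<otimes> g) \<circ> cinv c) (cmap c (\<mu> t)) v = df (cmap c (\<mu> t), cmap c' g) (v, 0)" for v
      by (rule dir_deriv_eqI[OF C1_map_onD(3)[OF R in_dom]])
    ultimately have D: "has_curve_deriv (\<lambda>s. (X \<circ> (\<lambda>h. h \<otimes> g) \<circ> cinv c) ((cmap c \<circ> \<mu>) s))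
        (dir_deriv (X \<circ> (\<lambda>h. h \<otimes> g) \<circ> cinv c) (cmap c (\<mu> t)) (curve_deriv (cmap c \<circ> \<mu>) t)) t {0..1}"
      by simp
    have "eventually (\<lambda>s. \<mu> s \<in> cdom c) (at t within {0..1})"
      by (rule topological_tendstoD[OF lim chart_inverse(5)[OF c(1)] c(2)])
    then have "eventually (\<lambda>s. (X \<circ> (\<lambda>h. h \<otimes> g) \<circ> cinv c) ((cmap c \<circ> \<mu>) s) = X (\<mu> s \<otimes> g)) (at t within {0..1})"
      by eventually_elim (simp add: chart_inverse(1)[OF c(1)])
    then show ?thesis
      by (rule has_curve_deriv_transform_eventually[OF D]) (simp add: chart_inverse(1)[OF c])
  qed
  obtain c where c: "c \<in> A" "\<mu> t \<in> cdom c" by (rule ex_chart)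
  define v where "v = dir_deriv (X \<circ> (\<lambda>h. h \<otimes> g) \<circ> cinv c) (cmap c (\<mu> t)) (curve_deriv (cmap c \<circ> \<mu>) t)"
  \<comment> \<open>Independence of the chart through which the tangent map is computed follows from
    uniqueness of limits, without a transformation rule; it makes the \<open>THE\<close> in
    \<open>chart_deriv\<close> meaningful.\<close>
  have unique: "u = v" if "(\<Xi>, u) \<in> right_log_deriv \<mu> t" for u
  proof -
    have "\<exists>c' \<in> charts_at A (\<mu> t).
        u = dir_deriv (X \<circ> (\<lambda>h. h \<otimes> g) \<circ> cinv c') (cmap c' (\<mu> t)) (curve_deriv (cmap c' \<circ> \<mu>) t)"
      using that unfolding right_log_deriv_def tangent_map_def velocity_def g_def
      by (auto simp del: split_paired_Ex)
    then obtain c' where c': "c' \<in> charts_at A (\<mu> t)"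
      and u: "u = dir_deriv (X \<circ> (\<lambda>h. h \<otimes> g) \<circ> cinv c') (cmap c' (\<mu> t)) (curve_deriv (cmap c' \<circ> \<mu>) t)"
      by blast
    then show ?thesis
      unfolding u v_def using c' has_curve_deriv_unique[OF D D[OF c] at_within_unit_interval[OF t]]
      by (simp add: charts_at_def)
  qed
  have "(\<Xi>, v) \<in> right_log_deriv \<mu> t"
    unfolding right_log_deriv_def tangent_map_def velocity_def v_def g_def
    using c chart_Xi g by (auto simp: charts_at_def g_def simp del: split_paired_Ex)
  then have "chart_deriv \<Xi> (right_log_deriv \<mu> t) = v"
    unfolding chart_deriv_def using unique by (rule the_equality)
  then show ?thesis
    unfolding has_right_log_deriv_def using lim D[OF c] by (simp add: v_def g_def)
qed

text \<open>Every curve that \<open>SOME\<close> can pick is a right translate of a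
  \<open>C1\<close> curve with derivative \<open>\<phi>\<close>; the translation normalises the
  initial value and preserves the right logarithmic derivative.\<close>

lemma Evol_has_right_log_deriv:
  assumes "\<phi> \<in> log_derivs"
  shows "Evol \<phi> 0 = \<one>" "t \<in> {0..1} \<Longrightarrow> has_right_log_deriv (Evol \<phi>) (chart_deriv \<Xi> (\<phi> t)) t {0..1}"
proof -
  have "\<exists>\<nu>. \<exists>\<mu>\<in>C1_curves A. (\<forall>t\<in>{0..1}. \<phi> t = right_log_deriv \<mu> t) \<and> \<nu> = (\<lambda>t. \<mu> t \<otimes> inv (\<mu> 0))"
    using assms unfolding log_derivs_def by blast
  from someI_ex[OF this, folded Evol_def]
  obtain \<mu> where \<mu>: "\<mu> \<in> C1_curves A" "\<And>t. t \<in> {0..1} \<Longrightarrow> \<phi> t = right_log_deriv \<mu> t"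
    and E: "Evol \<phi> = (\<lambda>t. \<mu> t \<otimes> inv (\<mu> 0))" by blast
  show "Evol \<phi> 0 = \<one>" by (simp add: E group_simps)
  show "has_right_log_deriv (Evol \<phi>) (chart_deriv \<Xi> (\<phi> t)) t {0..1}" if "t \<in> {0..1}"
    unfolding E \<mu>(2)[OF that]
    by (rule has_right_log_deriv_translate[OF has_right_log_deriv_C1_curve[OF \<mu>(1) that]])
qed

subsection \<open>The Lie algebra in charts\<close>

text \<open>Records existence and uniqueness of the coordinate, on which the \<open>THE\<close> in
  \<open>chart_deriv\<close> relies, in a form that \<open>tvec_diff\<close> preserves.\<close>

definition has_chart_deriv :: "('g, 'e) chart \<Rightarrow> ('g, 'e) tvec \<Rightarrow> 'e \<Rightarrow> bool" where
  "has_chart_deriv c Z w \<longleftrightarrow> (\<forall>v. (c, v) \<in> Z \<longleftrightarrow> v = w)"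

lemma has_chart_deriv_imp_eq: "has_chart_deriv c Z w \<Longrightarrow> chart_deriv c Z = w"
  by (simp add: has_chart_deriv_def chart_deriv_def)

lemma has_chart_deriv_lie_algebra:
  assumes "Z \<in> lie_algebra" "c \<in> charts_at A \<one>"
  shows "has_chart_deriv c Z (chart_deriv c Z)"
proof -
  obtain c' v' where "c' \<in> charts_at A \<one>"
    and Z: "Z = {(d, dir_deriv (cmap d \<circ> cinv c') (cmap c' \<one>) v') | d. d \<in> charts_at A \<one>}"
    using assms(1) unfolding lie_algebra_def tangent_space_def mem_Collect_eq by blast
  have "has_chart_deriv c Z (dir_deriv (cmap c \<circ> cinv c') (cmap c' \<one>) v')"
    using assms(2) by (auto simp: has_chart_deriv_def Z simp del: split_paired_Ex)
  then show ?thesis using has_chart_deriv_imp_eq by metis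
qed

lemma has_chart_deriv_tvec_diff:
  "has_chart_deriv c Z w \<Longrightarrow> has_chart_deriv c Z' w' \<Longrightarrow> has_chart_deriv c (tvec_diff Z Z') (w - w')"
  by (auto simp: has_chart_deriv_def tvec_diff_def simp del: split_paired_Ex)

text \<open>Inverts the coordinate in \<open>\<Xi>\<close>; it turns a curve in the model space,
  such as the glued one, into a curve in the Lie algebra.\<close>

definition lie_vector :: "'e \<Rightarrow> ('g, 'e) tvec" where
  "lie_vector v = {(d, dir_deriv (cmap d \<circ> Y) (X \<one>) v) | d. d \<in> charts_at A \<one>}"

lemma lie_vector_in_lie_algebra: "lie_vector v \<in> lie_algebra"
  using chart_Xi unfolding lie_vector_def lie_algebra_def tangent_space_def by blast

lemma chart_deriv_lie_vector:
  assumes "c \<in> charts_at A \<one>"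
  shows "chart_deriv c (lie_vector v) = dir_deriv (cmap c \<circ> Y) (X \<one>) v"
  using assms by (auto simp: chart_deriv_def lie_vector_def simp del: split_paired_Ex)

text \<open>Class \<open>k\<close> of a Lie algebra curve is demanded in every chart around the
  unit. A change of chart acts by a continuous linear map, so checking the coordinate in
  \<open>\<Xi>\<close> suffices.\<close>

lemma chart_deriv_lie_vector_C1:
  assumes "c \<in> charts_at A \<one>"
  shows "chart_deriv c (lie_vector (v + w)) = chart_deriv c (lie_vector v) + chart_deriv c (lie_vector w)"
    "chart_deriv c (lie_vector (a *\<^sub>R v)) = a *\<^sub>R chart_deriv c (lie_vector v)"
    "continuous_on UNIV (\<lambda>v. chart_deriv c (lie_vector v))"
proof -
  have c: "c \<in> A" "\<one> \<in> cdom c" using assms by (auto simp: charts_at_def)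
  have "bastiani \<infinity> (X ` (W \<inter> cdom c)) (cmap c \<circ> Y)"
    using atlas Xi_in_atlas c(1) unfolding smooth_atlas_def smoothly_compatible_def by blast
  then have C1: "C1_map_on (X ` (W \<inter> cdom c)) (cmap c \<circ> Y) (dir_deriv (cmap c \<circ> Y))"
    by (rule bastiani_imp_C1) simp
  have 1: "X \<one> \<in> X ` (W \<inter> cdom c)" using one_in_W c(2) by blast
  show "chart_deriv c (lie_vector (v + w)) = chart_deriv c (lie_vector v) + chart_deriv c (lie_vector w)"
    "chart_deriv c (lie_vector (a *\<^sub>R v)) = a *\<^sub>R chart_deriv c (lie_vector v)"
    unfolding chart_deriv_lie_vector[OF assms]
    by (rule C1_map_on_deriv_add[OF C1 1], rule C1_map_on_deriv_scaleR[OF C1 1])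
  show "continuous_on UNIV (\<lambda>v. chart_deriv c (lie_vector v))"
    unfolding chart_deriv_lie_vector[OF assms] continuous_on_def
    using C1_map_on_tendsto[OF C1 1 tendsto_const tendsto_ident_at] by simp
qed

lemma chart_deriv_Xi_lie_vector: "chart_deriv \<Xi> (lie_vector v) = v"
proof -
  have "has_dir_deriv (\<lambda>x. x) (X \<one>) v v"
    by (rule C1_map_onD(3)[OF C2_map_on_imp_C1[OF C2_map_on_id[OF open_UNIV]]]) simp
  then have "has_dir_deriv (X \<circ> Y) (X \<one>) v v"
    by (rule has_dir_deriv_transform[OF _ Xi_inverse(6)]) (use one_in_W Xi_inverse(2) in auto)
  then show ?thesis using chart_deriv_lie_vector[OF chart_Xi] dir_deriv_eqI by metis
qed

end

context charted_lie_group
begin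

subsection \<open>Mackey convergence in the chart\<close>

abbreviation coord :: "(real \<Rightarrow> ('g, 'e) tvec) \<Rightarrow> real \<Rightarrow> 'e" where
  "coord \<phi> t \<equiv> chart_deriv \<Xi> (\<phi> t)"

lemma lie_curves_imp_lie_algebra: "\<phi> \<in> lie_curves k \<Longrightarrow> t \<in> {0..1} \<Longrightarrow> \<phi> t \<in> lie_algebra"
  by (simp add: lie_curves_def)

lemma lie_curves_Ck_curve:
  assumes "\<phi> \<in> lie_curves k" "Fin j \<preceq> k"
  shows "Ck_curve (enat j) (coord \<phi>)"
proof (cases k)
  case (Fin n)
  then have "Ck_curve (enat n) (chart_deriv \<Xi> \<circ> \<phi>)" "j \<le> n"
    using assms chart_Xi by (auto simp: lie_curves_def simp del: split_paired_All)
  then show ?thesis using Ck_curve_mono by (fastforce simp: o_def)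
next
  case Infty
  then have "Ck_curve \<infinity> (chart_deriv \<Xi> \<circ> \<phi>)"
    using assms chart_Xi by (auto simp: lie_curves_def simp del: split_paired_All)
  then show ?thesis using Ck_curve_mono by (fastforce simp: o_def)
qed (use assms in simp)

lemma p_lie_tvec_diff:
  assumes "has_chart_deriv \<Xi> Z w" "has_chart_deriv \<Xi> Z' w'"
  shows "p_lie p (tvec_diff Z Z') = p (w - w')"
  using has_chart_deriv_imp_eq[OF has_chart_deriv_tvec_diff[OF assms]] by (simp add: p_lie_def)

lemma p_lie_tvec_curve_deriv:
  "p_lie p (tvec_curve_deriv A \<one> m \<gamma> t) = p ((curve_deriv ^^ m) (coord \<gamma>) t)"
proof -
  have "has_chart_deriv \<Xi> (tvec_curve_deriv A \<one> m \<gamma> t) ((curve_deriv ^^ m) (coord \<gamma>) t)"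
    using chart_Xi by (auto simp: has_chart_deriv_def tvec_curve_deriv_def o_def simp del: split_paired_Ex)
  then show ?thesis using has_chart_deriv_imp_eq by (simp add: p_lie_def)
qed

lemma curve_seminorm_Fin_upper:
  assumes p: "continuous_seminorm p"
    and D: "\<And>t. t \<in> {0..1} \<Longrightarrow> D 0 t = coord \<gamma> t"
      "\<And>i t. i < j \<Longrightarrow> t \<in> {0..1} \<Longrightarrow> has_curve_deriv (D i) (D (Suc i) t) t {0..1}"
      "\<And>i. i \<le> j \<Longrightarrow> continuous_on {0..1} (D i)"
    and i: "i \<le> j" "t \<in> {0..1}"
  shows "p (D i t) \<le> curve_seminorm p (Fin j) \<gamma>"
proof -
  have eq: "p_lie p (tvec_curve_deriv A \<one> m \<gamma> t) = p (D m t)" if "m \<le> j" "t \<in> {0..1}" for m t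
    using funpow_curve_deriv_chain[of D "coord \<gamma>" j m t] D(1,2) that by (simp add: p_lie_tvec_curve_deriv)
  have "{p_lie p (tvec_curve_deriv A \<one> m \<gamma> t) | m t. m \<le> j \<and> t \<in> {0..1}} = (\<Union>m\<in>{..j}. (\<lambda>t. p (D m t)) ` {0..1})"
  proof (intro equalityI subsetI)
    fix x assume "x \<in> {p_lie p (tvec_curve_deriv A \<one> m \<gamma> t) | m t. m \<le> j \<and> t \<in> {0..1}}"
    then obtain m t where x: "x = p_lie p (tvec_curve_deriv A \<one> m \<gamma> t)" and mt: "m \<le> j" "t \<in> {0..1}" by blast
    have "x = p (D m t)" unfolding x by (rule eq[OF mt])
    then show "x \<in> (\<Union>m\<in>{..j}. (\<lambda>t. p (D m t)) ` {0..1})" using mt by blast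
  next
    fix x assume "x \<in> (\<Union>m\<in>{..j}. (\<lambda>t. p (D m t)) ` {0..1})"
    then obtain m t where "x = p (D m t)" "m \<le> j" "t \<in> {0..1}" by blast
    then show "x \<in> {p_lie p (tvec_curve_deriv A \<one> m \<gamma> t) | m t. m \<le> j \<and> t \<in> {0..1}}"
      using eq[of m t] by (metis (mono_tags, lifting) mem_Collect_eq)
  qed
  then have seminorm: "curve_seminorm p (Fin j) \<gamma> = Sup (\<Union>m\<in>{..j}. (\<lambda>t. p (D m t)) ` {0..1})"
    by (simp only: curve_seminorm_def regularity.case)
  \<comment> \<open>The supremum of an unbounded set of reals carries no information; continuity of
    the derivatives on a compact interval rules this out.\<close>
  have "bdd_above ((\<lambda>t. p (D m t)) ` {0..1})" if "m \<le> j" for m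
    using compact_seminorm_bounded[OF p compact_Icc D(3)[OF that]] by (meson bdd_aboveI2)
  then have "bdd_above (\<Union>m\<in>{..j}. (\<lambda>t. p (D m t)) ` {0..1})" by (subst bdd_above_UN) auto
  moreover have "p (D i t) \<in> (\<Union>m\<in>{..j}. (\<lambda>t. p (D m t)) ` {0..1})" using i by blast
  ultimately show ?thesis unfolding seminorm by (intro cSup_upper)
qed

text \<open>Mackey convergence with a prescribed rate and without thresholds; the rate is the same
  for all seminorms and orders.\<close>

definition mackey_rate :: "regularity \<Rightarrow> (nat \<Rightarrow> real) \<Rightarrow> (nat \<Rightarrow> real \<Rightarrow> ('g, 'e) tvec) \<Rightarrow> (real \<Rightarrow> ('g, 'e) tvec) \<Rightarrow> bool" where
  "mackey_rate k q \<phi>s \<phi> \<longleftrightarrow> (\<forall>p s. continuous_seminorm p \<and> s \<preceq> k \<longrightarrow>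
     (\<exists>C\<ge>0. \<forall>n. curve_seminorm p s (\<lambda>t. tvec_diff (\<phi> t) (\<phi>s n t)) \<le> C * q n))"

text \<open>As \<open>q\<close> is positive, the finitely many indices below \<open>l\<^sup>s\<^sub>p\<close> can be absorbed into the constant.\<close>

lemma mackey_converges_subseq:
  fixes q :: "nat \<Rightarrow> real"
  assumes conv: "mackey_converges k \<phi>s \<phi>" and q: "\<And>i. 0 < q i"
  obtains r where "r \<longlonglongrightarrow> 0"
    "\<And>f. (\<And>i. i \<le> f i) \<Longrightarrow> (\<And>i. r (f i) \<le> q i) \<Longrightarrow> mackey_rate k q (\<lambda>i. \<phi>s (f i)) \<phi>"
proof -
  obtain C :: "('e \<Rightarrow> real) \<Rightarrow> regularity \<Rightarrow> real" and L :: "('e \<Rightarrow> real) \<Rightarrow> regularity \<Rightarrow> nat" and r :: "nat \<Rightarrow> real"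
    where r: "\<forall>n. 0 \<le> r n" "r \<longlonglongrightarrow> 0"
      and CL: "\<forall>p s. continuous_seminorm p \<and> s \<preceq> k \<longrightarrow> 0 \<le> C p s \<and>
        (\<forall>n\<ge>L p s. curve_seminorm p s (\<lambda>t. tvec_diff (\<phi> t) (\<phi>s n t)) \<le> C p s * r n)"
    using conv unfolding mackey_converges_def by (elim exE conjE) (rule that)
  have "mackey_rate k q (\<lambda>i. \<phi>s (f i)) \<phi>" if f: "\<And>i. i \<le> f i" "\<And>i. r (f i) \<le> q i" for f
    unfolding mackey_rate_def
  proof (intro allI impI)
    fix p :: "'e \<Rightarrow> real" and s assume "continuous_seminorm p \<and> s \<preceq> k"
    then have C: "0 \<le> C p s" "\<forall>n\<ge>L p s. curve_seminorm p s (\<lambda>t. tvec_diff (\<phi> t) (\<phi>s n t)) \<le> C p s * r n"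
      using CL by simp_all
    define x where "x i = curve_seminorm p s (\<lambda>t. tvec_diff (\<phi> t) (\<phi>s (f i) t))" for i
    define D where "D = (\<Sum>i<L p s. \<bar>x i\<bar> / q i)"
    have D: "0 \<le> D" using q by (simp add: D_def sum_nonneg less_imp_le)
    have "x i \<le> (C p s + D) * q i" for i
    proof (cases "i < L p s")
      case True
      have "x i \<le> \<bar>x i\<bar> / q i * q i" using q[of i] by simp
      also have "\<bar>x i\<bar> / q i \<le> D"
        unfolding D_def using True q by (intro member_le_sum) (auto simp: less_imp_le)
      also have "D \<le> C p s + D" using C(1) by simp
      finally show ?thesis using q[of i] by (simp add: mult_right_mono)
    next
      case False
      then have "x i \<le> C p s * r (f i)" unfolding x_def using C(2) f(1)[of i] by simp
      also have "\<dots> \<le> C p s * q i" by (rule mult_left_mono[OF f(2) C(1)])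
      also have "\<dots> \<le> (C p s + D) * q i" using D q[of i] by (intro mult_right_mono) auto
      finally show ?thesis .
    qed
    then show "\<exists>C\<ge>0. \<forall>n. curve_seminorm p s (\<lambda>t. tvec_diff (\<phi> t) (\<phi>s (f n) t)) \<le> C * q n"
      unfolding x_def using C(1) D by (intro exI[of _ "C p s + D"]) simp
  qed
  then show ?thesis by (rule that[OF r(2)])
qed

lemma coord_tvec_diff:
  assumes "\<phi> \<in> lie_curves k" "\<psi> \<in> lie_curves k'" "t \<in> {0..1}"
  shows "has_chart_deriv \<Xi> (tvec_diff (\<phi> t) (\<psi> t)) (coord \<phi> t - coord \<psi> t)"
    "coord (\<lambda>t. tvec_diff (\<phi> t) (\<psi> t)) t = coord \<phi> t - coord \<psi> t"
proof -
  show *: "has_chart_deriv \<Xi> (tvec_diff (\<phi> t) (\<psi> t)) (coord \<phi> t - coord \<psi> t)"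
    using assms chart_Xi
    by (intro has_chart_deriv_tvec_diff has_chart_deriv_lie_algebra) (auto dest: lie_curves_imp_lie_algebra)
  show "coord (\<lambda>t. tvec_diff (\<phi> t) (\<psi> t)) t = coord \<phi> t - coord \<psi> t"
    by (rule has_chart_deriv_imp_eq[OF *])
qed

text \<open>Subtracting towers of derivatives for \<open>\<phi>s n\<close> and \<open>\<phi>\<close>
  level by level gives a tower for the difference, and \<open>curve_seminorm\<close> bounds each of
  its levels.\<close>

lemma mackey_rate_Ck:
  assumes \<phi>s: "\<And>n. \<phi>s n \<in> lie_curves k" and \<phi>: "\<phi> \<in> lie_curves k"
    and rate: "mackey_rate k q \<phi>s \<phi>" and j: "Fin j \<preceq> k"
  shows "mackey_Ck j {0..1} q (\<lambda>n t. coord (\<phi>s n) t - coord \<phi> t)"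
    "mackey_Ck j {0..1} (\<lambda>_. 1) (\<lambda>_. coord \<phi>)"
proof -
  define chain where "chain D \<gamma> \<longleftrightarrow> D 0 = \<gamma> \<and>
      (\<forall>i t. i < j \<longrightarrow> t \<in> {0..1} \<longrightarrow> has_curve_deriv (D i) (D (Suc i) t) t {0..1}) \<and>
      (\<forall>i\<le>j. continuous_on {0..1} (D i))" for D :: "nat \<Rightarrow> real \<Rightarrow> 'e" and \<gamma>
  have ex: "\<exists>D. chain D (coord \<psi>)" if \<psi>: "\<psi> \<in> lie_curves k" for \<psi>
    unfolding chain_def by (rule Ck_curve_chain[OF lie_curves_Ck_curve[OF \<psi> j]]) blast
  obtain D where D: "chain D (coord \<phi>)" using ex[OF \<phi>] by blast
  have "\<forall>n. \<exists>D. chain D (coord (\<phi>s n))" using ex \<phi>s by blast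
  then obtain Ds where Ds: "\<And>n. chain (Ds n) (coord (\<phi>s n))" by metis
  have D1: "has_curve_deriv (D i) (D (Suc i) t) t {0..1}"
    and Ds1: "has_curve_deriv (Ds n i) (Ds n (Suc i) t) t {0..1}" if "i < j" "t \<in> {0..1}" for i n t
    using D Ds[of n] that unfolding chain_def by blast+
  have D2: "continuous_on {0..1} (D i)" and Ds2: "continuous_on {0..1} (Ds n i)" if "i \<le> j" for i n
    using D Ds[of n] that unfolding chain_def by blast+
  have D0: "D 0 = coord \<phi>" and Ds0: "Ds n 0 = coord (\<phi>s n)" for n
    using D Ds[of n] unfolding chain_def by blast+
  have bnd: "mackey_bounded {0..1} q (\<lambda>n t. Ds n i t - D i t)" if i: "i \<le> j" for i
  proof (rule mackey_boundedI)
    fix p :: "'e \<Rightarrow> real" assume p: "continuous_seminorm p"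
    obtain C where C: "C \<ge> 0" "\<forall>n. curve_seminorm p (Fin j) (\<lambda>t. tvec_diff (\<phi> t) (\<phi>s n t)) \<le> C * q n"
      using rate p j unfolding mackey_rate_def by blast
    have "p (Ds n i t - D i t) \<le> C * q n" if "t \<in> {0..1}" for n t
    proof -
      have "p (D i t - Ds n i t) \<le> curve_seminorm p (Fin j) (\<lambda>t. tvec_diff (\<phi> t) (\<phi>s n t))"
      proof (rule curve_seminorm_Fin_upper[OF p, where D = "\<lambda>i t. D i t - Ds n i t"])
        show "D 0 t - Ds n 0 t = coord (\<lambda>t. tvec_diff (\<phi> t) (\<phi>s n t)) t" if "t \<in> {0..1}" for t
          using coord_tvec_diff(2)[OF \<phi> \<phi>s that] by (simp add: D0 Ds0)
        show "has_curve_deriv (\<lambda>t. D i t - Ds n i t) (D (Suc i) t - Ds n (Suc i) t) t {0..1}"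
          if "i < j" "t \<in> {0..1}" for i t
          by (rule has_curve_deriv_diff[OF D1[OF that] Ds1[OF that]])
        show "continuous_on {0..1} (\<lambda>t. D i t - Ds n i t)" if "i \<le> j" for i
          by (rule continuous_on_diff[OF D2[OF that] Ds2[OF that]])
      qed (use i that in auto)
      then show ?thesis
        using C(2)[rule_format, of n] seminorm_minus_commute[OF p, of "Ds n i t" "D i t"] by simp
    qed
    then show "\<exists>C\<ge>0. \<forall>n. \<forall>t\<in>{0..1}. p (Ds n i t - D i t) \<le> C * q n" using C(1) by blast
  qed
  have "mackey_Ck j {0..1} q (\<lambda>n t. Ds n 0 t - D 0 t)"
    by (rule mackey_Ck_chain[where D = "\<lambda>i n t. Ds n i t - D i t"])
      (use bnd in \<open>auto intro: has_curve_deriv_diff[OF Ds1 D1] continuous_on_diff[OF Ds2 D2]\<close>)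
  then show "mackey_Ck j {0..1} q (\<lambda>n t. coord (\<phi>s n) t - coord \<phi> t)" by (simp add: D0 Ds0)
  have "mackey_bounded {0..1} (\<lambda>_. 1) (\<lambda>_. D i)" if i: "i \<le> j" for i
  proof (rule mackey_boundedI)
    fix p :: "'e \<Rightarrow> real" assume p: "continuous_seminorm p"
    obtain C where "C \<ge> 0" "\<And>t. t \<in> {0..1} \<Longrightarrow> p (D i t) \<le> C"
      using compact_seminorm_bounded[OF p compact_Icc D2[OF i]] by blast
    then show "\<exists>C\<ge>0. \<forall>n::nat. \<forall>t\<in>{0..1}. p (D i t) \<le> C * 1" by (intro exI[of _ C]) auto
  qed
  then have "mackey_Ck j {0..1} (\<lambda>_. 1) (\<lambda>_. D 0)"
    by (intro mackey_Ck_chain[where D = "\<lambda>i _. D i"]) (auto intro: D1 D2)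
  then show "mackey_Ck j {0..1} (\<lambda>_. 1) (\<lambda>_. coord \<phi>)" by (simp add: D0)
qed

lemma difference_quotientsI:
  "s \<in> {0..1} \<Longrightarrow> t \<in> {0..1} \<Longrightarrow> s \<noteq> t \<Longrightarrow>
    p_lie p (tvec_diff (\<gamma> s) (\<gamma> t)) / \<bar>s - t\<bar> \<in> difference_quotients p \<gamma>"
  unfolding difference_quotients_def by blast

lemma lie_curves_Lipschitz:
  assumes \<phi>: "\<phi> \<in> lie_curves Lip" and p: "continuous_seminorm p"
  shows "\<exists>C\<ge>0. \<forall>s\<in>{0..1}. \<forall>t\<in>{0..1}. p (coord \<phi> s - coord \<phi> t) \<le> C * \<bar>s - t\<bar>"
proof -
  have "bdd_above (difference_quotients p \<phi>)" using \<phi> p by (simp add: lie_curves_def)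
  then obtain C where C: "\<And>x. x \<in> difference_quotients p \<phi> \<Longrightarrow> x \<le> C"
    unfolding bdd_above_def by blast
  have "p (coord \<phi> s - coord \<phi> t) \<le> \<bar>C\<bar> * \<bar>s - t\<bar>" if "s \<in> {0..1}" "t \<in> {0..1}" for s t
  proof (cases "s = t")
    case False
    have "p_lie p (tvec_diff (\<phi> s) (\<phi> t)) = p (coord \<phi> s - coord \<phi> t)"
      using \<phi> that chart_Xi
      by (intro p_lie_tvec_diff has_chart_deriv_lie_algebra) (auto dest: lie_curves_imp_lie_algebra)
    then have "p (coord \<phi> s - coord \<phi> t) / \<bar>s - t\<bar> \<in> difference_quotients p \<phi>"
      using difference_quotientsI[OF that False, of p \<phi>] by (simp only:)
    from C[OF this] have "p (coord \<phi> s - coord \<phi> t) \<le> C * \<bar>s - t\<bar>" using False by (simp add: field_simps)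
    also have "\<dots> \<le> \<bar>C\<bar> * \<bar>s - t\<bar>" by (intro mult_right_mono) auto
    finally show ?thesis .
  qed (simp add: seminorm_zero[OF p])
  then show ?thesis by (intro exI[of _ "\<bar>C\<bar>"]) auto
qed

lemma Lipschitz_bounded:
  assumes p: "continuous_seminorm p" and C: "C \<ge> 0" "\<And>s t. s \<in> {0..1} \<Longrightarrow> t \<in> {0..1} \<Longrightarrow> p (f s - f t) \<le> C * \<bar>s - t\<bar>"
    and t: "t \<in> {0..1::real}"
  shows "p (f t) \<le> C + p (f 0)"
proof -
  have "p (f t) \<le> p (f t - f 0) + p (f 0)" using seminorm_triangle[OF p, of "f t - f 0" "f 0"] by simp
  also have "p (f t - f 0) \<le> C * \<bar>t - 0\<bar>" using t by (intro C) auto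
  also have "\<dots> \<le> C * 1" using t C(1) by (intro mult_left_mono) auto
  finally show ?thesis by simp
qed

lemma mackey_rate_Lip:
  assumes \<phi>s: "\<And>n. \<phi>s n \<in> lie_curves Lip" and \<phi>: "\<phi> \<in> lie_curves Lip"
    and rate: "mackey_rate Lip q \<phi>s \<phi>"
  shows "mackey_Lip {0..1} q (\<lambda>n t. coord (\<phi>s n) t - coord \<phi> t)"
    "mackey_bounded {0..1} (\<lambda>_. 1) (\<lambda>_. coord \<phi>)"
proof -
  define \<delta> where "\<delta> n t = coord \<phi> t - coord (\<phi>s n) t" for n t
  define \<Delta> where "\<Delta> n t = tvec_diff (\<phi> t) (\<phi>s n t)" for n t
  have \<Delta>: "has_chart_deriv \<Xi> (\<Delta> n t) (\<delta> n t)" if "t \<in> {0..1}" for n t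
    unfolding \<Delta>_def \<delta>_def by (rule coord_tvec_diff(1)[OF \<phi> \<phi>s that])
  have \<delta>_Lip: "\<exists>C\<ge>0. \<forall>s\<in>{0..1}. \<forall>t\<in>{0..1}. p (\<delta> n s - \<delta> n t) \<le> C * \<bar>s - t\<bar>" if p: "continuous_seminorm p" for p n
  proof -
    obtain C where C: "C \<ge> 0" "\<forall>s\<in>{0..1}. \<forall>t\<in>{0..1}. p (coord \<phi> s - coord \<phi> t) \<le> C * \<bar>s - t\<bar>"
      using lie_curves_Lipschitz[OF \<phi> p] by blast
    obtain D where D: "D \<ge> 0" "\<forall>s\<in>{0..1}. \<forall>t\<in>{0..1}. p (coord (\<phi>s n) s - coord (\<phi>s n) t) \<le> D * \<bar>s - t\<bar>"
      using lie_curves_Lipschitz[OF \<phi>s p] by blast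
    have "p (\<delta> n s - \<delta> n t) \<le> (C + D) * \<bar>s - t\<bar>" if st: "s \<in> {0..1}" "t \<in> {0..1}" for s t
    proof -
      have "\<delta> n s - \<delta> n t = (coord \<phi> s - coord \<phi> t) - (coord (\<phi>s n) s - coord (\<phi>s n) t)"
        by (simp add: \<delta>_def)
      then have "p (\<delta> n s - \<delta> n t) \<le> p (coord \<phi> s - coord \<phi> t) + p (coord (\<phi>s n) s - coord (\<phi>s n) t)"
        by (simp only: seminorm_diff[OF p])
      also have "\<dots> \<le> C * \<bar>s - t\<bar> + D * \<bar>s - t\<bar>" using C(2) D(2) st by (intro add_mono) blast+
      finally show ?thesis by (simp only: distrib_right)
    qed
    then show ?thesis using C(1) D(1) by (intro exI[of _ "C + D"]) auto
  qed
  have main: "\<exists>C\<ge>0. \<forall>n. (\<forall>t\<in>{0..1}. p (\<delta> n t) \<le> C * q n) \<and>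
      (\<forall>s\<in>{0..1}. \<forall>t\<in>{0..1}. p (\<delta> n s - \<delta> n t) \<le> C * q n * \<bar>s - t\<bar>)" if p: "continuous_seminorm p" for p
  proof -
    obtain C where C: "C \<ge> 0" "\<forall>n. curve_seminorm p Lip (\<lambda>t. tvec_diff (\<phi> t) (\<phi>s n t)) \<le> C * q n"
      using rate p unfolding mackey_rate_def by (metis reg_prec.simps(1))
    have "p (\<delta> n t) \<le> C * q n \<and> p (\<delta> n s - \<delta> n t) \<le> C * q n * \<bar>s - t\<bar>"
      if st: "s \<in> {0..1}" "t \<in> {0..1}" for n s t
    proof -
      obtain K where K: "K \<ge> 0" "\<forall>s\<in>{0..1}. \<forall>t\<in>{0..1}. p (\<delta> n s - \<delta> n t) \<le> K * \<bar>s - t\<bar>"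
        using \<delta>_Lip[OF p] by blast
      have le: "max (SUP t\<in>{0..1}. p_lie p (\<Delta> n t)) (Sup (difference_quotients p (\<Delta> n))) \<le> C * q n"
        using C(2) by (simp add: curve_seminorm_def Lip_const_def \<Delta>_def[abs_def])
      have pl: "p_lie p (\<Delta> n t) = p (\<delta> n t)" if "t \<in> {0..1}" for t
        using has_chart_deriv_imp_eq[OF \<Delta>[OF that]] by (simp add: p_lie_def)
      \<comment> \<open>Both suprema in the seminorm must be known to be of bounded sets before they
        bound anything. For fixed \<open>n\<close> this follows from \<open>\<delta>_Lip\<close>,
        whose constant may depend on \<open>n\<close>.\<close>
      have "bdd_above ((\<lambda>t. p_lie p (\<Delta> n t)) ` {0..1})"
        using Lipschitz_bounded[OF p K(1), of "\<delta> n"] K(2) pl by (intro bdd_aboveI2[of _ _ "K + p (\<delta> n 0)"]) auto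
      then have "p_lie p (\<Delta> n t) \<le> (SUP t\<in>{0..1}. p_lie p (\<Delta> n t))" using st(2) by (intro cSUP_upper)
      then have 1: "p (\<delta> n t) \<le> C * q n" using le pl[OF st(2)] by simp
      have dq: "p_lie p (tvec_diff (\<Delta> n s) (\<Delta> n t)) = p (\<delta> n s - \<delta> n t)" if "s \<in> {0..1}" "t \<in> {0..1}" for s t
        using that by (intro p_lie_tvec_diff \<Delta>)
      have "p (\<delta> n s - \<delta> n t) \<le> C * q n * \<bar>s - t\<bar>"
      proof (cases "s = t")
        case False
        have "bdd_above (difference_quotients p (\<Delta> n))"
        proof (rule bdd_aboveI)
          fix x assume "x \<in> difference_quotients p (\<Delta> n)"
          then obtain s t where st: "s \<in> {0..1}" "t \<in> {0..1}" "s \<noteq> t" "x = p (\<delta> n s - \<delta> n t) / \<bar>s - t\<bar>"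
            using dq unfolding difference_quotients_def by auto
          then have "p (\<delta> n s - \<delta> n t) \<le> K * \<bar>s - t\<bar>" using K(2) by blast
          then show "x \<le> K" using st(3,4) by (simp add: pos_divide_le_eq)
        qed
        moreover have "p (\<delta> n s - \<delta> n t) / \<bar>s - t\<bar> \<in> difference_quotients p (\<Delta> n)"
          using difference_quotientsI[OF st False, of p "\<Delta> n"] by (simp only: dq[OF st])
        ultimately have "p (\<delta> n s - \<delta> n t) / \<bar>s - t\<bar> \<le> Sup (difference_quotients p (\<Delta> n))"
          by (intro cSup_upper)
        then have "p (\<delta> n s - \<delta> n t) / \<bar>s - t\<bar> \<le> C * q n" using le by simp
        then show ?thesis using False by (simp add: field_simps)
      qed (simp add: seminorm_zero[OF p])
      then show ?thesis using 1 by blast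
    qed
    then show ?thesis using C(1) by blast
  qed
  have neg: "p (coord (\<phi>s n) t - coord \<phi> t) = p (\<delta> n t)"
    "p (coord (\<phi>s n) s - coord \<phi> s - (coord (\<phi>s n) t - coord \<phi> t)) = p (\<delta> n s - \<delta> n t)"
    if p: "continuous_seminorm p" for p n s t
  proof -
    show "p (coord (\<phi>s n) t - coord \<phi> t) = p (\<delta> n t)"
      unfolding \<delta>_def by (rule seminorm_minus_commute[OF p])
    have "coord (\<phi>s n) s - coord \<phi> s - (coord (\<phi>s n) t - coord \<phi> t) = - (\<delta> n s - \<delta> n t)" by (simp add: \<delta>_def)
    then show "p (coord (\<phi>s n) s - coord \<phi> s - (coord (\<phi>s n) t - coord \<phi> t)) = p (\<delta> n s - \<delta> n t)"
      by (simp only: seminorm_minus[OF p])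
  qed
  show "mackey_Lip {0..1} q (\<lambda>n t. coord (\<phi>s n) t - coord \<phi> t)"
    by (rule mackey_LipI) (simp only: neg main)
  show "mackey_bounded {0..1} (\<lambda>_. 1) (\<lambda>_. coord \<phi>)"
  proof (rule mackey_boundedI)
    fix p :: "'e \<Rightarrow> real" assume p: "continuous_seminorm p"
    obtain C where C: "C \<ge> 0" "\<forall>s\<in>{0..1}. \<forall>t\<in>{0..1}. p (coord \<phi> s - coord \<phi> t) \<le> C * \<bar>s - t\<bar>"
      using lie_curves_Lipschitz[OF \<phi> p] by blast
    have "p (coord \<phi> t) \<le> C + p (coord \<phi> 0)" if "t \<in> {0..1}" for t
      using C(2) by (intro Lipschitz_bounded[OF p C(1) _ that]) blast
    then show "\<exists>C\<ge>0. \<forall>n::nat. \<forall>t\<in>{0..1}. p (coord \<phi> t) \<le> C * 1"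
      using C(1) seminorm_nonneg[OF p] by (intro exI[of _ "C + p (coord \<phi> 0)"]) auto
  qed
qed

text \<open>The two premises together cover every \<open>k\<close>: no \<open>Fin j\<close> precedes
  \<open>Lip\<close>, so the Lipschitz class is described by the second one.\<close>

lemma lie_vector_in_lie_curves:
  assumes "\<And>j. Fin j \<preceq> k \<Longrightarrow> Ck_on j UNIV \<psi>"
    and "k = Lip \<Longrightarrow> (\<And>p. continuous_seminorm p \<Longrightarrow> \<exists>K. \<forall>s t. p (\<psi> s - \<psi> t) \<le> K * \<bar>s - t\<bar>)"
  shows "(\<lambda>t. lie_vector (\<psi> t)) \<in> lie_curves k"
proof -
  have Ck: "Ck_on j UNIV (chart_deriv c \<circ> (\<lambda>t. lie_vector (\<psi> t)))"
    if "Fin j \<preceq> k" "c \<in> charts_at A \<one>" for j c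
    using Ck_on_linear[of "\<lambda>v. chart_deriv c (lie_vector v)", OF chart_deriv_lie_vector_C1[OF that(2)] assms(1)[OF that(1)]]
    by (simp add: o_def)
  show ?thesis
  proof (cases k)
    case (Fin n)
    then have "\<forall>c\<in>charts_at A \<one>. Ck_curve (enat n) (chart_deriv c \<circ> (\<lambda>t. lie_vector (\<psi> t)))"
      using Ck Ck_curve_fin by (metis order_refl reg_prec.simps(2))
    then show ?thesis using Fin lie_vector_in_lie_algebra by (simp add: lie_curves_def)
  next
    case Infty
    then have "\<forall>c\<in>charts_at A \<one>. Ck_curve \<infinity> (chart_deriv c \<circ> (\<lambda>t. lie_vector (\<psi> t)))"
      using Ck Ck_curve_infinity by (metis reg_prec.simps(3))
    then show ?thesis using Infty lie_vector_in_lie_algebra by (simp add: lie_curves_def)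
  next
    case Lip
    have "bdd_above (difference_quotients p (\<lambda>t. lie_vector (\<psi> t)))" if p: "continuous_seminorm p" for p
    proof -
      obtain K where K: "\<And>s t. p (\<psi> s - \<psi> t) \<le> K * \<bar>s - t\<bar>" using assms(2)[OF Lip p] by blast
      have eq: "p_lie p (tvec_diff (lie_vector (\<psi> s)) (lie_vector (\<psi> t))) = p (\<psi> s - \<psi> t)" for s t
        using p_lie_tvec_diff[OF has_chart_deriv_lie_algebra[OF lie_vector_in_lie_algebra chart_Xi]
            has_chart_deriv_lie_algebra[OF lie_vector_in_lie_algebra chart_Xi]]
        by (simp add: chart_deriv_Xi_lie_vector)
      show ?thesis
      proof (rule bdd_aboveI)
        fix x assume "x \<in> difference_quotients p (\<lambda>t. lie_vector (\<psi> t))"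
        then obtain s t where "s \<noteq> t" "x = p (\<psi> s - \<psi> t) / \<bar>s - t\<bar>"
          unfolding difference_quotients_def eq by auto
        then show "x \<le> K" using K[of s t] by (simp add: pos_divide_le_eq)
      qed
    qed
    then show ?thesis using Lip lie_vector_in_lie_algebra by (simp add: lie_curves_def)
  qed
qed

end

section \<open>The contradiction argument\<close>

lemma (in charted_lie_group) semiregular_imp_mackey_continuous:
  assumes semireg: "semiregular k"
  shows "mackey_continuous k"
  unfolding mackey_continuous_def
proof (intro allI impI)
  fix \<phi>s :: "nat \<Rightarrow> real \<Rightarrow> ('g, 'e) tvec" and \<phi> U
  assume conv: "(\<forall>n. \<phi>s n \<in> log_derivs_of_class k) \<and> \<phi> \<in> log_derivs_of_class k \<and> mackey_converges k \<phi>s \<phi>"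
    and U: "open U \<and> \<one> \<in> U"
  define \<eta> where "\<eta> n t = inv (Evol \<phi> t) \<otimes> Evol (\<phi>s n) t" for n t
  have \<phi>: "\<phi> \<in> log_derivs" "\<phi> \<in> lie_curves k" and \<phi>s: "\<And>n. \<phi>s n \<in> log_derivs" "\<And>n. \<phi>s n \<in> lie_curves k"
    using conv by (auto simp: log_derivs_of_class_def)
  define \<delta> where "\<delta> n t = coord (\<phi>s n) t - coord \<phi> t" for n t
  define T where "T t v = Ad (inv (Evol \<phi> t)) v" for t v
  have E: "has_right_log_deriv (Evol \<phi>) (coord \<phi> t) t {0..1}" if "t \<in> {0..1}" for t
    by (rule Evol_has_right_log_deriv(2)[OF \<phi>(1) that])
  have \<eta>_deriv: "has_right_log_deriv (\<eta> n) (T t (\<delta> n t)) t {0..1}" if "t \<in> {0..1}" for n t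
    unfolding \<eta>_def[abs_def] T_def \<delta>_def
    by (rule has_right_log_deriv_quotient[OF E[OF that] Evol_has_right_log_deriv(2)[OF \<phi>s(1) that]])
  have \<eta>_0: "\<eta> n 0 = \<one>" for n
    by (simp add: \<eta>_def Evol_has_right_log_deriv(1)[OF \<phi>(1)] Evol_has_right_log_deriv(1)[OF \<phi>s(1)] group_simps)
  have "continuous_on {0..1} (Evol \<phi>)"
    using E unfolding continuous_on_def has_right_log_deriv_def by blast
  then have T_cont: "continuous_on ({0..1} \<times> UNIV) (\<lambda>(t, v). T t v)"
    unfolding T_def by (rule Ad_inv_continuous_on)
  have T_add: "T t (v + w) = T t v + T t w" and T_scaleR: "T t (a *\<^sub>R v) = a *\<^sub>R T t v" for t v w a
    by (simp_all add: T_def Ad_add Ad_scaleR)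
  obtain b where b: "continuous_bilinear b" and T_deriv:
    "\<And>t v. t \<in> {0..1} \<Longrightarrow> has_curve_deriv (\<lambda>s. T s v) (T t (b (coord \<phi> t) v)) t {0..1}"
    using Ad_inv_has_curve_deriv E unfolding T_def by blast

  have "\<exists>N. \<forall>n\<ge>N. \<forall>t\<in>{0..1}. \<eta> n t \<in> U"
  proof (rule ccontr)
    assume bad: "\<not> ?thesis"
    \<comment> \<open>Each \<open>q i\<close> must be positive, both to be undercut by the null
      sequence \<open>r\<close> and to absorb finitely many indices into the constants.\<close>
    obtain q :: "nat \<Rightarrow> real" where q: "rapidly_decreasing q" "\<And>i. 0 < q i"
      by (rule ex_rapidly_decreasing, rule that)
    obtain r where r: "r \<longlonglongrightarrow> 0"
      and rate: "\<And>f. (\<And>i. i \<le> f i) \<Longrightarrow> (\<And>i. r (f i) \<le> q i) \<Longrightarrow> mackey_rate k q (\<lambda>i. \<phi>s (f i)) \<phi>"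
      by (rule mackey_converges_subseq[where q = q, OF conv[THEN conjunct2, THEN conjunct2] q(2)]) (rule that, assumption, blast)
    \<comment> \<open>Requiring \<open>i \<le> n\<close> makes the chosen index pass each threshold
      of the convergence as soon as \<open>i\<close> does.\<close>
    have "\<exists>n t. i \<le> n \<and> r n \<le> q i \<and> t \<in> {0..1} \<and> \<eta> n t \<notin> U" for i
    proof -
      have "eventually (\<lambda>n. r n < q i) sequentially" using order_tendstoD(2)[OF r q(2)] .
      then obtain M where M: "\<And>n. n \<ge> M \<Longrightarrow> r n < q i" by (auto simp: eventually_sequentially)
      obtain n t where "n \<ge> max i M" "t \<in> {0..1}" "\<eta> n t \<notin> U" using bad by blast
      then show ?thesis using M[of n] by (intro exI[of _ n] exI[of _ t]) auto
    qed
    then obtain f \<tau> where f: "\<And>i. i \<le> f i" "\<And>i. r (f i) \<le> q i"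
      and \<tau>: "\<And>i. \<tau> i \<in> {0..1}" "\<And>i. \<eta> (f i) (\<tau> i) \<notin> U"
      by metis
    have rate_f: "mackey_rate k q (\<lambda>i. \<phi>s (f i)) \<phi>" by (rule rate) (rule f)+
    obtain \<sigma> \<beta> :: "real \<Rightarrow> real" and K where
      \<sigma>: "\<And>t. has_curve_deriv \<sigma> (\<beta> t) t UNIV" "\<And>t. \<sigma> t \<in> {0..1}" "\<And>t. t \<le> 0 \<Longrightarrow> \<sigma> t = 0" "\<And>t. 1 \<le> t \<Longrightarrow> \<sigma> t = 1"
      and \<beta>: "\<And>t. t \<le> 0 \<or> 1 \<le> t \<Longrightarrow> \<beta> t = 0" "\<And>j. mackey_Ck j UNIV (\<lambda>_. 1) (\<lambda>_. \<beta>)" "\<And>t. \<bar>\<beta> t\<bar> \<le> K"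
      and Lip: "\<And>s t. \<bar>\<sigma> s - \<sigma> t\<bar> \<le> K * \<bar>s - t\<bar>" "\<And>s t. \<bar>\<beta> s - \<beta> t\<bar> \<le> K * \<bar>s - t\<bar>"
      by (rule smooth_step, rule that)
    define \<zeta> where "\<zeta> i t = T t (\<delta> (f i) t)" for i t
    \<comment> \<open>The logarithmic derivative of \<open>\<eta> (f i)\<close> along
      \<open>\<sigma> (2 ^ Suc i * s - 1)\<close>, written in the variable
      \<open>u = 2 ^ Suc i * s - 1\<close>. The chain rule contributes \<open>\<beta> u\<close> and
      the dilation factor.\<close>
    define P where "P i u = (2 ^ Suc i :: real) *\<^sub>R (\<beta> u *\<^sub>R \<zeta> i (\<sigma> u))" for i u
    define \<psi> where "\<psi> = glue P"
    have P: "unit_supported P" using \<beta>(1) by (auto simp: unit_supported_def P_def)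
    \<comment> \<open>The factor \<open>2 ^ Suc i\<close> in \<open>P\<close> worsens the rate by
      one power, which rapid decrease tolerates.\<close>
    note q' = rapidly_decreasing_scale[OF q(1)]
    have "Ck_on j UNIV \<psi>" if j: "Fin j \<preceq> k" for j
    proof -
      have "mackey_Ck j {0..1} q (\<lambda>i. \<delta> (f i))" and coord: "mackey_Ck j {0..1} (\<lambda>_. 1) (\<lambda>_. coord \<phi>)"
        using mackey_rate_Ck[OF \<phi>s(2) \<phi>(2) rate_f j] by (simp_all add: \<delta>_def[abs_def])
      from mackey_Ck_operator[OF compact_Icc T_cont T_add T_scaleR b T_deriv coord this(1)]
      have "mackey_Ck j {0..1} q \<zeta>" by (simp add: \<zeta>_def[abs_def])
      then have "mackey_Ck j UNIV q (\<lambda>i u. \<zeta> i (\<sigma> u))"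
        by (rule mackey_Ck_compose[OF \<sigma>(1,2) \<beta>(2)])
      from mackey_Ck_scale[OF mackey_Ck_bilinear[OF continuous_bilinear_scaleR \<beta>(2) this], of "\<lambda>i. 2 ^ Suc i"]
      have "mackey_Ck j UNIV (\<lambda>i. \<bar>2 ^ Suc i\<bar> * q i) P" by (simp add: P_def[abs_def])
      then show ?thesis unfolding \<psi>_def by (rule glue_Ck_on[OF P _ q'])
    qed
    moreover have "\<exists>L. \<forall>s t. p (\<psi> s - \<psi> t) \<le> L * \<bar>s - t\<bar>" if k: "k = Lip" and p: "continuous_seminorm p" for p
    proof -
      have "mackey_Lip {0..1} q (\<lambda>i. \<delta> (f i))" and coord: "mackey_bounded {0..1} (\<lambda>_. 1) (\<lambda>_. coord \<phi>)"
        using mackey_rate_Lip[of "\<lambda>i. \<phi>s (f i)" \<phi> q] \<phi>s(2) \<phi>(2) rate_f by (simp_all add: \<delta>_def[abs_def] k)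
      from mackey_Lip_operator[OF T_cont T_add T_scaleR b T_deriv coord this(1) less_imp_le[OF q(2)]]
      have "mackey_Lip {0..1} q \<zeta>" by (simp add: \<zeta>_def[abs_def])
      then have "mackey_Lip UNIV q (\<lambda>i u. \<beta> u *\<^sub>R \<zeta> i (\<sigma> u))"
        by (rule mackey_Lip_compose[OF _ less_imp_le[OF q(2)] \<sigma>(2) Lip(1) \<beta>(3) Lip(2)])
      from mackey_Lip_scale[OF this, of "\<lambda>i. 2 ^ Suc i"]
      have PL: "mackey_Lip UNIV (\<lambda>i. \<bar>2 ^ Suc i\<bar> * q i) P" by (simp add: P_def[abs_def])
      show ?thesis unfolding \<psi>_def by (rule glue_Lipschitz[OF P PL q' p]) blast
    qed
    ultimately have "(\<lambda>t. lie_vector (\<psi> t)) \<in> lie_curves k" by (rule lie_vector_in_lie_curves)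
    then have "(\<lambda>t. lie_vector (\<psi> t)) \<in> log_derivs"
      using semireg by (auto simp: semiregular_def log_derivs_of_class_def)
    then obtain \<mu> where \<mu>: "\<mu> \<in> C1_curves A" "\<And>t. t \<in> {0..1} \<Longrightarrow> lie_vector (\<psi> t) = right_log_deriv \<mu> t"
      unfolding log_derivs_def by blast
    have \<mu>_deriv: "has_right_log_deriv \<mu> (\<psi> t) t {0..1}" if "t \<in> {0..1}" for t
      using has_right_log_deriv_C1_curve[OF \<mu>(1) that] by (simp add: \<mu>(2)[OF that, symmetric] chart_deriv_Xi_lie_vector)

    \<comment> \<open>\<open>a i\<close> and \<open>2 * a i\<close> are the end points of the
      interval that carries \<open>P i\<close>.\<close>
    define a where "a i = inverse (2 ^ Suc i :: real)" for i
    have a: "0 < a i" "2 * a i \<le> 1" for i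
      using one_le_power[of "2::real" i] by (auto simp: a_def field_simps)
    \<comment> \<open>Both sides have logarithmic derivative \<open>\<psi>\<close> on the interval
      and equal the unit at \<open>a i\<close>, where the reparametrisation starts at time
      0.\<close>
    have piece: "\<eta> (f i) (\<sigma> (2 ^ Suc i * t - 1)) = \<mu> t \<otimes> inv (\<mu> (a i))" if t: "a i \<le> t" "t \<le> 2 * a i" for i t
    proof -
      define \<theta> where "\<theta> s = \<sigma> (2 ^ Suc i * s - 1)" for s
      have "has_right_log_deriv (\<lambda>s. inv (\<eta> (f i) (\<theta> s)) \<otimes> \<mu> s) 0 s {a i..t}" if s: "s \<in> {a i..t}" for s
      proof -
        have s01: "s \<in> {0..1}" "{a i..t} \<subseteq> {0..1}" using s t a[of i] by auto
        have range: "1 \<le> 2 ^ Suc i * s" "2 ^ Suc i * s \<le> 2"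
        proof -
          have "2 ^ Suc i * a i \<le> 2 ^ Suc i * s" "2 ^ Suc i * s \<le> 2 ^ Suc i * (2 * a i)"
            using s t by (intro mult_left_mono; simp)+
          then show "1 \<le> 2 ^ Suc i * s" "2 ^ Suc i * s \<le> 2" by (simp_all add: a_def)
        qed
        have "has_curve_deriv \<theta> (2 ^ Suc i *\<^sub>R \<beta> (2 ^ Suc i * s - 1)) s {a i..t}"
          unfolding \<theta>_def[abs_def] by (rule has_curve_deriv_mono[OF has_curve_deriv_dilate[OF \<sigma>(1)]]) simp
        moreover have \<theta>_01: "\<theta> s \<in> {0..1}" for s unfolding \<theta>_def by (rule \<sigma>(2))
        ultimately have "has_right_log_deriv (\<lambda>s. \<eta> (f i) (\<theta> s)) ((2 ^ Suc i *\<^sub>R \<beta> (2 ^ Suc i * s - 1)) *\<^sub>R \<zeta> i (\<theta> s)) s {a i..t}"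
          unfolding \<zeta>_def by (intro has_right_log_deriv_compose[where \<sigma> = \<theta> and T = "{0..1}"] \<eta>_deriv)
        moreover have "(2 ^ Suc i *\<^sub>R \<beta> (2 ^ Suc i * s - 1)) *\<^sub>R \<zeta> i (\<theta> s) = \<psi> s"
          unfolding \<psi>_def glue_eq[OF P range] by (simp add: P_def \<theta>_def)
        ultimately have "has_right_log_deriv (\<lambda>s. \<eta> (f i) (\<theta> s)) (\<psi> s) s {a i..t}" by simp
        \<comment> \<open>The two derivatives coincide, so the quotient rule yields the adjoint
          action on 0, which vanishes by homogeneity.\<close>
        from has_right_log_deriv_quotient[OF this has_right_log_deriv_mono[OF \<mu>_deriv[OF s01(1)] s01(2)]]
        show ?thesis using Ad_scaleR[of _ 0 0] by simp
      qed
      then have "inv (\<eta> (f i) (\<theta> t)) \<otimes> \<mu> t = inv (\<eta> (f i) (\<theta> (a i))) \<otimes> \<mu> (a i)"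
        by (rule has_right_log_deriv_zero_constant[OF t(1)])
      moreover have "\<theta> (a i) = 0" by (simp add: \<theta>_def a_def \<sigma>(3))
      ultimately have "inv (\<eta> (f i) (\<theta> t)) \<otimes> \<mu> t = \<mu> (a i)" by (simp add: \<eta>_0 group_simps)
      then have "\<eta> (f i) (\<theta> t) \<otimes> (inv (\<eta> (f i) (\<theta> t)) \<otimes> \<mu> t) \<otimes> inv (\<mu> (a i)) = \<eta> (f i) (\<theta> t) \<otimes> \<mu> (a i) \<otimes> inv (\<mu> (a i))"
        by simp
      then show ?thesis by (simp add: group_simps \<theta>_def)
    qed
    \<comment> \<open>The step takes every value in \<open>{0..1}\<close>, so the time
      \<open>\<tau> i\<close> at which \<open>\<eta> (f i)\<close> is outside \<open>U\<close> is
      \<open>\<sigma> u\<close> for some \<open>u\<close>; the affine map onto the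
      \<open>i\<close>-th interval sends \<open>u\<close> to the witness \<open>t\<close>.\<close>
    have "\<exists>t. a i \<le> t \<and> t \<le> 2 * a i \<and> \<mu> t \<otimes> inv (\<mu> (a i)) \<notin> U" for i
    proof -
      have "continuous_on {0..1} \<sigma>"
        using has_curve_deriv_continuous_on[of UNIV \<sigma> \<beta>] \<sigma>(1) continuous_on_subset by blast
      then obtain u where u: "0 \<le> u" "u \<le> 1" "\<sigma> u = \<tau> i"
        using IVT'[of \<sigma> 0 "\<tau> i" 1] \<tau>(1)[of i] \<sigma>(3)[of 0] \<sigma>(4)[of 1] by auto
      define t where "t = a i * (u + 1)"
      have "a i * 1 \<le> a i * (u + 1)" "a i * (u + 1) \<le> a i * 2"
        using u a[of i] by (intro mult_left_mono; simp)+
      then have t: "a i \<le> t" "t \<le> 2 * a i" by (simp_all add: t_def mult.commute)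
      moreover have "2 ^ Suc i * t - 1 = u" by (simp add: t_def a_def mult.assoc[symmetric])
      ultimately show ?thesis using piece[OF t] u(3) \<tau>(2)[of i] by (intro exI[of _ t]) simp
    qed
    then obtain t where t: "\<And>i. a i \<le> t i" "\<And>i. t i \<le> 2 * a i" "\<And>i. \<mu> (t i) \<otimes> inv (\<mu> (a i)) \<notin> U"
      by metis
    have a_lim: "a \<longlonglongrightarrow> 0"
      unfolding a_def using LIMSEQ_Suc[OF LIMSEQ_inverse_realpow_zero[of 2]] by simp
    have t_lim: "t \<longlonglongrightarrow> 0"
    proof (rule tendsto_sandwich[OF _ _ tendsto_const])
      show "eventually (\<lambda>i. 0 \<le> t i) sequentially" using a(1) t(1) by (intro always_eventually) (meson less_imp_le order_trans)
      show "eventually (\<lambda>i. t i \<le> 2 * a i) sequentially" using t(2) by (intro always_eventually) blast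
      show "(\<lambda>i. 2 * a i) \<longlonglongrightarrow> 0" using tendsto_mult_right_zero[OF a_lim] .
    qed
    have \<mu>_lim: "(\<lambda>i. \<mu> (x i)) \<longlonglongrightarrow> \<mu> 0" if "x \<longlonglongrightarrow> 0" "\<And>i. x i \<in> {0..1}" for x :: "nat \<Rightarrow> real"
    proof -
      have "continuous (at 0 within {0..1}) \<mu>"
        using C1_curve_continuous[OF \<mu>(1), of 0] by (simp add: continuous_within)
      then show ?thesis
        by (rule continuous_within_tendsto_compose[OF _ always_eventually that(1)]) (use that(2) in blast)
    qed
    have "a i \<in> {0..1}" "t i \<in> {0..1}" for i
      using a[of i] t(1,2)[of i] by auto
    \<comment> \<open>The intervals shrink to 0, so both factors converge to values at 0 and the
      quotients are forced into \<open>U\<close>.\<close>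
    then have "(\<lambda>i. \<mu> (t i) \<otimes> inv (\<mu> (a i))) \<longlonglongrightarrow> \<mu> 0 \<otimes> inv (\<mu> 0)"
      by (intro tendsto_mult_group tendsto_inv_group \<mu>_lim a_lim t_lim)
    then have "eventually (\<lambda>i. \<mu> (t i) \<otimes> inv (\<mu> (a i)) \<in> U) sequentially"
      using U by (intro topological_tendstoD) (auto simp: group_simps)
    then show False using t(3) by (auto simp: eventually_sequentially)
  qed
  then show "\<exists>N. \<forall>n\<ge>N. \<forall>t\<in>{0..1}. inv (Evol \<phi> t) \<otimes> Evol (\<phi>s n) t \<in> U"
    by (simp add: \<eta>_def)
qed

theorem theoremC:
  fixes G :: "('g::t2_space, 'b) monoid_scheme"
    and A :: "('g, 'e::locally_convex_space) chart set"
    and \<Xi> :: "('g, 'e) chart"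
    and k :: regularity
  assumes "charted_lie_group G A \<Xi>"
    and "charted_lie_group.semiregular G A \<Xi> k"
  shows "charted_lie_group.mackey_continuous G A \<Xi> k"
  using charted_lie_group.semiregular_imp_mackey_continuous[OF assms] .

end
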